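(* Let $X$ be a smooth projective curve of genus $2$ over an algebraically closed field $k$ of characteristic $p$, and let $L_\theta$ be a chosen theta characteristic on $X$. Suppose $p=2$. 1. If $(V,\phi)\in S_\theta(L_\theta)$, then either $V\in S_\theta$ or $V\in J_2(\mathcal{O}_X\oplus L_\theta)$. 2. There exist Higgs fields $\phi_0$ and $\phi_1$ such that $(W,\phi_0)$ and $(V,\phi_1)$ are Frobenius semi-stable for all $W\in J_2(\mathcal{O}_X\oplus L_\theta)$ and all $V\in J_2(V_1)$.
   Context: $\Omega$ is the canonical bundle of $X$; a theta characteristic is a line bundle $L_\theta$ of degree $1$ with $L_\theta^{2}\cong\Omega$. $F:X\to X$ is the absolute Frobenius, $f\mapsto f^p$ on local sections of $\mathcal{O}_X$. The slope of a bundle is $\mu=\deg/\operatorname{rank}$. A rank 2 bundle $V$ is stable (semi-stable) if $\mu(W)<\mu(V)$ (resp. $\mu(W)\le\mu(V)$) for every proper nonzero subbundle $W\subset V$. $S_\theta$ is the moduli space of S-equivalence classes of semi-stable rank 2 vector bundles on $X$ with determinant $L_\theta$. For a line bundle $L$, a Higgs bundle $(V,\phi)$ with line bundle $L$ is a vector bundle $V$ together with an $\mathcal{O}_X$-linear map (the Higgs field) $\phi:V\to V\otimes L$, equivalently $\phi\in H^0(\operatorname{End}(V)\otimes L)$. It is stable (semi-stable) if $\mu(W)<\mu(V)$ (resp. $\mu(W)\le\mu(V)$) for every proper nonzero subbundle $W\subset V$ with $\phi(W)\subset W\otimes L$. $S_\theta(L_\theta)$ is the moduli space of S-equivalence classes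 of semi-stable rank 2 Higgs bundles $(V,\phi)$ with $\det V\cong L_\theta$ and with line bundle $L_\theta$, so $\phi:V\to V\otimes L_\theta$. The Higgs fields $\phi_0$ and $\phi_1$ in the claim are of this type (with line bundle $L_\theta$); since $\operatorname{End}(V\otimes M)=\operatorname{End}(V)$ for a line bundle $M$, a Higgs field on one member of $J_2(V)$ is also a Higgs field on every other member. The Frobenius pull-back of $(V,\phi)$ with line bundle $L$ is the Higgs bundle $(F^*(V),F^*(\phi))$ with line bundle $F^*(L)=L^p$. $(V,\phi)$ is called Frobenius semi-stable if both $(V,\phi)$ and $(F^*(V),F^*(\phi))$ are semi-stable. $J^0$ is the group of isomorphism classes of degree $0$ line bundles on $X$; for a vector bundle $V$, $J_2(V)=\{V\otimes L: L\in J^0,\ L^2\cong\mathcal{O}_X\}$. $V_1$ is the bundle in $\operatorname{Ext}^1(L_\theta,\mathcal{O}_X)$ given by the nontrivial extension $0\to\mathcal{O}_X\to V_1\to L_\theta\to 0$ (the source describes this nontrivial extension as unique up to isomorphism). *)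

theory Defs
  imports "HOL-Analysis.Analysis" "HOL-Computational_Algebra.Polynomial"
begin

text \<open>
  A smooth projective curve over an algebraically closed field is given in its classical form
  (Hartshorne, Algebraic Geometry, I.6): its function field is a type \<open>'a\<close>, finitely generated of
  transcendence degree 1 over \<open>'k\<close> along an embedding \<open>emb\<close>, and its closed points are the
  discrete valuation rings of \<open>'a\<close> over \<open>'k\<close>.  The point \<open>P\<close> is identified with its local ring
  \<open>P \<subseteq> 'a\<close>, the nonempty open sets are the cofinite ones, and the sections of the structure sheaf
  over \<open>U\<close> are the elements of \<open>\<Inter>U\<close>.
\<close>

definition field_embedding :: "('k::field \<Rightarrow> 'a::field) \<Rightarrow> bool" where
  "field_embedding emb \<longleftrightarrow> emb 1 = 1 \<and>
     (\<forall>c d. emb (c + d) = emb c + emb d) \<and> (\<forall>c d. emb (c * d) = emb c * emb d)"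

definition transcendental_over :: "('k::field \<Rightarrow> 'a::field) \<Rightarrow> 'a \<Rightarrow> bool" where
  "transcendental_over emb x \<longleftrightarrow> (\<forall>f. poly (map_poly emb f) x = 0 \<longrightarrow> f = 0)"

definition simple_extension :: "('k::field \<Rightarrow> 'a::field) \<Rightarrow> 'a \<Rightarrow> 'a set" where
  "simple_extension emb x =
     {poly (map_poly emb f) x / poly (map_poly emb g) x | f g. poly (map_poly emb g) x \<noteq> 0}"

definition function_field :: "('k::field \<Rightarrow> 'a::field) \<Rightarrow> bool" where
  "function_field emb \<longleftrightarrow> field_embedding emb \<and>
     (\<exists>x. transcendental_over emb x \<and>
        (\<exists>B. finite B \<and>
           (\<forall>y. \<exists>c. (\<forall>b\<in>B. c b \<in> simple_extension emb x) \<and> y = (\<Sum>b\<in>B. c b * b))))"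

definition is_subring :: "'a::field set \<Rightarrow> bool" where
  "is_subring R \<longleftrightarrow> 1 \<in> R \<and> (\<forall>x\<in>R. \<forall>y\<in>R. x - y \<in> R \<and> x * y \<in> R)"

definition unit_in :: "'a::field set \<Rightarrow> 'a \<Rightarrow> bool" where
  "unit_in R u \<longleftrightarrow> u \<noteq> 0 \<and> u \<in> R \<and> inverse u \<in> R"

definition uniformizer :: "'a::field set \<Rightarrow> 'a \<Rightarrow> bool" where
  "uniformizer R t \<longleftrightarrow> t \<in> R \<and> t \<noteq> 0 \<and> \<not> unit_in R t \<and>
     (\<forall>x. x \<noteq> 0 \<longrightarrow> (\<exists>(n::int) u. unit_in R u \<and> x = u * t powi n))"

definition curve :: "('k::field \<Rightarrow> 'a::field) \<Rightarrow> 'a set set" where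
  "curve emb = {R. is_subring R \<and> range emb \<subseteq> R \<and> (\<exists>t. uniformizer R t)}"

definition ord_at :: "'a::field set \<Rightarrow> 'a \<Rightarrow> int" where
  "ord_at R x = (THE n. \<exists>t u. uniformizer R t \<and> unit_in R u \<and> x = u * t powi n)"

definition zariski_open :: "'a set set \<Rightarrow> 'a set set \<Rightarrow> bool" where
  "zariski_open X U \<longleftrightarrow> U = {} \<or> (U \<subseteq> X \<and> finite (X - U))"


text \<open>
  Every vector bundle on an integral scheme embeds into its generic fibre, so up to isomorphism
  a bundle of rank \<open>n\<close> is a locally free subsheaf of rank \<open>n\<close> of the constant sheaf \<open>'a ^ 'n\<close>, where
  \<open>n = CARD('n)\<close>.  Such a subsheaf is given by its stalks \<open>E P\<close>; its sections over \<open>U\<close> are the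
  elements of \<open>\<Inter>P\<in>U. E P\<close>.  The values of \<open>E\<close> at arguments which are not points of the curve
  play no role.  Homomorphisms are the homomorphisms of generic fibres, i.e. matrices over \<open>'a\<close>,
  which respect all stalks.
\<close>

type_synonym ('a, 'n) subsheaf = "'a set \<Rightarrow> ('a ^ 'n) set"

definition vector_bundle :: "'a::field set set \<Rightarrow> ('a, 'n::finite) subsheaf \<Rightarrow> bool" where
  "vector_bundle X E \<longleftrightarrow>
     (\<forall>P\<in>X. \<exists>U (M :: 'a ^ 'n ^ 'n). zariski_open X U \<and> P \<in> U \<and> invertible M \<and>
        (\<forall>Q\<in>U. E Q = (\<lambda>v. M *v v) ` {v. \<forall>i. v $ i \<in> Q}))"

abbreviation line_bundle :: "'a::field set set \<Rightarrow> ('a, 1) subsheaf \<Rightarrow> bool" where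
  "line_bundle \<equiv> vector_bundle"

definition bundle_hom :: "'a::field set set \<Rightarrow> ('a, 'm::finite) subsheaf \<Rightarrow>
    ('a, 'n::finite) subsheaf \<Rightarrow> 'a ^ 'm ^ 'n \<Rightarrow> bool" where
  "bundle_hom X E F A \<longleftrightarrow> (\<forall>P\<in>X. (\<lambda>v. A *v v) ` E P \<subseteq> F P)"

definition bundle_iso_by :: "'a::field set set \<Rightarrow> ('a, 'n::finite) subsheaf \<Rightarrow>
    ('a, 'n) subsheaf \<Rightarrow> 'a ^ 'n ^ 'n \<Rightarrow> bool" where
  "bundle_iso_by X E F A \<longleftrightarrow> invertible A \<and> (\<forall>P\<in>X. (\<lambda>v. A *v v) ` E P = F P)"

definition bundle_iso :: "'a::field set set \<Rightarrow> ('a, 'n::finite) subsheaf \<Rightarrow>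
    ('a, 'n) subsheaf \<Rightarrow> bool" where
  "bundle_iso X E F \<longleftrightarrow> (\<exists>A. bundle_iso_by X E F A)"

text \<open>Exactness of \<open>0 \<rightarrow> N \<rightarrow> V \<rightarrow> Q \<rightarrow> 0\<close>, tested on stalks.\<close>

definition short_exact :: "'a::field set set \<Rightarrow> ('a, 'l::finite) subsheaf \<Rightarrow> 'a ^ 'l ^ 'm \<Rightarrow>
    ('a, 'm::finite) subsheaf \<Rightarrow> 'a ^ 'm ^ 'n \<Rightarrow> ('a, 'n::finite) subsheaf \<Rightarrow> bool" where
  "short_exact X N A V B Q \<longleftrightarrow> bundle_hom X N V A \<and> bundle_hom X V Q B \<and>
     (\<forall>P\<in>X. inj_on (\<lambda>v. A *v v) (N P) \<and>
             (\<lambda>v. A *v v) ` N P = {v \<in> V P. B *v v = 0} \<and>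
             (\<lambda>v. B *v v) ` V P = Q P)"

definition submodule :: "'a::field set \<Rightarrow> ('a ^ 'n::finite) set \<Rightarrow> bool" where
  "submodule R M \<longleftrightarrow> 0 \<in> M \<and> (\<forall>v\<in>M. \<forall>w\<in>M. v + w \<in> M) \<and> (\<forall>a\<in>R. \<forall>v\<in>M. a *s v \<in> M)"

definition structure_sheaf :: "('a::field, 1) subsheaf" where
  "structure_sheaf P = {v. v $ 1 \<in> P}"

text \<open>The tensor product with a line bundle, inside \<open>'a ^ 'n \<otimes> 'a = 'a ^ 'n\<close>.\<close>

definition twist :: "('a::field, 'n::finite) subsheaf \<Rightarrow> ('a, 1) subsheaf \<Rightarrow> ('a, 'n) subsheaf" where
  "twist E L P = submodule P hull {(l $ 1) *s v | l v. l \<in> L P \<and> v \<in> E P}"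

definition direct_sum :: "('a::field, 1) subsheaf \<Rightarrow> ('a, 1) subsheaf \<Rightarrow> ('a, 2) subsheaf" where
  "direct_sum N Q P = {vector [v $ 1, w $ 1] | v w. v \<in> N P \<and> w \<in> Q P}"

definition diagonal_map :: "'a::field ^ 1 ^ 1 \<Rightarrow> 'a ^ 1 ^ 1 \<Rightarrow> 'a ^ 2 ^ 2" where
  "diagonal_map a b = vector [vector [a $ 1 $ 1, 0], vector [0, b $ 1 $ 1]]"

text \<open>The top exterior power: \<open>v\<^sub>1 \<and> \<dots> \<and> v\<^sub>n\<close> is the determinant of the matrix with rows \<open>v\<^sub>i\<close>.\<close>

definition det_bundle :: "('a::field, 'n::finite) subsheaf \<Rightarrow> ('a, 1) subsheaf" where
  "det_bundle E P = submodule P hull {(\<chi> i. det A) | A :: 'a ^ 'n ^ 'n. \<forall>i. row i A \<in> E P}"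

text \<open>
  If the stalk of a line bundle at \<open>P\<close> is generated by \<open>g\<close>, the corresponding divisor has
  multiplicity \<open>- ord\<^sub>P g\<close> at \<open>P\<close>.  All residue fields are \<open>'k\<close>, as \<open>'k\<close> will be algebraically
  closed, so every point has degree 1.
\<close>

definition multiplicity_at :: "('a::field, 1) subsheaf \<Rightarrow> 'a set \<Rightarrow> int" where
  "multiplicity_at L P =
     (THE n. \<exists>g. g \<noteq> 0 \<and> L P = (\<lambda>a. a *s g) ` P \<and> n = - ord_at P (g $ 1))"

definition degree_line :: "'a::field set set \<Rightarrow> ('a, 1) subsheaf \<Rightarrow> int" where
  "degree_line X L = (\<Sum>P\<in>{P\<in>X. multiplicity_at L P \<noteq> 0}. multiplicity_at L P)"

definition bundle_degree :: "'a::field set set \<Rightarrow> ('a, 'n::finite) subsheaf \<Rightarrow> int" where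
  "bundle_degree X E = degree_line X (det_bundle E)"

definition slope :: "'a::field set set \<Rightarrow> ('a, 'n::finite) subsheaf \<Rightarrow> rat" where
  "slope X E = of_int (bundle_degree X E) / of_nat CARD('n)"


text \<open>
  A derivation \<open>D\<close> of the function field over \<open>'k\<close> through which every other one factors uniquely
  identifies the one-dimensional space of differentials of the function field with \<open>'a\<close>, and
  \<open>df\<close> with \<open>D f\<close>.  It exists for function fields over a perfect field and is unique up to a
  nonzero factor, so the following subsheaf is well defined up to isomorphism.  Its stalk at
  \<open>P\<close> is the \<open>P\<close>-module of Kaehler differentials of \<open>P\<close> over \<open>'k\<close>, generated by the \<open>df\<close> with \<open>f \<in> P\<close>.
\<close>

definition derivation_over :: "('k::field \<Rightarrow> 'a::field) \<Rightarrow> ('a \<Rightarrow> 'a) \<Rightarrow> bool" where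
  "derivation_over emb D \<longleftrightarrow> (\<forall>x y. D (x + y) = D x + D y) \<and>
     (\<forall>x y. D (x * y) = x * D y + y * D x) \<and> (\<forall>c. D (emb c) = 0)"

definition universal_derivation :: "('k::field \<Rightarrow> 'a::field) \<Rightarrow> ('a \<Rightarrow> 'a) \<Rightarrow> bool" where
  "universal_derivation emb D \<longleftrightarrow> derivation_over emb D \<and>
     (\<forall>D'. derivation_over emb D' \<longrightarrow> (\<exists>!c. \<forall>x. D' x = c * D x))"

definition canonical_bundle :: "('k::field \<Rightarrow> 'a::field) \<Rightarrow> ('a, 1) subsheaf" where
  "canonical_bundle emb P =
     submodule P hull {(\<chi> i. (SOME D. universal_derivation emb D) f) | f. f \<in> P}"

definition global_sections :: "'a::field set set \<Rightarrow> ('a, 'n::finite) subsheaf \<Rightarrow> ('a ^ 'n) set" where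
  "global_sections X E = {s. \<forall>P\<in>X. s \<in> E P}"

definition genus :: "('k::field \<Rightarrow> 'a::field) \<Rightarrow> nat" where
  "genus emb = vector_space.dim (\<lambda>c v. emb c *s v)
     (global_sections (curve emb) (canonical_bundle emb))"

definition theta_characteristic :: "('k::field \<Rightarrow> 'a::field) \<Rightarrow> ('a, 1) subsheaf \<Rightarrow> bool" where
  "theta_characteristic emb L \<longleftrightarrow> line_bundle (curve emb) L \<and> bundle_degree (curve emb) L = 1 \<and>
     bundle_iso (curve emb) (twist L L) (canonical_bundle emb)"


text \<open>
  The proper nonzero subbundles of a bundle of rank 2 are the line subbundles, i.e. the images
  of the maps \<open>A\<close> from line bundles \<open>N\<close> whose cokernel is again a line bundle.
\<close>

definition line_subbundle :: "'a::field set set \<Rightarrow> ('a, 2) subsheaf \<Rightarrow>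
    ('a, 1) subsheaf \<Rightarrow> 'a ^ 1 ^ 2 \<Rightarrow> bool" where
  "line_subbundle X V N A \<longleftrightarrow> line_bundle X N \<and>
     (\<exists>(Q :: ('a, 1) subsheaf) B. line_bundle X Q \<and> short_exact X N A V B Q)"

definition stable :: "'a::field set set \<Rightarrow> ('a, 2) subsheaf \<Rightarrow> bool" where
  "stable X V \<longleftrightarrow> vector_bundle X V \<and> (\<forall>N A. line_subbundle X V N A \<longrightarrow> slope X N < slope X V)"

definition semistable :: "'a::field set set \<Rightarrow> ('a, 2) subsheaf \<Rightarrow> bool" where
  "semistable X V \<longleftrightarrow> vector_bundle X V \<and> (\<forall>N A. line_subbundle X V N A \<longrightarrow> slope X N \<le> slope X V)"

definition higgs_bundle :: "'a::field set set \<Rightarrow> ('a, 1) subsheaf \<Rightarrow>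
    ('a, 'n::finite) subsheaf \<Rightarrow> 'a ^ 'n ^ 'n \<Rightarrow> bool" where
  "higgs_bundle X L V \<phi> \<longleftrightarrow> vector_bundle X V \<and> bundle_hom X V (twist V L) \<phi>"

definition invariant_line_subbundle :: "'a::field set set \<Rightarrow> ('a, 1) subsheaf \<Rightarrow>
    ('a, 2) subsheaf \<Rightarrow> 'a ^ 2 ^ 2 \<Rightarrow> ('a, 1) subsheaf \<Rightarrow> 'a ^ 1 ^ 2 \<Rightarrow> bool" where
  "invariant_line_subbundle X L V \<phi> N A \<longleftrightarrow> line_subbundle X V N A \<and>
     (\<forall>P\<in>X. (\<lambda>v. \<phi> *v (A *v v)) ` N P \<subseteq> (\<lambda>v. A *v v) ` twist N L P)"

definition higgs_stable :: "'a::field set set \<Rightarrow> ('a, 1) subsheaf \<Rightarrow>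
    ('a, 2) subsheaf \<Rightarrow> 'a ^ 2 ^ 2 \<Rightarrow> bool" where
  "higgs_stable X L V \<phi> \<longleftrightarrow> higgs_bundle X L V \<phi> \<and>
     (\<forall>N A. invariant_line_subbundle X L V \<phi> N A \<longrightarrow> slope X N < slope X V)"

definition higgs_semistable :: "'a::field set set \<Rightarrow> ('a, 1) subsheaf \<Rightarrow>
    ('a, 2) subsheaf \<Rightarrow> 'a ^ 2 ^ 2 \<Rightarrow> bool" where
  "higgs_semistable X L V \<phi> \<longleftrightarrow> higgs_bundle X L V \<phi> \<and>
     (\<forall>N A. invariant_line_subbundle X L V \<phi> N A \<longrightarrow> slope X N \<le> slope X V)"


text \<open>
  S-equivalence: the graded objects of Jordan-Hoelder filtrations are isomorphic.  In rank 2
  the filtration of \<open>V\<close> is trivial if \<open>V\<close> is stable, and otherwise given by a line subbundle \<open>N\<close> of the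
  same slope.
\<close>

definition is_graded :: "'a::field set set \<Rightarrow> ('a, 2) subsheaf \<Rightarrow> ('a, 2) subsheaf \<Rightarrow> bool" where
  "is_graded X V G \<longleftrightarrow> (stable X V \<and> G = V) \<or>
     (\<exists>(N :: ('a, 1) subsheaf) A B (Q :: ('a, 1) subsheaf).
        line_bundle X N \<and> line_bundle X Q \<and> short_exact X N A V B Q \<and>
        slope X N = slope X V \<and> slope X Q = slope X V \<and> G = direct_sum N Q)"

definition S_equivalent :: "'a::field set set \<Rightarrow> ('a, 2) subsheaf \<Rightarrow> ('a, 2) subsheaf \<Rightarrow> bool" where
  "S_equivalent X V V' \<longleftrightarrow>
     (\<exists>G G'. is_graded X V G \<and> is_graded X V' G' \<and> bundle_iso X G G')"

definition higgs_is_graded :: "'a::field set set \<Rightarrow> ('a, 1) subsheaf \<Rightarrow>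
    ('a, 2) subsheaf \<times> ('a ^ 2 ^ 2) \<Rightarrow> ('a, 2) subsheaf \<times> ('a ^ 2 ^ 2) \<Rightarrow> bool" where
  "higgs_is_graded X L = (\<lambda>(V, \<phi>) (G, \<gamma>).
     (higgs_stable X L V \<phi> \<and> G = V \<and> \<gamma> = \<phi>) \<or>
     (\<exists>(N :: ('a, 1) subsheaf) A B (Q :: ('a, 1) subsheaf) \<alpha> \<beta>.
        higgs_bundle X L N \<alpha> \<and> higgs_bundle X L Q \<beta> \<and> short_exact X N A V B Q \<and>
        \<phi> ** A = A ** \<alpha> \<and> B ** \<phi> = \<beta> ** B \<and>
        slope X N = slope X V \<and> slope X Q = slope X V \<and>
        G = direct_sum N Q \<and> \<gamma> = diagonal_map \<alpha> \<beta>))"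

definition higgs_iso :: "'a::field set set \<Rightarrow>
    ('a, 2) subsheaf \<times> ('a ^ 2 ^ 2) \<Rightarrow> ('a, 2) subsheaf \<times> ('a ^ 2 ^ 2) \<Rightarrow> bool" where
  "higgs_iso X = (\<lambda>(V, \<phi>) (V', \<phi>'). \<exists>T. bundle_iso_by X V V' T \<and> T ** \<phi> = \<phi>' ** T)"

definition higgs_S_equivalent :: "'a::field set set \<Rightarrow> ('a, 1) subsheaf \<Rightarrow>
    ('a, 2) subsheaf \<times> ('a ^ 2 ^ 2) \<Rightarrow> ('a, 2) subsheaf \<times> ('a ^ 2 ^ 2) \<Rightarrow> bool" where
  "higgs_S_equivalent X L H H' \<longleftrightarrow>
     (\<exists>G G'. higgs_is_graded X L H G \<and> higgs_is_graded X L H' G' \<and> higgs_iso X G G')"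

text \<open>The moduli spaces, as sets of S-equivalence classes; \<open>D\<close> is the determinant.\<close>

definition bundle_moduli :: "'a::field set set \<Rightarrow> ('a, 1) subsheaf \<Rightarrow> ('a, 2) subsheaf set set" where
  "bundle_moduli X D =
     (let S = {V. semistable X V \<and> bundle_iso X (det_bundle V) D}
      in S // {(V, V'). V \<in> S \<and> V' \<in> S \<and> S_equivalent X V V'})"

definition higgs_moduli :: "'a::field set set \<Rightarrow> ('a, 1) subsheaf \<Rightarrow> ('a, 1) subsheaf \<Rightarrow>
    (('a, 2) subsheaf \<times> ('a ^ 2 ^ 2)) set set" where
  "higgs_moduli X D L =
     (let S = {(V, \<phi>). higgs_semistable X L V \<phi> \<and> bundle_iso X (det_bundle V) D}
      in S // {(H, H'). H \<in> S \<and> H' \<in> S \<and> higgs_S_equivalent X L H H'})"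


text \<open>
  The pull-back along the absolute Frobenius, where \<open>p\<close> is the characteristic.  It is the identity
  on points, and the generic fibre is identified by \<open>F\<^sup>* ('a ^ 'n) = 'a ^ 'n\<close>.
\<close>

definition frobenius_pullback :: "nat \<Rightarrow> ('a::field, 'n::finite) subsheaf \<Rightarrow> ('a, 'n) subsheaf" where
  "frobenius_pullback p E P = submodule P hull ((\<lambda>v. \<chi> i. (v $ i) ^ p) ` E P)"

definition frobenius_pullback_map :: "nat \<Rightarrow> 'a::field ^ 'm ^ 'n \<Rightarrow> 'a ^ 'm ^ 'n" where
  "frobenius_pullback_map p A = (\<chi> i j. (A $ i $ j) ^ p)"

definition frobenius_semistable :: "nat \<Rightarrow> 'a::field set set \<Rightarrow> ('a, 1) subsheaf \<Rightarrow>
    ('a, 2) subsheaf \<Rightarrow> 'a ^ 2 ^ 2 \<Rightarrow> bool" where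
  "frobenius_semistable p X L V \<phi> \<longleftrightarrow> higgs_semistable X L V \<phi> \<and>
     higgs_semistable X (frobenius_pullback p L) (frobenius_pullback p V) (frobenius_pullback_map p \<phi>)"

definition J2 :: "'a::field set set \<Rightarrow> ('a, 'n::finite) subsheaf \<Rightarrow> ('a, 'n) subsheaf set" where
  "J2 X V = {twist V L | L. line_bundle X L \<and> bundle_degree X L = 0 \<and>
     bundle_iso X (twist L L) structure_sheaf}"

definition nontrivial_extension :: "'a::field set set \<Rightarrow> ('a, 1) subsheaf \<Rightarrow>
    ('a, 2) subsheaf \<Rightarrow> ('a, 1) subsheaf \<Rightarrow> bool" where
  "nontrivial_extension X N V Q \<longleftrightarrow> vector_bundle X V \<and>
     (\<exists>A B. short_exact X N A V B Q \<and>
        \<not> (\<exists>S. bundle_hom X Q V S \<and> B ** S = mat 1))"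

end

theory Submission
  imports Defs
begin

text \<open>
  Both parts reduce to degrees of line bundles, once it is known that a principal divisor has
  degree 0.  For a nonconstant function \<open>x\<close> of degree \<open>n = [K : k(x)]\<close> this follows from two
  estimates.  The approximation theorem yields functions which are independent modulo \<open>x\<close>, hence
  over \<open>k(x)\<close>, one for each zero counted with multiplicity, so there are at most \<open>n\<close> zeros.
  Conversely, Riemann's count of the functions with poles of bounded order yields at least \<open>n\<close>
  poles; it uses that every nonconstant function \<open>y\<close> has a pole, which is found as a subring that
  is maximal among those containing \<open>1 / y\<close> but not \<open>y\<close>.

  If \<open>(V, \<phi>)\<close> is semistable and \<open>N \<subset> V\<close> destabilises \<open>V\<close>, then \<open>\<phi>\<close> induces a nonzero map
  \<open>N \<rightarrow> (V / N) \<otimes> L\<close>, which is an isomorphism for reasons of degree and splits \<open>V\<close>.  Conversely, an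
  extension \<open>0 \<rightarrow> \<O> \<rightarrow> V \<rightarrow> L \<rightarrow> 0\<close> carries the nilpotent Higgs field \<open>V \<rightarrow> L \<rightarrow> V \<otimes> L\<close>.
  Its only invariant line subbundle is \<open>\<O>\<close>, of degree 0, and this description is stable
  under Frobenius pull-back and under twisting by line bundles of degree 0.
\<close>


section \<open>Discrete valuation rings\<close>

text \<open>Line bundles are handled through local generators, one for each point. Tensor products
  multiply them, determinants and Frobenius pull-backs act on bases of stalks, and so slopes reduce
  to sums of orders. Only global factors remain ambiguous, which is why the degree of a principal
  divisor is the one deep input. The obstacle there is that points are given abstractly as valuation
  rings: even the existence of a single point needs proof. All linear algebra takes place over the
  ring k[x] instead of k(x); by clearing denominators both notions of dependence agree. In the first
  part the number 1 = deg L decides. Slope 1/2 is not an integer, so a semistable V is stable. If N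
  has degree n \<ge> 1, the quotient Q has degree 1 - n, and a nonzero map N \<rightarrow> Q
  \<otimes> L forces n \<le> 2 - n, hence n = 1 and deg Q = 0. Comparing N = Q \<otimes> L with N
  \<otimes> Q = det V = L, up to isomorphism, makes the square of Q trivial; this is where the twist
  by a 2-torsion bundle comes from.\<close>

lemma subring_zero: "is_subring R \<Longrightarrow> 0 \<in> R"
  unfolding is_subring_def by (metis diff_self)

lemma subring_one: "is_subring R \<Longrightarrow> 1 \<in> R"
  unfolding is_subring_def by blast

lemma subring_diff: "is_subring R \<Longrightarrow> x \<in> R \<Longrightarrow> y \<in> R \<Longrightarrow> x - y \<in> R"
  unfolding is_subring_def by blast

lemma subring_mult: "is_subring R \<Longrightarrow> x \<in> R \<Longrightarrow> y \<in> R \<Longrightarrow> x * y \<in> R"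
  unfolding is_subring_def by blast

lemma subring_uminus: "is_subring R \<Longrightarrow> x \<in> R \<Longrightarrow> - x \<in> R"
  using subring_diff[of R 0 x] subring_zero[of R] by simp

lemma subring_add: "is_subring R \<Longrightarrow> x \<in> R \<Longrightarrow> y \<in> R \<Longrightarrow> x + y \<in> R"
  using subring_diff[of R x "- y"] subring_uminus[of R y] by simp

lemma subring_power: "is_subring R \<Longrightarrow> x \<in> R \<Longrightarrow> x ^ n \<in> R"
  by (induction n) (auto intro: subring_one subring_mult)

lemma subring_sum: "is_subring R \<Longrightarrow> (\<And>i. i \<in> I \<Longrightarrow> f i \<in> R) \<Longrightarrow> sum f I \<in> R"
  by (induction I rule: infinite_finite_induct) (auto intro: subring_zero subring_add)

lemma subring_prod: "is_subring R \<Longrightarrow> (\<And>i. i \<in> I \<Longrightarrow> f i \<in> R) \<Longrightarrow> prod f I \<in> R"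
  by (induction I rule: infinite_finite_induct) (auto intro: subring_one subring_mult)

text \<open>Encodes order at least n with the convention that 0 has infinite order:
  \<open>ord_at P 0\<close> is an unspecified value, so zero needs its own disjunct.\<close>

definition vge :: "'a::field set \<Rightarrow> int \<Rightarrow> 'a \<Rightarrow> bool" where
  "vge P n x \<longleftrightarrow> x = 0 \<or> n \<le> ord_at P x"

locale dvr =
  fixes P :: "'a::field set"
  assumes subring: "is_subring P" and ex_uniformizer: "\<exists>t. uniformizer P t"
begin

lemma unit_one: "unit_in P 1"
  using subring unfolding unit_in_def is_subring_def by simp

lemma unit_mult: "unit_in P u \<Longrightarrow> unit_in P v \<Longrightarrow> unit_in P (u * v)"
  using subring unfolding unit_in_def is_subring_def by simp

lemma unit_inverse: "unit_in P u \<Longrightarrow> unit_in P (inverse u)"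
  unfolding unit_in_def by simp

lemma unit_powi: "unit_in P u \<Longrightarrow> unit_in P (u powi n)"
proof -
  have "unit_in P (u ^ k)" if "unit_in P u" for u and k :: nat
    using that by (induction k) (auto intro: unit_one unit_mult)
  then show "unit_in P u \<Longrightarrow> unit_in P (u powi n)"
    by (simp add: power_int_def unit_inverse)
qed

text \<open>If a negative power of t were in P, multiplying it by a suitable nonnegative power of t
  would give 1 / t, and t would be a unit.\<close>

lemma uniformizer_powi_mem:
  assumes "uniformizer P t" "t powi n \<in> P"
  shows "0 \<le> n"
proof (rule ccontr)
  assume "\<not> 0 \<le> n"
  then obtain k where k: "n = - int (Suc k)"
    by (metis int_cases not_less of_nat_0_le_iff negD)
  have t: "t \<in> P" "t \<noteq> 0" "\<not> unit_in P t"
    using assms(1) unfolding uniformizer_def by auto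
  have "t powi n = inverse (t ^ Suc k)"
    by (simp only: k power_int_minus power_int_of_nat)
  also have "t ^ k * \<dots> = inverse t"
    using t(2) by (simp add: field_simps)
  finally have "t ^ k * t powi n = inverse t" .
  then have "inverse t \<in> P"
    using subring_mult[OF subring subring_power[OF subring t(1), of k] assms(2)] by simp
  then show False using t unfolding unit_in_def by blast
qed

lemma uniformizer_powi_unit:
  assumes "uniformizer P t" "unit_in P (t powi n)"
  shows "n = 0"
proof -
  have "t powi (- n) \<in> P"
    using assms(2) unfolding unit_in_def by (simp add: power_int_minus)
  then show ?thesis
    using uniformizer_powi_mem[OF assms(1), of n] uniformizer_powi_mem[OF assms(1), of "- n"] assms(2)
    unfolding unit_in_def by auto
qed

text \<open>Each uniformizer is a unit times a power of the other. Both exponents are positive,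
  being exponents of nonunits of P, and their product is 1.\<close>

lemma uniformizer_unique_up_to_unit:
  assumes "uniformizer P t" "uniformizer P t'"
  obtains u where "unit_in P u" "t' = u * t"
proof -
  have t: "t \<noteq> 0" "t' \<noteq> 0" "t \<in> P" "t' \<in> P" "\<not> unit_in P t" "\<not> unit_in P t'"
    using assms unfolding uniformizer_def by auto
  obtain k u where k: "unit_in P u" "t' = u * t powi k"
    using assms t unfolding uniformizer_def by metis
  obtain j v where j: "unit_in P v" "t = v * t' powi j"
    using assms t unfolding uniformizer_def by metis
  have u0: "u \<noteq> 0" "v \<noteq> 0" using k j unfolding unit_in_def by auto
  have pos: "n \<ge> 1" if "unit_in P w" "s = w * r powi n" "uniformizer P r" "s \<in> P" "\<not> unit_in P s"
    for w s r n
  proof -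
    have "w \<noteq> 0" using that(1) unfolding unit_in_def by auto
    then have "r powi n = inverse w * s" using that(2) by (simp add: field_simps)
    then have "r powi n \<in> P"
      using subring_mult[OF subring _ that(4), of "inverse w"] that(1) unfolding unit_in_def by simp
    then have "n \<ge> 0" using uniformizer_powi_mem[OF that(3)] by simp
    moreover have "n \<noteq> 0" using that by auto
    ultimately show ?thesis by simp
  qed
  have k1: "k \<ge> 1" using pos[OF k(1,2) assms(1)] t by blast
  have j1: "j \<ge> 1" using pos[OF j(1,2) assms(2)] t by blast
  have "t = v * (u powi j * t powi (k * j))"
    using j(2) k(2) by (simp add: power_int_mult_distrib power_int_mult)
  then have "1 = v * u powi j * t powi (k * j - 1)"
    using t(1) by (simp add: power_int_diff field_simps)
  then have "t powi (k * j - 1) = inverse (v * u powi j)"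
    using u0 by (simp add: field_simps)
  then have "unit_in P (t powi (k * j - 1))"
    using k(1) j(1) by (simp only:) (intro unit_inverse unit_mult unit_powi)
  then have "k * j = 1" using uniformizer_powi_unit[OF assms(1)] by fastforce
  then have "k = 1" using k1 j1 by (simp add: zmult_eq_1_iff)
  then show ?thesis using that k by simp
qed

text \<open>Shows that the definite description behind \<open>ord_at\<close> is well defined:
  changing the uniformizer changes only the unit factor.\<close>

lemma ord_at_eqI:
  assumes "uniformizer P t" "unit_in P u"
  shows "ord_at P (u * t powi n) = n"
  unfolding ord_at_def
proof (rule the_equality)
  show "\<exists>t' u'. uniformizer P t' \<and> unit_in P u' \<and> u * t powi n = u' * t' powi n"
    using assms by blast
next
  fix m assume "\<exists>t' u'. uniformizer P t' \<and> unit_in P u' \<and> u * t powi n = u' * t' powi m"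
  then obtain t' u' where *: "uniformizer P t'" "unit_in P u'" "u * t powi n = u' * t' powi m"
    by blast
  obtain w where w: "unit_in P w" "t' = w * t"
    using uniformizer_unique_up_to_unit[OF assms(1) *(1)] by blast
  have nz: "u \<noteq> 0" "u' \<noteq> 0" "w \<noteq> 0" "t \<noteq> 0"
    using assms * w unfolding unit_in_def uniformizer_def by auto
  have "u * t powi n = u' * w powi m * t powi m"
    using * w by (simp add: power_int_mult_distrib)
  then have "t powi (n - m) = inverse u * (u' * w powi m)"
    using nz by (simp add: power_int_diff field_simps)
  then have "unit_in P (t powi (n - m))"
    using assms(2) *(2) w(1) by (simp only:) (intro unit_inverse unit_mult unit_powi)
  then show "m = n" using uniformizer_powi_unit[OF assms(1)] by fastforce
qed

lemma decompose:
  assumes "x \<noteq> 0" "uniformizer P t"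
  obtains u where "unit_in P u" "x = u * t powi (ord_at P x)"
  using assms ord_at_eqI[OF assms(2)] unfolding uniformizer_def by metis

lemma ord_mult:
  assumes "x \<noteq> 0" "y \<noteq> 0"
  shows "ord_at P (x * y) = ord_at P x + ord_at P y"
proof -
  obtain t where t: "uniformizer P t" using ex_uniformizer by blast
  then have "t \<noteq> 0" unfolding uniformizer_def by blast
  obtain u where u: "unit_in P u" "x = u * t powi (ord_at P x)" using decompose assms t by blast
  obtain v where v: "unit_in P v" "y = v * t powi (ord_at P y)" using decompose assms t by blast
  have "x * y = (u * v) * t powi (ord_at P x + ord_at P y)"
    by (subst u(2), subst v(2)) (simp add: power_int_add \<open>t \<noteq> 0\<close> mult_ac)
  then show ?thesis using ord_at_eqI[OF t unit_mult[OF u(1) v(1)]] by simp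
qed

lemma ord_one: "ord_at P 1 = 0"
  using ord_mult[of 1 1] by simp

lemma ord_inverse: "x \<noteq> 0 \<Longrightarrow> ord_at P (inverse x) = - ord_at P x"
  using ord_mult[of x "inverse x"] ord_one by simp

lemma ord_divide: "x \<noteq> 0 \<Longrightarrow> y \<noteq> 0 \<Longrightarrow> ord_at P (x / y) = ord_at P x - ord_at P y"
  by (simp add: divide_inverse ord_mult ord_inverse)

lemma ord_power: "x \<noteq> 0 \<Longrightarrow> ord_at P (x ^ n) = int n * ord_at P x"
  by (induction n) (simp_all add: ord_one ord_mult algebra_simps)

lemma ord_minus_one: "ord_at P (- 1) = 0"
  using ord_mult[of "-1" "-1"] ord_one by simp

lemma ord_uminus: "ord_at P (- x) = ord_at P x"
  using ord_mult[of "-1" x] ord_minus_one by (cases "x = 0") auto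

lemma uniformizer_ord: "uniformizer P t \<Longrightarrow> ord_at P t = 1"
  using ord_at_eqI[OF _ unit_one, of t 1] by simp

lemma mem_iff: "x \<in> P \<longleftrightarrow> x = 0 \<or> 0 \<le> ord_at P x"
proof (cases "x = 0")
  case True then show ?thesis using subring_zero[OF subring] by simp
next
  case False
  obtain t where t: "uniformizer P t" using ex_uniformizer by blast
  obtain u where u: "unit_in P u" "x = u * t powi (ord_at P x)" using decompose False t by blast
  show ?thesis
  proof
    assume "x \<in> P"
    have "t powi (ord_at P x) = inverse u * x"
      using u by (metis unit_in_def left_inverse mult.assoc mult_1)
    then have "t powi (ord_at P x) \<in> P"
      using u(1) \<open>x \<in> P\<close> unfolding unit_in_def by (simp add: subring_mult[OF subring])
    then show "x = 0 \<or> 0 \<le> ord_at P x" using uniformizer_powi_mem[OF t] by blast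
  next
    assume "x = 0 \<or> 0 \<le> ord_at P x"
    then have "t powi (ord_at P x) = t ^ nat (ord_at P x)" using False by (simp add: power_int_def)
    moreover have "t \<in> P" using t unfolding uniformizer_def by blast
    ultimately show "x \<in> P"
      using u subring_mult[OF subring] subring_power[OF subring] unfolding unit_in_def by metis
  qed
qed

lemma unit_iff: "unit_in P x \<longleftrightarrow> x \<noteq> 0 \<and> ord_at P x = 0"
  unfolding unit_in_def using mem_iff[of x] mem_iff[of "inverse x"] ord_inverse[of x] by auto

lemma vge_0_iff: "vge P 0 x \<longleftrightarrow> x \<in> P"
  unfolding vge_def mem_iff by simp

lemma vge_zero [simp]: "vge P n 0"
  unfolding vge_def by simp

lemma vge_ord: "vge P (ord_at P x) x"
  unfolding vge_def by simp

lemma vge_mono: "vge P n x \<Longrightarrow> m \<le> n \<Longrightarrow> vge P m x"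
  unfolding vge_def by auto

lemma vge_mult: "vge P m x \<Longrightarrow> vge P n y \<Longrightarrow> vge P (m + n) (x * y)"
  unfolding vge_def using ord_mult[of x y] by (cases "x = 0"; cases "y = 0") auto

lemma vge_mult_mem: "x \<in> P \<Longrightarrow> vge P n y \<Longrightarrow> vge P n (x * y)"
  using vge_mult[of 0 x n y] by (simp add: vge_0_iff)

lemma vge_uminus: "vge P n (- x) \<longleftrightarrow> vge P n x"
  unfolding vge_def using ord_uminus[of x] by simp

text \<open>The ultrametric inequality: if x has the smaller order, then y / x lies in P, and x + y
  = (1 + y / x) x.\<close>

lemma vge_add:
  assumes "vge P n x" "vge P n y"
  shows "vge P n (x + y)"
proof (cases "x = 0 \<or> y = 0 \<or> x + y = 0")
  case True
  then show ?thesis using assms by (auto simp: vge_def)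
next
  case False
  have *: "vge P n (x + y)" if "ord_at P x \<le> ord_at P y" "x \<noteq> 0" "y \<noteq> 0" "vge P n x" for x y
  proof -
    have "y / x \<in> P" using that mem_iff ord_divide by auto
    then have "1 + y / x \<in> P" using subring_add[OF subring subring_one[OF subring]] by blast
    then have "vge P n ((1 + y / x) * x)" using vge_mult_mem that by blast
    moreover have "(1 + y / x) * x = x + y" using that by (simp add: distrib_right)
    ultimately show ?thesis by simp
  qed
  show ?thesis
    using *[of x y] *[of y x] False assms by (cases "ord_at P x \<le> ord_at P y") (auto simp: add.commute)
qed

lemma vge_diff: "vge P n x \<Longrightarrow> vge P n y \<Longrightarrow> vge P n (x - y)"
  using vge_add[of n x "- y"] by (simp add: vge_uminus)

lemma vge_sum: "(\<And>i. i \<in> I \<Longrightarrow> vge P n (f i)) \<Longrightarrow> vge P n (sum f I)"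
  by (induction I rule: infinite_finite_induct) (auto intro: vge_add)

lemma ord_add_lt:
  assumes "x \<noteq> 0" "vge P (ord_at P x + 1) y"
  shows "x + y \<noteq> 0" "ord_at P (x + y) = ord_at P x"
proof -
  show nz: "x + y \<noteq> 0"
  proof
    assume "x + y = 0"
    then have "y = - x" by (simp add: eq_neg_iff_add_eq_0 add.commute)
    then show False using assms ord_uminus by (auto simp: vge_def)
  qed
  have "vge P (ord_at P x) (x + y)" by (intro vge_add vge_ord vge_mono[OF assms(2)]) simp
  moreover have "\<not> vge P (ord_at P x + 1) (x + y)"
  proof
    assume "vge P (ord_at P x + 1) (x + y)"
    from vge_diff[OF this assms(2)] show False using assms(1) by (simp add: vge_def)
  qed
  ultimately show "ord_at P (x + y) = ord_at P x" using nz by (simp add: vge_def)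
qed

lemma proper: "\<exists>x. x \<notin> P"
proof -
  obtain t where t: "uniformizer P t" using ex_uniformizer by blast
  then have "t \<noteq> 0" unfolding uniformizer_def by blast
  then have "inverse t \<notin> P" using uniformizer_ord[OF t] mem_iff ord_inverse by auto
  then show ?thesis by blast
qed

text \<open>An x outside P has negative order, so every y becomes integral after division by a high
  power of x. Thus a discrete valuation ring is a maximal proper subring, and distinct points are
  incomparable.\<close>

lemma overring_trivial:
  assumes "is_subring Q" "P \<subseteq> Q" "Q \<noteq> P"
  shows "Q = UNIV"
proof -
  obtain x where x: "x \<in> Q" "x \<notin> P" using assms by blast
  then have x0: "x \<noteq> 0" "ord_at P x < 0" using mem_iff by auto
  have "y \<in> Q" for y
  proof (cases "y = 0")
    case True then show ?thesis using subring_zero[OF assms(1)] by simp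
  next
    case False
    \<comment> \<open>This exponent suffices because the order of x is at most -1.\<close>
    define n where "n = nat (- ord_at P y)"
    have "- ord_at P y \<le> int n * 1" by (simp add: n_def)
    also have "\<dots> \<le> int n * (- ord_at P x)"
      using x0(2) by (intro mult_left_mono) auto
    finally have "y / x ^ n \<in> P" using mem_iff[of "y / x ^ n"] ord_divide[of y "x ^ n"] ord_power[of x n] x0 False by simp
    then have "y / x ^ n * x ^ n \<in> Q"
      using assms x by (intro subring_mult[OF assms(1)] subring_power[OF assms(1)]) auto
    then show ?thesis using x0 by simp
  qed
  then show ?thesis by blast
qed

end

lemma dvr_not_subset:
  assumes "dvr P" "dvr Q" "P \<noteq> Q"
  shows "\<exists>x. x \<in> P \<and> x \<notin> Q"
  using dvr.overring_trivial[OF assms(1), of Q] assms dvr.proper[OF assms(2)] dvr.subring[OF assms(2)] by blast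

lemma curve_dvr: "P \<in> curve emb \<Longrightarrow> dvr P"
  unfolding curve_def by unfold_locales auto

section \<open>Linear dependence over subrings\<close>

text \<open>The coefficients come from a ring; for R = k[x] this is dependence over the field k(x),
  as denominators can be cleared. Families instead of sets are used so that repetitions count as
  dependences.\<close>

definition lin_dep :: "'a::field set \<Rightarrow> 'i set \<Rightarrow> ('i \<Rightarrow> 'a) \<Rightarrow> bool" where
  "lin_dep R I u \<longleftrightarrow> (\<exists>c. (\<forall>i\<in>I. c i \<in> R) \<and> (\<exists>i\<in>I. c i \<noteq> 0) \<and> (\<Sum>i\<in>I. c i * u i) = 0)"

definition lin_combs :: "'a::field set \<Rightarrow> 'j set \<Rightarrow> ('j \<Rightarrow> 'a) \<Rightarrow> 'a set" where
  "lin_combs R J v = {\<Sum>j\<in>J. a j * v j | a. \<forall>j\<in>J. a j \<in> R}"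

lemma lin_combs_add:
  assumes "is_subring R" "x \<in> lin_combs R J v" "y \<in> lin_combs R J v"
  shows "x + y \<in> lin_combs R J v"
proof -
  obtain a b where "\<forall>j\<in>J. a j \<in> R" "x = (\<Sum>j\<in>J. a j * v j)" "\<forall>j\<in>J. b j \<in> R" "y = (\<Sum>j\<in>J. b j * v j)"
    using assms unfolding lin_combs_def by blast
  then show ?thesis
    unfolding lin_combs_def
    by (intro CollectI exI[of _ "\<lambda>j. a j + b j"])
       (auto simp: distrib_right sum.distrib intro: subring_add[OF assms(1)])
qed

lemma lin_combs_scale:
  assumes "is_subring R" "r \<in> R" "x \<in> lin_combs R J v"
  shows "r * x \<in> lin_combs R J v"
proof -
  obtain a where "\<forall>j\<in>J. a j \<in> R" "x = (\<Sum>j\<in>J. a j * v j)"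
    using assms unfolding lin_combs_def by blast
  then show ?thesis
    unfolding lin_combs_def
    by (intro CollectI exI[of _ "\<lambda>j. r * a j"])
       (auto simp: sum_distrib_left mult.assoc intro: subring_mult[OF assms(1)] assms)
qed

lemma lin_combs_zero: "is_subring R \<Longrightarrow> 0 \<in> lin_combs R J v"
  unfolding lin_combs_def by (intro CollectI exI[of _ "\<lambda>j. 0"]) (auto intro: subring_zero)

lemma lin_combs_sum:
  assumes "is_subring R" "\<And>i. i \<in> I \<Longrightarrow> f i \<in> lin_combs R J v"
  shows "sum f I \<in> lin_combs R J v"
  using assms(2)
  by (induction I rule: infinite_finite_induct)
     (auto intro: lin_combs_zero[OF assms(1)] lin_combs_add[OF assms(1)])

lemma lin_combs_base:
  assumes "is_subring R" "finite J" "j \<in> J"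
  shows "v j \<in> lin_combs R J v"
  unfolding lin_combs_def
  by (intro CollectI exI[of _ "\<lambda>i. if i = j then 1 else 0"])
     (auto simp: assms if_distrib[of "\<lambda>c. c * _"] sum.delta subring_zero subring_one cong: if_cong)

lemma lin_dep_reindex:
  assumes "lin_dep R (h ` I) u" "inj_on h I"
  shows "lin_dep R I (u \<circ> h)"
proof -
  obtain c where "\<forall>i\<in>h ` I. c i \<in> R" "\<exists>i\<in>h ` I. c i \<noteq> 0" "(\<Sum>i\<in>h ` I. c i * u i) = 0"
    using assms(1) unfolding lin_dep_def by blast
  then show ?thesis
    unfolding lin_dep_def
    by (intro exI[of _ "c \<circ> h"]) (auto simp: sum.reindex[OF assms(2)] o_def)
qed

lemma lin_dep_scale:
  assumes "lin_dep R I (\<lambda>i. h * u i)" "h \<noteq> 0"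
  shows "lin_dep R I u"
proof -
  obtain c where c: "\<forall>i\<in>I. c i \<in> R" "\<exists>i\<in>I. c i \<noteq> 0" "(\<Sum>i\<in>I. c i * (h * u i)) = 0"
    using assms(1) unfolding lin_dep_def by blast
  have "(\<Sum>i\<in>I. c i * (h * u i)) = h * (\<Sum>i\<in>I. c i * u i)"
    by (simp add: sum_distrib_left mult_ac)
  then show ?thesis using c assms(2) unfolding lin_dep_def by auto
qed

text \<open>Fraction-free Gaussian elimination.\<close>

lemma lin_dep_if_card_less:
  assumes "is_subring R" "finite J" "finite I" "card J < card I"
    and "\<And>i. i \<in> I \<Longrightarrow> u i \<in> lin_combs R J v"
  shows "lin_dep R I u"
  using assms(2-)
proof (induction J arbitrary: I u rule: finite_induct)
  case empty
  then have "\<And>i. i \<in> I \<Longrightarrow> u i = 0" unfolding lin_combs_def by simp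
  moreover obtain i where "i \<in> I" using empty by fastforce
  ultimately show ?case
    unfolding lin_dep_def by (intro exI[of _ "\<lambda>_. 1"]) (auto simp: subring_one[OF assms(1)])
next
  case (insert j J)
  have "\<exists>a. (\<forall>k\<in>insert j J. a k \<in> R) \<and> u i = (\<Sum>k\<in>insert j J. a k * v k)" if "i \<in> I" for i
    using insert.prems(3)[OF that] unfolding lin_combs_def by blast
  then obtain a where a: "\<And>i k. i \<in> I \<Longrightarrow> k \<in> insert j J \<Longrightarrow> a i k \<in> R"
    "\<And>i. i \<in> I \<Longrightarrow> u i = (\<Sum>k\<in>insert j J. a i k * v k)"
    by metis
  have u: "u i = a i j * v j + (\<Sum>k\<in>J. a i k * v k)" if "i \<in> I" for i
    using a(2)[OF that] insert.hyps by simp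
  show ?case
  proof (cases "\<exists>i\<in>I. a i j \<noteq> 0")
    case False
    have "u i \<in> lin_combs R J v" if "i \<in> I" for i
      using u[OF that] False a(1) that unfolding lin_combs_def by auto
    then show ?thesis using insert.IH[of I u] insert.prems insert.hyps by simp
  next
    case True
    then obtain i0 where i0: "i0 \<in> I" "a i0 j \<noteq> 0" by blast
    \<comment> \<open>Cross multiplication with the pivot row \<open>i0\<close> cancels the
      coordinate j without dividing in R.\<close>
    define w where "w i = a i0 j * u i - a i j * u i0" for i
    have "w i \<in> lin_combs R J v" if "i \<in> I - {i0}" for i
    proof -
      have "w i = (\<Sum>k\<in>J. (a i0 j * a i k - a i j * a i0 k) * v k)"
        unfolding w_def using u[of i] u[of i0] that i0
        by (simp add: algebra_simps sum_distrib_left sum.distrib sum_subtractf)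
      then show ?thesis
        unfolding lin_combs_def using a(1) that i0
        by (auto intro!: exI[of _ "\<lambda>k. a i0 j * a i k - a i j * a i0 k"]
            subring_diff[OF assms(1)] subring_mult[OF assms(1)])
    qed
    moreover have "card J < card (I - {i0})"
      using insert.prems insert.hyps i0 by simp
    ultimately have "lin_dep R (I - {i0}) w"
      using insert.IH[of "I - {i0}" w] insert.prems by simp
    then obtain c where c: "\<forall>i\<in>I - {i0}. c i \<in> R" "\<exists>i\<in>I - {i0}. c i \<noteq> 0"
      "(\<Sum>i\<in>I - {i0}. c i * w i) = 0"
      unfolding lin_dep_def by blast
    \<comment> \<open>Rewrites the relation among the \<open>w i\<close> in terms of the
      \<open>u i\<close>; the pivot collects everything that the elimination subtracted.\<close>
    define d where "d i = (if i = i0 then - (\<Sum>i\<in>I - {i0}. c i * a i j) else c i * a i0 j)" for i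
    have "(\<Sum>i\<in>I. d i * u i) = d i0 * u i0 + (\<Sum>i\<in>I - {i0}. d i * u i)"
      using i0 insert.prems by (simp add: sum.remove)
    also have "(\<Sum>i\<in>I - {i0}. d i * u i) = (\<Sum>i\<in>I - {i0}. c i * w i + c i * a i j * u i0)"
      by (intro sum.cong) (auto simp: d_def w_def algebra_simps)
    also have "\<dots> = (\<Sum>i\<in>I - {i0}. c i * a i j) * u i0"
      using c(3) by (simp add: sum.distrib sum_distrib_right)
    finally have "(\<Sum>i\<in>I. d i * u i) = 0" by (simp add: d_def)
    moreover have "\<forall>i\<in>I. d i \<in> R"
      using c(1) a(1) i0 unfolding d_def
      by (auto intro!: subring_uminus[OF assms(1)] subring_sum[OF assms(1)] subring_mult[OF assms(1)])
    moreover have "\<exists>i\<in>I. d i \<noteq> 0" using c(2) i0 by (auto simp: d_def)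
    ultimately show ?thesis unfolding lin_dep_def by blast
  qed
qed

section \<open>Function fields\<close>

locale fun_field =
  fixes emb :: "'k::alg_closed_field \<Rightarrow> 'a::field"
  assumes function_field: "function_field emb"
begin

lemma emb_one: "emb 1 = 1" and emb_add: "emb (c + d) = emb c + emb d"
  and emb_mult: "emb (c * d) = emb c * emb d"
  using function_field unfolding function_field_def field_embedding_def by auto

lemma emb_zero: "emb 0 = 0"
  using emb_add[of 0 0] by (metis add_cancel_left_left add_0)

lemma emb_uminus: "emb (- c) = - emb c"
  using emb_add[of c "- c"] by (simp add: emb_zero eq_neg_iff_add_eq_0 add.commute)

lemma emb_diff: "emb (c - d) = emb c - emb d"
  using emb_add[of c "- d"] by (simp add: emb_uminus)

lemma emb_nonzero: "c \<noteq> 0 \<Longrightarrow> emb c \<noteq> 0"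
proof
  assume "c \<noteq> 0" "emb c = 0"
  then have "emb (c * inverse c) = 0" by (subst emb_mult) simp
  then show False using \<open>c \<noteq> 0\<close> emb_one by simp
qed

lemma emb_eq_0_iff: "emb c = 0 \<longleftrightarrow> c = 0"
  using emb_nonzero emb_zero by auto

lemma emb_inverse: "emb (inverse c) = inverse (emb c)"
proof (cases "c = 0")
  case False
  then have "emb c * emb (inverse c) = 1" by (simp add: emb_mult[symmetric] emb_one)
  then show ?thesis by (metis inverse_unique)
qed (simp add: emb_zero)

lemma subring_consts: "is_subring (range emb)"
  unfolding is_subring_def using emb_one emb_diff emb_mult by (metis rangeE rangeI)

text \<open>\<open>range (ev x)\<close> is the subring k[x] of the function field, over which all
  linear dependence below is taken.\<close>

definition ev :: "'a \<Rightarrow> 'k poly \<Rightarrow> 'a" where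
  "ev x f = poly (map_poly emb f) x"

lemma ev_pCons: "ev x (pCons c f) = emb c + x * ev x f"
  unfolding ev_def by (simp add: map_poly_pCons emb_zero)

lemma ev_0 [simp]: "ev x 0 = 0"
  unfolding ev_def by simp

lemma ev_const: "ev x [:c:] = emb c"
  by (simp add: ev_pCons)

lemma ev_1: "ev x 1 = 1"
  using ev_const[of x 1] by (simp add: emb_one one_pCons)

lemma ev_add: "ev x (f + g) = ev x f + ev x g"
  by (induction f g rule: poly_induct2) (simp_all add: ev_pCons emb_add algebra_simps)

lemma ev_uminus: "ev x (- f) = - ev x f"
  using ev_add[of x f "- f"] by (simp add: eq_neg_iff_add_eq_0 add.commute)

lemma ev_diff: "ev x (f - g) = ev x f - ev x g"
  using ev_add[of x f "- g"] by (simp add: ev_uminus)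

lemma ev_smult: "ev x (smult c f) = emb c * ev x f"
  by (induction f) (simp_all add: ev_pCons emb_mult algebra_simps)

lemma ev_mult: "ev x (f * g) = ev x f * ev x g"
  by (induction f) (simp_all add: ev_pCons ev_add ev_smult algebra_simps emb_zero)

lemma ev_sum: "ev x (sum f I) = (\<Sum>i\<in>I. ev x (f i))"
  by (induction I rule: infinite_finite_induct) (auto simp: ev_add)

lemma ev_prod: "ev x (prod f I) = (\<Prod>i\<in>I. ev x (f i))"
  by (induction I rule: infinite_finite_induct) (auto simp: ev_mult ev_1)

lemma ev_monom: "ev x (monom c n) = emb c * x ^ n"
  by (induction n) (simp_all add: ev_const monom_0 monom_Suc ev_pCons emb_zero)

lemma ev_altdef: "degree f \<le> n \<Longrightarrow> ev x f = (\<Sum>i\<le>n. emb (coeff f i) * x ^ i)"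
proof -
  assume "degree f \<le> n"
  have "ev x f = ev x (\<Sum>i\<le>n. monom (coeff f i) i)"
    using poly_as_sum_of_monoms'[OF \<open>degree f \<le> n\<close>] by simp
  then show ?thesis by (simp add: ev_sum ev_monom)
qed

lemma subring_range_ev: "is_subring (range (ev x))"
  unfolding is_subring_def using rangeI[of "ev x" 1]
  by (auto simp: ev_1 simp flip: ev_diff ev_mult)

text \<open>As k is algebraically closed, f splits, so f(x) is a product of a nonzero constant and
  factors x - c. It applies to the set of nonzero elements and to the set of functions of order 0 at
  a point.\<close>

lemma ev_mult_closed:
  assumes "\<And>c. c \<noteq> 0 \<Longrightarrow> emb c \<in> S" "\<And>c. x - emb c \<in> S"
    and "\<And>a b. a \<in> S \<Longrightarrow> b \<in> S \<Longrightarrow> a * b \<in> S" and "f \<noteq> 0"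
  shows "ev x f \<in> S"
  using assms(4)
proof (induction "degree f" arbitrary: f)
  case 0
  then obtain c where "f = [:c:]" by (metis degree_eq_zeroE)
  then show ?case using 0 assms(1) by (simp add: ev_const)
next
  case (Suc n)
  then obtain c where "poly f c = 0" using alg_closed_imp_poly_has_root[of f] by auto
  then obtain g where g: "f = [:-c, 1:] * g" by (metis poly_eq_0_iff_dvd dvd_def)
  then have "g \<noteq> 0" using Suc.prems by auto
  moreover have "degree f = Suc (degree g)"
    unfolding g using \<open>g \<noteq> 0\<close> by (subst degree_mult_eq) auto
  ultimately have "ev x g \<in> S" using Suc by simp
  moreover have "ev x [:-c, 1:] = x - emb c" by (simp add: ev_pCons emb_uminus emb_one)
  ultimately show ?case unfolding g ev_mult using assms(2,3) by simp
qed

text \<open>None of the factors x - c of f(x) vanishes when x is nonconstant. So nonconstant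
  functions are transcendental over k.\<close>

lemma ev_nonzero:
  assumes "x \<notin> range emb" "f \<noteq> 0"
  shows "ev x f \<noteq> 0"
proof -
  have "ev x f \<in> - {0}"
    using assms by (intro ev_mult_closed) (auto simp: emb_eq_0_iff)
  then show ?thesis by simp
qed

text \<open>A relation over \<open>k[x]\<close> reduces modulo \<open>x\<close> to one over \<open>k\<close>, and a nontrivial
  one can be divided by \<open>x\<close> until its reduction is nontrivial.\<close>

lemma not_lin_dep_if_indep_mod:
  assumes "is_subring R" "range emb \<subseteq> R" "x \<in> R" "x \<notin> range emb"
    and "\<And>i. i \<in> I \<Longrightarrow> u i \<in> R"
    and indep: "\<And>c r. r \<in> R \<Longrightarrow> (\<Sum>i\<in>I. emb (c i) * u i) = x * r \<Longrightarrow> \<forall>i\<in>I. c i = 0"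
  shows "\<not> lin_dep (range (ev x)) I u"
proof
  assume "lin_dep (range (ev x)) I u"
  then obtain c where c: "\<forall>i\<in>I. c i \<in> range (ev x)" "\<exists>i\<in>I. c i \<noteq> 0" "(\<Sum>i\<in>I. c i * u i) = 0"
    unfolding lin_dep_def by blast
  then have "\<forall>i\<in>I. \<exists>g. c i = ev x g" by blast
  then obtain f where f: "\<And>i. i \<in> I \<Longrightarrow> c i = ev x (f i)" by metis
  have x0: "x \<noteq> 0" using assms(4) emb_zero by (metis rangeI)
  have ev_R: "ev x g \<in> R" for g
    by (induction g)
       (use assms(1-3) in \<open>auto simp: ev_pCons intro!: subring_add subring_mult subring_zero\<close>)
  \<comment> \<open>The induction on m runs over all families f at once: dividing the relation by x
    replaces each polynomial by the one with its coefficients shifted down.\<close>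
  have "\<forall>i\<in>I. coeff (f i) m = 0" if "(\<Sum>i\<in>I. ev x (f i) * u i) = 0" for m f
    using that
  proof (induction m arbitrary: f)
    case (0 f)
    have "\<exists>g. f i = pCons (coeff (f i) 0) g" for i by (metis coeff_pCons_0 pCons_cases)
    then obtain g where g: "\<And>i. f i = pCons (coeff (f i) 0) (g i)" by metis
    have "0 = (\<Sum>i\<in>I. (emb (coeff (f i) 0) + x * ev x (g i)) * u i)"
      using 0 by (subst (asm) g) (simp add: ev_pCons)
    then have "(\<Sum>i\<in>I. emb (coeff (f i) 0) * u i) = x * (- (\<Sum>i\<in>I. ev x (g i) * u i))"
      by (simp add: algebra_simps sum.distrib sum_distrib_left eq_neg_iff_add_eq_0)
    moreover have "- (\<Sum>i\<in>I. ev x (g i) * u i) \<in> R"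
      using assms ev_R by (auto intro!: subring_uminus subring_sum subring_mult)
    ultimately show ?case by (intro indep)
  next
    case (Suc m f)
    have "\<exists>g. f i = pCons (coeff (f i) 0) g" for i by (metis coeff_pCons_0 pCons_cases)
    then obtain g where g: "\<And>i. f i = pCons (coeff (f i) 0) (g i)" by metis
    have "0 = (\<Sum>i\<in>I. (emb (coeff (f i) 0) + x * ev x (g i)) * u i)"
      using Suc.prems by (subst (asm) g) (simp add: ev_pCons)
    then have s: "(\<Sum>i\<in>I. emb (coeff (f i) 0) * u i) = x * (- (\<Sum>i\<in>I. ev x (g i) * u i))"
      by (simp add: algebra_simps sum.distrib sum_distrib_left eq_neg_iff_add_eq_0)
    moreover have "- (\<Sum>i\<in>I. ev x (g i) * u i) \<in> R"
      using assms ev_R by (auto intro!: subring_uminus subring_sum subring_mult)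
    ultimately have "\<forall>i\<in>I. coeff (f i) 0 = 0" by (intro indep)
    then have "(\<Sum>i\<in>I. ev x (g i) * u i) = 0" using s x0 by (simp add: emb_zero)
    from Suc.IH[OF this] show ?case using g by (metis (no_types) coeff_pCons_Suc)
  qed
  then have "\<And>m. \<forall>i\<in>I. coeff (f i) m = 0" using c(3) f by simp
  then have "f i = 0" if "i \<in> I" for i using that by (simp add: poly_eq_iff)
  then show False using c(2) f by auto
qed

section \<open>Finiteness of the degree over k(y)\<close>

lemma common_denominator:
  assumes "transcendental_over emb x" "finite B"
    and "\<And>y. \<exists>c. (\<forall>b\<in>B. c b \<in> simple_extension emb x) \<and> y = (\<Sum>b\<in>B. c b * b)"
    and "finite I"
  shows "\<exists>h. h \<noteq> 0 \<and> (\<forall>i\<in>I. ev x h * u i \<in> lin_combs (range (ev x)) B (\<lambda>b. b))"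
  using assms(4)
proof (induction I rule: finite_induct)
  case empty
  show ?case by (rule exI[of _ 1]) simp
next
  case (insert i I)
  note sub = subring_range_ev[of x]
  have nz: "ev x f \<noteq> 0" if "f \<noteq> 0" for f
    using assms(1) that unfolding transcendental_over_def ev_def by blast
  obtain h where h: "h \<noteq> 0" "\<forall>i\<in>I. ev x h * u i \<in> lin_combs (range (ev x)) B (\<lambda>b. b)"
    using insert.IH by blast
  obtain c where c: "\<And>b. b \<in> B \<Longrightarrow> c b \<in> simple_extension emb x" "u i = (\<Sum>b\<in>B. c b * b)"
    using assms(3) by blast
  have "\<forall>b\<in>B. \<exists>f g. c b = ev x f / ev x g \<and> ev x g \<noteq> 0"
    using c(1) unfolding simple_extension_def ev_def by blast
  then obtain f where "\<forall>b\<in>B. \<exists>g. c b = ev x (f b) / ev x g \<and> ev x g \<noteq> 0"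
    using bchoice[of B "\<lambda>b f. \<exists>g. c b = ev x f / ev x g \<and> ev x g \<noteq> 0"] by blast
  then obtain g where "\<forall>b\<in>B. c b = ev x (f b) / ev x (g b) \<and> ev x (g b) \<noteq> 0"
    using bchoice[of B "\<lambda>b g. c b = ev x (f b) / ev x g \<and> ev x g \<noteq> 0"] by blast
  then have fg: "\<And>b. b \<in> B \<Longrightarrow> c b = ev x (f b) / ev x (g b)"
    "\<And>b. b \<in> B \<Longrightarrow> ev x (g b) \<noteq> 0" by auto
  \<comment> \<open>The product of the denominators of all coordinates of
    \<open>u i\<close>.\<close>
  define h' where "h' = prod g B"
  have h': "h' \<noteq> 0" unfolding h'_def using fg(2) assms(2) ev_0 by (metis prod_zero_iff)
  have "ev x h' * u i = (\<Sum>b\<in>B. ev x (f b * prod g (B - {b})) * b)"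
    unfolding c(2) sum_distrib_left
  proof (rule sum.cong)
    fix b assume b: "b \<in> B"
    have "ev x h' = ev x (g b) * ev x (prod g (B - {b}))"
      unfolding h'_def using b assms(2) by (simp add: prod.remove ev_mult)
    then show "ev x h' * (c b * b) = ev x (f b * prod g (B - {b})) * b"
      using fg b by (simp add: ev_mult)
  qed simp
  then have i: "ev x h' * u i \<in> lin_combs (range (ev x)) B (\<lambda>b. b)"
    unfolding lin_combs_def by (intro CollectI exI[of _ "\<lambda>b. ev x (f b * prod g (B - {b}))"]) auto
  show ?case
  proof (intro exI[of _ "h * h'"] conjI ballI)
    show "h * h' \<noteq> 0" using h h' by simp
    fix j assume "j \<in> insert i I"
    then consider "j = i" | "j \<in> I" by blast
    then show "ev x (h * h') * u j \<in> lin_combs (range (ev x)) B (\<lambda>b. b)"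
    proof cases
      case 1
      then show ?thesis using lin_combs_scale[OF sub _ i, of "ev x h"] by (simp add: ev_mult mult.assoc)
    next
      case 2
      then show ?thesis using lin_combs_scale[OF sub _ h(2)[rule_format, OF 2], of "ev x h'"]
        by (simp add: ev_mult mult_ac)
    qed
  qed
qed

text \<open>The powers of y from 0 to |B| are one more than a spanning set over k(x) has elements,
  hence dependent over k[x]. Written as a double sum, the relation is symmetric in x and y and can
  be reread as a relation for x over k[y].\<close>

lemma algebraic_relation:
  assumes "transcendental_over emb x" "finite B"
    and "\<And>y. \<exists>c. (\<forall>b\<in>B. c b \<in> simple_extension emb x) \<and> y = (\<Sum>b\<in>B. c b * b)"
  obtains N b and a :: "nat \<Rightarrow> nat \<Rightarrow> 'k"
  where "(\<Sum>i\<le>N. \<Sum>j\<le>b. emb (a i j) * y ^ j * x ^ i) = 0" "\<exists>i\<le>N. \<exists>j\<le>b. a i j \<noteq> 0"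
proof -
  define b where "b = card B"
  obtain h where h: "h \<noteq> 0" "\<forall>j\<le>b. ev x h * y ^ j \<in> lin_combs (range (ev x)) B (\<lambda>b. b)"
    using common_denominator[OF assms, of "{..b}" "\<lambda>j. y ^ j"] by auto
  have "ev x h \<noteq> 0" using assms(1) h(1) unfolding transcendental_over_def ev_def by blast
  moreover have "lin_dep (range (ev x)) {..b} (\<lambda>j. ev x h * y ^ j)"
    by (rule lin_dep_if_card_less[where v = "\<lambda>b. b", OF subring_range_ev assms(2)])
       (use h in \<open>auto simp: b_def\<close>)
  ultimately have "lin_dep (range (ev x)) {..b} (\<lambda>j. y ^ j)" by (rule lin_dep_scale[rotated])
  then obtain c where c: "\<forall>j\<le>b. c j \<in> range (ev x)" "\<exists>j\<le>b. c j \<noteq> 0" "(\<Sum>j\<le>b. c j * y ^ j) = 0"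
    unfolding lin_dep_def by auto
  define f where "f j = inv (ev x) (c j)" for j
  have f: "c j = ev x (f j)" if "j \<le> b" for j
    unfolding f_def using c(1) that by (simp add: f_inv_into_f)
  obtain N where N: "\<And>j. j \<le> b \<Longrightarrow> degree (f j) \<le> N"
    using finite_nat_set_iff_bounded_le[of "(\<lambda>j. degree (f j)) ` {..b}"] by auto
  have "(\<Sum>i\<le>N. \<Sum>j\<le>b. emb (coeff (f j) i) * y ^ j * x ^ i) = (\<Sum>j\<le>b. \<Sum>i\<le>N. emb (coeff (f j) i) * y ^ j * x ^ i)"
    by (rule sum.swap)
  also have "\<dots> = (\<Sum>j\<le>b. c j * y ^ j)"
    by (intro sum.cong) (simp_all add: f ev_altdef[OF N] sum_distrib_left sum_distrib_right mult_ac)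
  finally have "(\<Sum>i\<le>N. \<Sum>j\<le>b. emb (coeff (f j) i) * y ^ j * x ^ i) = 0" using c(3) by simp
  moreover have "\<exists>i\<le>N. \<exists>j\<le>b. coeff (f j) i \<noteq> 0"
  proof -
    obtain j where j: "j \<le> b" "c j \<noteq> 0" using c(2) by blast
    then have "f j \<noteq> 0" using f by auto
    then show ?thesis using N[OF j(1)] j(1) by (intro exI[of _ "degree (f j)"] conjI exI[of _ j]) auto
  qed
  ultimately show ?thesis by (rule that)
qed

text \<open>Read over k[y], the relation makes x algebraic of some degree d over k(y), so the d |B|
  products of powers of x and elements of B span the function field over k(y). Inverting the leading
  coefficient G is avoided by multiplying with powers of G.\<close>

lemma finite_field_degree:
  assumes y: "y \<notin> range emb"
  shows "\<exists>n. \<forall>I (u :: nat \<Rightarrow> 'a). finite I \<longrightarrow> n < card I \<longrightarrow> lin_dep (range (ev y)) I u"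
proof -
  obtain x B where x: "transcendental_over emb x" "finite B"
    "\<And>y. \<exists>c. (\<forall>b\<in>B. c b \<in> simple_extension emb x) \<and> y = (\<Sum>b\<in>B. c b * b)"
    using function_field unfolding function_field_def by blast
  obtain N b and a :: "nat \<Rightarrow> nat \<Rightarrow> 'k"
    where a: "(\<Sum>i\<le>N. \<Sum>j\<le>b. emb (a i j) * y ^ j * x ^ i) = 0" "\<exists>i\<le>N. \<exists>j\<le>b. a i j \<noteq> 0"
    by (rule algebraic_relation[OF x])
  note sub = subring_range_ev[of y]
  define g where "g i = (\<Sum>j\<le>b. monom (a i j) j)" for i
  have g: "ev y (g i) = (\<Sum>j\<le>b. emb (a i j) * y ^ j)" for i
    by (simp add: g_def ev_sum ev_monom)
  have coeff_g: "coeff (g i) j = a i j" if "j \<le> b" for i j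
    using that by (simp add: g_def coeff_sum)
  define D where "D = {i. i \<le> N \<and> g i \<noteq> 0}"
  have D: "finite D" "D \<noteq> {}" unfolding D_def using a(2) coeff_g by (auto, metis coeff_0)
  define d where "d = Max D"
  have d: "d \<in> D" "\<And>i. i \<in> D \<Longrightarrow> i \<le> d" unfolding d_def using D by auto
  define G where "G = ev y (g d)"
  have G0: "G \<noteq> 0" unfolding G_def using d(1) ev_nonzero[OF y] by (auto simp: D_def)
  have G_in: "G \<in> range (ev y)" unfolding G_def by blast
  have emb_in: "emb c \<in> range (ev y)" for c using ev_const[of y c] by (metis rangeI)
  \<comment> \<open>The k[y]-span of the powers of x below d. Multiplication by x leaves it in
    general, but multiplication by G x does not.\<close>
  define C where "C = lin_combs (range (ev y)) {..<d} (\<lambda>i. x ^ i)"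
  have "0 = (\<Sum>i\<le>N. ev y (g i) * x ^ i)"
    using a(1) by (simp add: g sum_distrib_right)
  also have "\<dots> = (\<Sum>i\<le>d. ev y (g i) * x ^ i)"
  proof (rule sum.mono_neutral_right)
    show "\<forall>i\<in>{..N} - {..d}. ev y (g i) * x ^ i = 0"
    proof
      fix i assume "i \<in> {..N} - {..d}"
      then have "g i = 0" using d(2)[of i] by (auto simp: D_def)
      then show "ev y (g i) * x ^ i = 0" by simp
    qed
  qed (use d(1) in \<open>auto simp: D_def\<close>)
  also have "\<dots> = (\<Sum>i<d. ev y (g i) * x ^ i) + G * x ^ d"
    by (simp add: G_def lessThan_Suc_atMost[symmetric])
  finally have "G * x ^ d = (\<Sum>i<d. ev y (- g i) * x ^ i)"
    by (simp add: ev_uminus sum_negf eq_neg_iff_add_eq_0 add.commute)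
  then have top: "G * x ^ d \<in> C"
    unfolding C_def lin_combs_def by (intro CollectI exI[of _ "\<lambda>i. ev y (- g i)"]) auto
  \<comment> \<open>For d = 0 the relation would say that the nonzero leading coefficient
    vanishes.\<close>
  have d0: "d > 0"
    using top G0 unfolding C_def lin_combs_def by (cases d) auto
  have base: "x ^ i \<in> C" if "i < d" for i
    unfolding C_def using lin_combs_base[OF sub, of "{..<d}" i "\<lambda>i. x ^ i"] that by simp
  have step: "G * x * z \<in> C" if z: "z \<in> C" for z
  proof -
    obtain c where c: "\<forall>i\<in>{..<d}. c i \<in> range (ev y)" "z = (\<Sum>i<d. c i * x ^ i)"
      using z unfolding C_def lin_combs_def by blast
    have "c i * (G * x ^ Suc i) \<in> C" if "i < d" for i
    proof -
      have "G * x ^ Suc i \<in> C"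
      proof (cases "Suc i = d")
        case False
        then show ?thesis using base[of "Suc i"] that lin_combs_scale[OF sub G_in] unfolding C_def by simp
      qed (use top in simp)
      moreover have "c i \<in> range (ev y)" using c(1) that by blast
      ultimately show ?thesis unfolding C_def by (rule lin_combs_scale[OF sub, rotated])
    qed
    then have "(\<Sum>i<d. c i * (G * x ^ Suc i)) \<in> C"
      unfolding C_def by (intro lin_combs_sum[OF sub]) auto
    also have "(\<Sum>i<d. c i * (G * x ^ Suc i)) = G * x * z"
      unfolding c(2) sum_distrib_left by (intro sum.cong) (auto simp: mult_ac)
    finally show ?thesis .
  qed
  have pow: "G ^ m * x ^ m \<in> C" for m
  proof (induction m)
    case 0
    then show ?case using base[of 0] d0 by simp
  next
    case (Suc m)
    then show ?case using step[of "G ^ m * x ^ m"] by (simp add: mult_ac)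
  qed
  have poly_C: "G ^ m * ev x f \<in> C" if "degree f \<le> m" for f m
  proof -
    have "G ^ m * ev x f = (\<Sum>i\<le>m. (emb (coeff f i) * G ^ (m - i)) * (G ^ i * x ^ i))"
      unfolding ev_altdef[OF that] sum_distrib_left
    proof (intro sum.cong refl)
      fix i assume "i \<in> {..m}"
      then have "G ^ m = G ^ (m - i) * G ^ i" by (simp flip: power_add)
      then show "G ^ m * (emb (coeff f i) * x ^ i) = emb (coeff f i) * G ^ (m - i) * (G ^ i * x ^ i)"
        by (simp add: mult_ac)
    qed
    also have "\<dots> \<in> C"
      unfolding C_def
      by (intro lin_combs_sum[OF sub] lin_combs_scale[OF sub] subring_mult[OF sub] emb_in
          subring_power[OF sub G_in] pow[unfolded C_def])
    finally show ?thesis .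
  qed
  define J where "J = {..<d} \<times> B"
  define v where "v = (\<lambda>(i, b). x ^ i * b)"
  define C' where "C' = lin_combs (range (ev y)) J v"
  have finJ: "finite J" unfolding J_def using x(2) by simp
  have C': "z * b \<in> C'" if z: "z \<in> C" and b: "b \<in> B" for z b
  proof -
    obtain c where c: "\<forall>i\<in>{..<d}. c i \<in> range (ev y)" "z = (\<Sum>i<d. c i * x ^ i)"
      using z unfolding C_def lin_combs_def by blast
    have "z * b = (\<Sum>i<d. c i * v (i, b))"
      unfolding c(2) v_def sum_distrib_right by (simp add: mult.assoc)
    also have "\<dots> \<in> C'"
      unfolding C'_def
      by (intro lin_combs_sum[OF sub] lin_combs_scale[OF sub] lin_combs_base[OF sub finJ])
         (use c b in \<open>auto simp: J_def\<close>)
    finally show ?thesis .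
  qed
  have "lin_dep (range (ev y)) I u" if I: "finite I" "card J < card I" for I and u :: "nat \<Rightarrow> 'a"
  proof -
    obtain h where h: "h \<noteq> 0" "\<forall>i\<in>I. ev x h * u i \<in> lin_combs (range (ev x)) B (\<lambda>b. b)"
      using common_denominator[OF x I(1)] by blast
    have "\<forall>i\<in>I. \<exists>c. (\<forall>b\<in>B. c b \<in> range (ev x)) \<and> ev x h * u i = (\<Sum>b\<in>B. c b * b)"
      using h(2) unfolding lin_combs_def by blast
    from bchoice[OF this] obtain c where
      "\<forall>i\<in>I. (\<forall>b\<in>B. c i b \<in> range (ev x)) \<and> ev x h * u i = (\<Sum>b\<in>B. c i b * b)" by blast
    then have c: "\<And>i b. i \<in> I \<Longrightarrow> b \<in> B \<Longrightarrow> c i b \<in> range (ev x)"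
      "\<And>i. i \<in> I \<Longrightarrow> ev x h * u i = (\<Sum>b\<in>B. c i b * b)" by auto
    define f where "f i b = inv (ev x) (c i b)" for i b
    have f: "c i b = ev x (f i b)" if "i \<in> I" "b \<in> B" for i b
      unfolding f_def using c(1) that by (simp add: f_inv_into_f)
    \<comment> \<open>A common bound M for all degrees lets the single factor \<open>G ^ M\<close>
      bring every coefficient into C.\<close>
    have "finite ((\<lambda>(i, b). degree (f i b)) ` (I \<times> B))" using I x(2) by simp
    then obtain M where "\<forall>n\<in>(\<lambda>(i, b). degree (f i b)) ` (I \<times> B). n \<le> M"
      unfolding finite_nat_set_iff_bounded_le by blast
    then have M: "degree (f i b) \<le> M" if "i \<in> I" "b \<in> B" for i b using that by auto
    have "(G ^ M * ev x h) * u i \<in> C'" if "i \<in> I" for i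
    proof -
      have "(G ^ M * ev x h) * u i = (\<Sum>b\<in>B. G ^ M * ev x (f i b) * b)"
        unfolding mult.assoc c(2)[OF that] sum_distrib_left
        by (intro sum.cong) (use f that in auto)
      also have "\<dots> \<in> C'"
        unfolding C'_def
        by (intro lin_combs_sum[OF sub] C'[unfolded C'_def] poly_C M that)
      finally show ?thesis .
    qed
    then have "lin_dep (range (ev y)) I (\<lambda>i. (G ^ M * ev x h) * u i)"
      unfolding C'_def by (intro lin_dep_if_card_less[OF sub finJ I])
    moreover have "ev x h \<noteq> 0" using x(1) h(1) unfolding transcendental_over_def ev_def by blast
    ultimately show ?thesis using lin_dep_scale G0 by (metis no_zero_divisors power_not_zero)
  qed
  then show ?thesis by (intro exI[of _ "card J"]) blast
qed

text \<open>For nonconstant y this is [K : k(y)]. The families are indexed by natural numbers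
  because a definition has to fix one index type; the next lemma transfers the bound to all
  others.\<close>

definition field_degree :: "'a \<Rightarrow> nat" where
  "field_degree y = (LEAST n. \<forall>I (u :: nat \<Rightarrow> 'a). finite I \<longrightarrow> n < card I \<longrightarrow> lin_dep (range (ev y)) I u)"

lemma lin_dep_if_field_degree_less:
  fixes u :: "'i \<Rightarrow> 'a"
  assumes "y \<notin> range emb" "finite I" "field_degree y < card I"
  shows "lin_dep (range (ev y)) I u"
proof -
  obtain h where h: "bij_betw h I {..<card I}"
    using ex_bij_betw_finite_nat[OF assms(2)] by (auto simp: atLeast0LessThan)
  have "lin_dep (range (ev y)) {..<card I} (u \<circ> the_inv_into I h)"
    using LeastI_ex[OF finite_field_degree[OF assms(1)], folded field_degree_def] assms(3) by simp
  then have "lin_dep (range (ev y)) I ((u \<circ> the_inv_into I h) \<circ> h)"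
    using lin_dep_reindex[of _ h I] h by (metis bij_betw_def)
  moreover have "((u \<circ> the_inv_into I h) \<circ> h) i = u i" if "i \<in> I" for i
    using h that by (simp add: bij_betw_def the_inv_into_f_f)
  ultimately show ?thesis unfolding lin_dep_def by (auto cong: sum.cong)
qed

text \<open>Minimality yields an independent family with more than n elements, where n + 1 is the
  degree. The upper bound makes its size exactly the degree, and a bijection moves it to an initial
  segment.\<close>

lemma ex_indep_card_field_degree:
  assumes "y \<notin> range emb"
  shows "\<exists>u :: nat \<Rightarrow> 'a. \<not> lin_dep (range (ev y)) {..<field_degree y} u"
proof (cases "field_degree y")
  case 0
  then show ?thesis by (simp add: lin_dep_def)
next
  case (Suc n)
  then have "\<not> (\<forall>I (u :: nat \<Rightarrow> 'a). finite I \<longrightarrow> n < card I \<longrightarrow> lin_dep (range (ev y)) I u)"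
    unfolding field_degree_def by (intro not_less_Least) simp
  then obtain I and u :: "nat \<Rightarrow> 'a" where I: "finite I" "n < card I" "\<not> lin_dep (range (ev y)) I u"
    by blast
  then have "card I \<le> field_degree y" using lin_dep_if_field_degree_less[OF assms I(1)] by (meson not_less)
  then have card: "card I = field_degree y" using I(2) Suc by simp
  obtain h where h: "bij_betw h {..<field_degree y} I"
    using ex_bij_betw_nat_finite[OF I(1)] card by (auto simp: atLeast0LessThan)
  have "\<not> lin_dep (range (ev y)) {..<field_degree y} (u \<circ> h)"
  proof
    assume *: "lin_dep (range (ev y)) {..<field_degree y} (u \<circ> h)"
    let ?g = "the_inv_into {..<field_degree y} h"
    have g: "bij_betw ?g I {..<field_degree y}" using h by (rule bij_betw_the_inv_into)
    then have "lin_dep (range (ev y)) I ((u \<circ> h) \<circ> ?g)"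
      using * lin_dep_reindex[of _ ?g I] by (metis bij_betw_def)
    moreover have "((u \<circ> h) \<circ> ?g) i = u i" if "i \<in> I" for i
      using h that by (auto simp: bij_betw_def f_the_inv_into_f)
    ultimately show False using I(3) unfolding lin_dep_def by (auto cong: sum.cong)
  qed
  then show ?thesis by blast
qed

end

section \<open>Places of a function field\<close>

context fun_field
begin

text \<open>For a valuation ring with maximal ideal \<open>m\<close>, the hypotheses say that the valuations of the
  \<open>z i\<close> increase strictly and stay below that of \<open>x\<close>.\<close>

lemma chain_length_le_field_degree:
  assumes R: "is_subring R" "range emb \<subseteq> R"
    and m: "m \<subseteq> R" "0 \<in> m" "1 \<notin> m" "\<And>a b. a \<in> m \<Longrightarrow> b \<in> m \<Longrightarrow> a + b \<in> m"
      "\<And>a b. a \<in> R \<Longrightarrow> b \<in> m \<Longrightarrow> a * b \<in> m"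
    and x: "x \<notin> range emb"
    and z: "\<And>i. i < r \<Longrightarrow> z i \<in> R" "\<And>i. i < r \<Longrightarrow> z i \<noteq> 0" "\<And>i. i < r \<Longrightarrow> x / z i \<in> m"
      "\<And>i j. i < j \<Longrightarrow> j < r \<Longrightarrow> z j / z i \<in> m"
  shows "r \<le> field_degree x"
proof (cases "r = 0")
  case False
  have xR: "x \<in> R"
    using subring_mult[OF R(1), of "z 0" "x / z 0"] z(1-3)[of 0] m(1) False by auto
  have m_sum: "sum f I \<in> m" if "\<And>i. i \<in> I \<Longrightarrow> f i \<in> m" for f :: "nat \<Rightarrow> 'a" and I
    using that by (induction I rule: infinite_finite_induct) (auto intro: m)
  have m_diff: "a - b \<in> m" if "a \<in> m" "b \<in> m" for a b
    using m(4)[OF that(1) m(5)[OF subring_uminus[OF R(1) subring_one[OF R(1)]] that(2)]] by simp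
  have "\<not> lin_dep (range (ev x)) {..<r} z"
  proof (rule not_lin_dep_if_indep_mod[OF R xR x])
    fix c s assume s: "s \<in> R" "(\<Sum>i\<in>{..<r}. emb (c i) * z i) = x * s"
    show "\<forall>i\<in>{..<r}. c i = 0"
    proof (rule ccontr)
      assume "\<not> (\<forall>i\<in>{..<r}. c i = 0)"
      then have ex: "\<exists>i. i < r \<and> c i \<noteq> 0" by auto
      \<comment> \<open>The nonzero term of least valuation. After division by \<open>z i0\<close>
        all other terms lie in m, so a nonzero constant would lie there too.\<close>
      define i0 where "i0 = (LEAST i. i < r \<and> c i \<noteq> 0)"
      have i0: "i0 < r" "c i0 \<noteq> 0" using LeastI_ex[OF ex] unfolding i0_def by auto
      have below: "c i = 0" if "i < i0" for i
        using not_less_Least[of i "\<lambda>i. i < r \<and> c i \<noteq> 0"] that i0(1) unfolding i0_def by auto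
      have "(\<Sum>i\<in>{..<r}. emb (c i) * z i) = emb (c i0) * z i0 + (\<Sum>i\<in>{..<r} - {i0}. emb (c i) * z i)"
        using i0 by (subst sum.remove[of _ i0]) auto
      then have "x * s / z i0 = emb (c i0) + (\<Sum>i\<in>{..<r} - {i0}. emb (c i) * z i) / z i0"
        using z(2)[OF i0(1)] s(2) by (simp add: add_divide_distrib)
      then have "emb (c i0) = s * (x / z i0) - (\<Sum>i\<in>{..<r} - {i0}. emb (c i) * (z i / z i0))"
        by (simp add: sum_divide_distrib mult.commute)
      also have "\<dots> \<in> m"
      proof -
        have "emb (c i) * (z i / z i0) \<in> m" if i: "i \<in> {..<r} - {i0}" for i
        proof (cases "i < i0")
          case False
          then show ?thesis using i R(2) by (intro m(5) z(4)) auto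
        qed (use below m(2) in \<open>simp add: emb_zero\<close>)
        then show ?thesis by (intro m_diff m_sum m(5)[OF s(1)] z(3) i0(1))
      qed
      finally have "emb (inverse (c i0)) * emb (c i0) \<in> m" using R(2) by (intro m(5)) auto
      then show False using m(3) i0(2) by (simp flip: emb_mult add: emb_one)
    qed
  qed (use z in auto)
  then show ?thesis using lin_dep_if_field_degree_less[OF x, of "{..<r}" z] by (auto simp: not_less[symmetric])
qed simp

section \<open>Existence of points: a maximal subring avoiding y is a discrete valuation
  ring\<close>

definition maximal_without :: "'a \<Rightarrow> 'a set \<Rightarrow> bool" where
  "maximal_without y R \<longleftrightarrow> is_subring R \<and> range emb \<subseteq> R \<and> inverse y \<in> R \<and> y \<notin> R \<and>
     (\<forall>S. is_subring S \<longrightarrow> R \<subseteq> S \<longrightarrow> y \<notin> S \<longrightarrow> S = R)"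

text \<open>Zorn's lemma, starting from the ring k[1/y]. Overrings contain the constants and 1/y
  automatically, so maximality can be tested against all subrings that omit y.\<close>

lemma ex_maximal_without:
  assumes "y \<notin> range emb"
  shows "\<exists>R. maximal_without y R"
proof -
  define \<S> where "\<S> = {R. is_subring R \<and> range emb \<subseteq> R \<and> inverse y \<in> R \<and> y \<notin> R}"
  define z where "z = inverse y"
  have y: "y = inverse z" by (simp add: z_def)
  have z: "z \<notin> range emb" using assms unfolding y by (auto simp flip: emb_inverse)
  have z0: "z \<noteq> 0" using z emb_zero by (metis rangeI)
  \<comment> \<open>If 1 / z were f(z), then 1 - z f(z) = 0 would be an algebraic relation for the
    nonconstant z with constant term 1.\<close>
  have "y \<noteq> ev z f" for f
  proof
    assume "y = ev z f"
    then have "ev z (1 - pCons 0 f) = 0"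
      using z0 unfolding y by (simp add: ev_diff ev_1 ev_pCons emb_zero field_simps)
    then have "1 - pCons 0 f = 0" using ev_nonzero[OF z] by blast
    then have "coeff (1 - pCons 0 f) 0 = 0" by simp
    then show False by simp
  qed
  moreover have "range emb \<subseteq> range (ev z)" by (metis ev_const image_subsetI rangeI)
  moreover have "z \<in> range (ev z)"
    using rangeI[of "ev z" "monom 1 1"] by (simp add: ev_monom emb_one)
  ultimately have "range (ev z) \<in> \<S>"
    unfolding \<S>_def using subring_range_ev z_def by auto
  then have "\<S> \<noteq> {}" by blast
  moreover have "\<Union>\<C> \<in> \<S>" if \<C>: "\<C> \<noteq> {}" "subset.chain \<S> \<C>" for \<C>
  proof -
    have sub: "\<C> \<subseteq> \<S>" and tot: "\<And>A B. A \<in> \<C> \<Longrightarrow> B \<in> \<C> \<Longrightarrow> A \<subseteq> B \<or> B \<subseteq> A"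
      using \<C>(2) unfolding subset.chain_def by auto
    have "is_subring (\<Union>\<C>)"
      unfolding is_subring_def
    proof (intro conjI ballI)
      show "1 \<in> \<Union>\<C>" using \<C>(1) sub unfolding \<S>_def is_subring_def by blast
      fix a b assume "a \<in> \<Union>\<C>" "b \<in> \<Union>\<C>"
      then obtain A where A: "A \<in> \<C>" "a \<in> A" "b \<in> A" using tot by blast
      then have "is_subring A" using sub unfolding \<S>_def by blast
      with A show "a - b \<in> \<Union>\<C>" "a * b \<in> \<Union>\<C>" unfolding is_subring_def by blast+
    qed
    then show ?thesis using \<C>(1) sub unfolding \<S>_def by blast
  qed
  ultimately obtain R where R: "R \<in> \<S>" "\<And>S. S \<in> \<S> \<Longrightarrow> R \<subseteq> S \<Longrightarrow> S = R"
    using subset_Zorn_nonempty[of \<S>] by blast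
  have "maximal_without y R"
    unfolding maximal_without_def
  proof (intro conjI allI impI)
    fix S assume "is_subring S" "R \<subseteq> S" "y \<notin> S"
    then show "S = R" using R unfolding \<S>_def by blast
  qed (use R(1) in \<open>auto simp: \<S>_def\<close>)
  then show ?thesis by blast
qed

text \<open>So 1/y lies in the Jacobson radical of R. Inverting q = 1 - a / y does not bring in y,
  because y q = y - a shows that all products of y with powers of q are congruent to y modulo R;
  maximality then puts 1/q into R.\<close>

lemma maximal_without_unit:
  assumes "maximal_without y R" "a \<in> R"
  shows "1 - inverse y * a \<noteq> 0" "inverse (1 - inverse y * a) \<in> R"
proof -
  define z where "z = inverse y"
  have R: "is_subring R" "z \<in> R" "y \<notin> R" "\<And>S. is_subring S \<Longrightarrow> R \<subseteq> S \<Longrightarrow> y \<notin> S \<Longrightarrow> S = R"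
    using assms(1) unfolding maximal_without_def z_def by blast+
  have y0: "y \<noteq> 0" using R(3) subring_zero[OF R(1)] by auto
  then have zy: "y * z = 1" by (simp add: z_def)
  define q where "q = 1 - z * a"
  have q0: "q \<noteq> 0"
  proof
    assume "q = 0"
    then have "y = y * (z * a)" by (simp add: q_def)
    then show False using R(3) assms(2) zy by (simp flip: mult.assoc)
  qed
  have qR: "q \<in> R" unfolding q_def by (intro subring_diff subring_mult subring_one R assms(2))
  define S where "S = {r / q ^ n | r n. r \<in> R}"
  have "R \<subseteq> S"
  proof
    fix r assume "r \<in> R"
    then show "r \<in> S" unfolding S_def by (intro CollectI exI[of _ r] exI[of _ 0]) simp
  qed
  moreover have "is_subring S"
    unfolding is_subring_def
  proof (intro conjI ballI)
    show "1 \<in> S" using \<open>R \<subseteq> S\<close> subring_one[OF R(1)] by blast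
    fix b c assume "b \<in> S" "c \<in> S"
    then obtain r n s k where *: "b = r / q ^ n" "c = s / q ^ k" "r \<in> R" "s \<in> R"
      unfolding S_def by blast
    have "b - c = (r * q ^ k - s * q ^ n) / q ^ (n + k)"
      using q0 * by (simp add: diff_divide_distrib power_add)
    moreover have "r * q ^ k - s * q ^ n \<in> R"
      using * by (intro subring_diff subring_mult subring_power R qR)
    ultimately show "b - c \<in> S" unfolding S_def by blast
    have "b * c = (r * s) / q ^ (n + k)" using * by (simp add: power_add)
    moreover have "r * s \<in> R" using * by (intro subring_mult R)
    ultimately show "b * c \<in> S" unfolding S_def by blast
  qed
  moreover have "y \<notin> S"
  proof
    assume "y \<in> S"
    then obtain r n where r: "y = r / q ^ n" "r \<in> R" unfolding S_def by blast
    have "\<exists>b\<in>R. y * q ^ n = y - b" for n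
    proof (induction n)
      case 0
      show ?case using subring_zero[OF R(1)] by (intro bexI[of _ 0]) auto
    next
      case (Suc n)
      then obtain b where b: "b \<in> R" "y * q ^ n = y - b" by blast
      have "y * q ^ Suc n = (y - b) * q" using b by simp
      also have "\<dots> = y - (y * z) * a - b * q" by (simp add: q_def algebra_simps)
      also have "\<dots> = y - (a + b * q)" by (simp add: zy)
      finally show ?case
        using b assms(2) by (intro bexI[of _ "a + b * q"] subring_add subring_mult R qR)
    qed
    then obtain b where b: "b \<in> R" "y * q ^ n = y - b" by blast
    moreover have "y * q ^ n = r" using r q0 by simp
    ultimately have "y = r + b" by (simp add: algebra_simps)
    then show False using R(3) r(2) b(1) subring_add[OF R(1)] by blast
  qed
  ultimately have "S = R" using R(4) by blast
  moreover have "inverse q \<in> S"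
    unfolding S_def by (intro CollectI exI[of _ 1] exI[of _ 1]) (simp add: subring_one[OF R(1)] divide_inverse)
  ultimately show "1 - inverse y * a \<noteq> 0" "inverse (1 - inverse y * a) \<in> R"
    using q0 unfolding q_def z_def by auto
qed

text \<open>The ring R[u] is strictly larger than R, so by maximality it contains y.\<close>

lemma maximal_without_adjoin:
  assumes "maximal_without y R" "u \<notin> R"
  shows "\<exists>n. y \<in> lin_combs R {..n} (\<lambda>i. u ^ i)"
proof -
  have R: "is_subring R" "\<And>S. is_subring S \<Longrightarrow> R \<subseteq> S \<Longrightarrow> y \<notin> S \<Longrightarrow> S = R"
    using assms(1) unfolding maximal_without_def by auto
  define S where "S = {poly f u | f. \<forall>i. coeff f i \<in> R}"
  have "is_subring S"
    unfolding is_subring_def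
  proof (intro conjI ballI)
    show "1 \<in> S" unfolding S_def
      by (intro CollectI exI[of _ 1]) (auto simp: coeff_1 intro: subring_one subring_zero R)
    fix b c assume "b \<in> S" "c \<in> S"
    then obtain f g where *: "b = poly f u" "c = poly g u" "\<forall>i. coeff f i \<in> R" "\<forall>i. coeff g i \<in> R"
      unfolding S_def by blast
    show "b - c \<in> S" unfolding S_def
      using * by (intro CollectI exI[of _ "f - g"]) (auto intro: subring_diff R)
    show "b * c \<in> S" unfolding S_def
      using * by (intro CollectI exI[of _ "f * g"])
        (auto simp: coeff_mult intro!: subring_sum subring_mult R)
  qed
  moreover have "R \<subseteq> S"
  proof
    fix r assume "r \<in> R"
    then show "r \<in> S" unfolding S_def
      by (intro CollectI exI[of _ "[:r:]"]) (auto simp: coeff_pCons subring_zero[OF R(1)] split: nat.split)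
  qed
  moreover have "u \<in> S"
    unfolding S_def
    by (intro CollectI exI[of _ "[:0, 1:]"])
       (auto simp: coeff_pCons subring_zero[OF R(1)] subring_one[OF R(1)] split: nat.split)
  ultimately have "y \<in> S" using R(2) assms(2) by blast
  then obtain f where f: "y = poly f u" "\<forall>i. coeff f i \<in> R" unfolding S_def by blast
  then have "y \<in> lin_combs R {..degree f} (\<lambda>i. u ^ i)"
    unfolding lin_combs_def by (auto simp: poly_altdef)
  then show ?thesis by blast
qed

text \<open>Multiplying the expression of y in powers of 1/u by 1/y isolates the unit 1 - b/y, with
  b the constant coefficient, on one side and leaves negative powers of u on the other. Multiplied
  by the n-th power of u, this expresses that power by lower ones.\<close>

lemma maximal_without_reduce:
  assumes R: "maximal_without y R" and "u \<noteq> 0" "m \<le> n"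
    and n: "y \<in> lin_combs R {..n} (\<lambda>i. u ^ i)" and m: "y \<in> lin_combs R {..m} (\<lambda>i. inverse u ^ i)"
  shows "n > 0 \<and> y \<in> lin_combs R {..n - 1} (\<lambda>i. u ^ i)"
proof -
  define z where "z = inverse y"
  have sub: "is_subring R" and zR: "z \<in> R" and yR: "y \<notin> R"
    using R unfolding maximal_without_def z_def by auto
  have "y \<noteq> 0" using yR subring_zero[OF sub] by auto
  then have zy: "z * y = 1" by (simp add: z_def)
  obtain a where a: "\<forall>i\<in>{..n}. a i \<in> R" "y = (\<Sum>i\<le>n. a i * u ^ i)"
    using n unfolding lin_combs_def by blast
  obtain b where b: "\<forall>i\<in>{..m}. b i \<in> R" "y = (\<Sum>i\<le>m. b i * inverse u ^ i)"
    using m unfolding lin_combs_def by blast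
  define q where "q = 1 - z * b 0"
  have q: "q \<noteq> 0" "inverse q \<in> R"
    unfolding q_def z_def using maximal_without_unit[OF R, of "b 0"] b(1) by auto
  have m0: "m > 0"
  proof (rule ccontr)
    assume "\<not> m > 0"
    then show False using b yR by simp
  qed
  have split: "y = b 0 + (\<Sum>i<m. b (Suc i) * inverse u ^ Suc i)"
  proof -
    obtain k where "m = Suc k" using m0 by (cases m) auto
    then show ?thesis using b(2) by (simp add: sum.atMost_Suc_shift lessThan_Suc_atMost del: sum.atMost_Suc)
  qed
  have "q = z * (y - b 0)" using zy by (simp add: q_def algebra_simps)
  also have "\<dots> = (\<Sum>i<m. z * b (Suc i) * inverse u ^ Suc i)"
    by (subst split) (simp add: sum_distrib_left mult.assoc)
  finally have q_eq: "q = (\<Sum>i<m. z * b (Suc i) * inverse u ^ Suc i)" .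
  have un: "u ^ n = (\<Sum>i<m. (inverse q * z * b (Suc i)) * u ^ (n - Suc i))"
  proof -
    have "u ^ n = inverse q * u ^ n * q" using q(1) by simp
    also have "\<dots> = (\<Sum>i<m. (inverse q * z * b (Suc i)) * (u ^ n * inverse u ^ Suc i))"
      by (subst q_eq) (simp add: sum_distrib_left mult_ac)
    also have "\<dots> = (\<Sum>i<m. (inverse q * z * b (Suc i)) * u ^ (n - Suc i))"
    proof (intro sum.cong refl)
      fix i assume "i \<in> {..<m}"
      then have "Suc i \<le> n" using assms(3) by auto
      then have "u ^ n = u ^ (n - Suc i) * u ^ Suc i" by (simp only: power_add[symmetric] le_add_diff_inverse2)
      then have "u ^ n * inverse u ^ Suc i = u ^ (n - Suc i)"
        using assms(2) by (simp add: power_inverse mult.assoc del: power_Suc)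
      then show "(inverse q * z * b (Suc i)) * (u ^ n * inverse u ^ Suc i) =
        (inverse q * z * b (Suc i)) * u ^ (n - Suc i)" by simp
    qed
    finally show ?thesis .
  qed
  have n0: "n > 0" using m0 assms(3) by simp
  let ?L = "lin_combs R {..n - 1} (\<lambda>i. u ^ i)"
  have pow: "u ^ i \<in> ?L" if "i < n" for i
    using lin_combs_base[OF sub, of "{..n - 1}" i "\<lambda>i. u ^ i"] that by simp
  have "u ^ n \<in> ?L"
    unfolding un using b(1) n0
    by (intro lin_combs_sum[OF sub] lin_combs_scale[OF sub] subring_mult[OF sub] q zR pow) auto
  have "a i * u ^ i \<in> ?L" if "i \<le> n" for i
    using a(1) that pow \<open>u ^ n \<in> ?L\<close> by (intro lin_combs_scale[OF sub]) (auto simp: le_less)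
  then have "y \<in> ?L" unfolding a(2) by (intro lin_combs_sum[OF sub]) auto
  then show ?thesis using n0 by simp
qed

text \<open>If both u and 1/u were missing, y would be a polynomial in each of them over R. The
  longer of the two expressions can always be shortened, an infinite descent on the sum of their
  lengths.\<close>

lemma maximal_without_valuation:
  assumes "maximal_without y R" "u \<noteq> 0" "u \<notin> R"
  shows "inverse u \<in> R"
proof (rule ccontr)
  assume *: "inverse u \<notin> R"
  have contra: False
    if "u \<noteq> 0" "y \<in> lin_combs R {..n} (\<lambda>i. u ^ i)" "y \<in> lin_combs R {..m} (\<lambda>i. inverse u ^ i)"
    for u n m
    using that
  proof (induction "n + m" arbitrary: n m rule: less_induct)
    case less
    show ?case
    proof (cases "m \<le> n")
      case True
      from maximal_without_reduce[OF assms(1) less.prems(1) True less.prems(2,3)]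
      show ?thesis using less.hyps[of "n - 1" m] less.prems by auto
    next
      case False
      with maximal_without_reduce[OF assms(1), of "inverse u" n m] less.prems
      show ?thesis using less.hyps[of n "m - 1"] by auto
    qed
  qed
  show False
    using maximal_without_adjoin[OF assms(1,3)] maximal_without_adjoin[OF assms(1) *] contra[OF assms(2)] by blast
qed

text \<open>Discreteness comes from the bound on strict chains of valuations, applied twice. If the
  maximal ideal m had no generator, m would contain arbitrarily long chains below 1/y; and if some
  nonzero x were divisible by all powers of a generator t, these powers would form arbitrarily long
  chains below x.\<close>

lemma maximal_without_in_curve:
  assumes "maximal_without y R"
  shows "R \<in> curve emb"
proof -
  have sub: "is_subring R" and kR: "range emb \<subseteq> R" and zR: "inverse y \<in> R" and yR: "y \<notin> R"
    using assms unfolding maximal_without_def by auto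
  have y0: "y \<noteq> 0" using yR subring_zero[OF sub] by auto
  define m where "m = {r \<in> R. r = 0 \<or> inverse r \<notin> R}"
  have val: "inverse u \<in> R" if "u \<noteq> 0" "u \<notin> R" for u using maximal_without_valuation[OF assms that] .
  have m0: "0 \<in> m" unfolding m_def using subring_zero[OF sub] by simp
  have m1: "1 \<notin> m" unfolding m_def using subring_one[OF sub] by simp
  have mR: "m \<subseteq> R" unfolding m_def by blast
  have m_mult: "a * b \<in> m" if "a \<in> R" "b \<in> m" for a b
  proof (cases "a * b = 0")
    case False
    have "inverse (a * b) \<notin> R"
    proof
      assume "inverse (a * b) \<in> R"
      then have "a * inverse (a * b) \<in> R" using that subring_mult[OF sub] by blast
      moreover have "a * inverse (a * b) = inverse b" using False by (simp add: field_simps)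
      ultimately have "inverse b \<in> R" by metis
      then show False using False that(2) by (simp add: m_def)
    qed
    then show ?thesis using that subring_mult[OF sub] by (auto simp: m_def)
  qed (use m0 in auto)
  have m_add: "a + b \<in> m" if "a \<in> m" "b \<in> m" for a b
  proof (cases "a = 0 \<or> b = 0")
    case False
    have "c + d \<in> m" if "c \<noteq> 0" "c / d \<in> R" "d \<noteq> 0" "d \<in> m" for c d
    proof -
      have "(1 + c / d) * d \<in> m" using that by (intro m_mult subring_add subring_one sub)
      then show ?thesis using that by (simp add: distrib_right add.commute)
    qed
    from this[of a b] this[of b a] val[of "a / b"] show ?thesis using False that by (auto simp: add.commute)
  qed (use that in auto)
  have m_nonconst: "w \<notin> range emb" if "w \<in> m" "w \<noteq> 0" for w
  proof
    assume "w \<in> range emb"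
    then have "inverse w \<in> R" using kR emb_inverse by (metis rangeE rangeI subsetD)
    then show False using that by (auto simp: m_def)
  qed
  have not_R: "inverse u \<in> m" if "u \<noteq> 0" "u \<notin> R" for u
    using val[OF that] that by (simp add: m_def)
  have z: "inverse y \<in> m" "inverse y \<noteq> 0" using y0 zR yR by (auto simp: m_def)
  have "\<exists>t\<in>m. t \<noteq> 0 \<and> (\<forall>w\<in>m. w / t \<in> R)"
  proof (rule ccontr)
    assume "\<not> ?thesis"
    then have "\<forall>t\<in>m - {0}. \<exists>w. w \<in> m \<and> w / t \<notin> R" by blast
    from bchoice[OF this] obtain g where g: "\<forall>t\<in>m - {0}. g t \<in> m \<and> g t / t \<notin> R" by blast
    \<comment> \<open>Each g t is a proper divisor of t inside m, so valuations drop strictly along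
      the iterates of g.\<close>
    have g': "g t \<in> m - {0}" "t / g t \<in> m" if "t \<in> m - {0}" for t
    proof -
      have "g t / t \<noteq> 0" using g that subring_zero[OF sub] by metis
      then show "g t \<in> m - {0}" "t / g t \<in> m" using g that not_R[of "g t / t"] by auto
    qed
    define w where "w k = (g ^^ k) (inverse y)" for k
    have w: "w k \<in> m - {0}" for k
      by (induction k) (use z g' in \<open>auto simp: w_def\<close>)
    have w_Suc: "w (Suc k) = g (w k)" for k by (simp add: w_def)
    have w_div: "w i / w (i + Suc k) \<in> m" for i k
    proof (induction k)
      case 0
      then show ?case using g'(2)[OF w[of i]] by (simp add: w_Suc)
    next
      case (Suc k)
      have "w i / w (i + Suc (Suc k)) = (w i / w (i + Suc k)) * (w (i + Suc k) / w (i + Suc (Suc k)))"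
        using w by simp
      also have "\<dots> \<in> m" using Suc mR g'(2)[OF w[of "i + Suc k"]] by (intro m_mult) (auto simp: w_Suc)
      finally show ?case .
    qed
    define r where "r = Suc (field_degree (inverse y))"
    \<comment> \<open>The iterates in reverse order, so that valuations increase, with 1 in front:
      one more element than the degree of 1/y permits.\<close>
    define c where "c i = (if i = 0 then 1 else w (r - i))" for i
    have "r \<le> field_degree (inverse y)"
    proof (rule chain_length_le_field_degree[OF sub kR mR m0 m1 m_add m_mult m_nonconst[OF z], of r c])
      fix i assume i: "i < r"
      show "c i \<in> R" using w mR subring_one[OF sub] by (auto simp: c_def)
      show "c i \<noteq> 0" using w by (auto simp: c_def)
      have "w 0 / w (0 + Suc (r - i - 1)) \<in> m" by (rule w_div)
      moreover have "0 + Suc (r - i - 1) = r - i" using i by simp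
      ultimately have "w 0 / w (r - i) \<in> m" by metis
      then show "inverse y / c i \<in> m" using z by (simp add: c_def w_def)
    next
      fix i j assume ij: "i < j" "j < r"
      show "c j / c i \<in> m"
      proof (cases "i = 0")
        case True
        then show ?thesis using ij w by (auto simp: c_def)
      next
        case False
        have "w (r - j) / w ((r - j) + Suc (j - i - 1)) \<in> m" by (rule w_div)
        moreover have "(r - j) + Suc (j - i - 1) = r - i" using ij by simp
        ultimately have "w (r - j) / w (r - i) \<in> m" by metis
        then show ?thesis using False ij by (simp add: c_def)
      qed
    qed
    then show False by (simp add: r_def)
  qed
  then obtain t where t: "t \<in> m" "t \<noteq> 0" "\<And>w. w \<in> m \<Longrightarrow> w / t \<in> R" by blast
  have pow: "t ^ Suc k \<in> m" for k
    using t(1) mR subring_power[OF sub, of t k] m_mult[of "t ^ k" t] by (auto simp: mult.commute)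
  \<comment> \<open>If no quotient by a power of t is a unit, every quotient stays in m and can be
    divided by t once more.\<close>
  have "\<exists>n. unit_in R (x / t ^ n)" if x: "x \<in> R" "x \<noteq> 0" for x
  proof (rule ccontr)
    assume no: "\<not> ?thesis"
    have xm: "x / t ^ n \<in> m" for n
    proof (induction n)
      case 0
      then show ?case using no[simplified, rule_format, of 0] x by (auto simp: m_def unit_in_def)
    next
      case (Suc n)
      then have "x / t ^ Suc n \<in> R" using t(3)[OF Suc] by (simp add: mult.commute)
      then show ?case using no[simplified, rule_format, of "Suc n"] x t(2) by (auto simp: m_def unit_in_def)
    qed
    have x_nc: "x \<notin> range emb" using m_nonconst xm[of 0] x by simp
    have "Suc (field_degree x) \<le> field_degree x"
    proof (rule chain_length_le_field_degree[OF sub kR mR m0 m1 m_add m_mult x_nc, of "Suc (field_degree x)" "\<lambda>i. t ^ i"])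
      fix i j :: nat assume "i < j"
      then have "Suc (j - i - 1) = j - i" by simp
      moreover have "t ^ j = t ^ (j - i) * t ^ i" using \<open>i < j\<close> by (simp flip: power_add)
      ultimately have "t ^ j / t ^ i = t ^ Suc (j - i - 1)" using t(2) by simp
      then show "t ^ j / t ^ i \<in> m" using pow by metis
    qed (use t mR xm in \<open>auto intro: subring_power[OF sub]\<close>)
    then show False by simp
  qed
  note nonneg = this
  have "\<exists>(n::int) u. unit_in R u \<and> x = u * t powi n" if x0: "x \<noteq> 0" for x
  proof (cases "x \<in> R")
    case True
    then obtain n where "unit_in R (x / t ^ n)" using nonneg[OF _ x0] by blast
    then show ?thesis
      using t(2) by (intro exI[of _ "int n"] exI[of _ "x / t ^ n"]) simp
  next
    case False
    then have "inverse x \<in> R" by (rule val[OF x0])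
    then obtain n where "unit_in R (inverse x / t ^ n)" using nonneg[of "inverse x"] x0 by auto
    then have "unit_in R (x * t ^ n)"
      by (simp add: unit_in_def divide_inverse mult.commute)
    then show ?thesis
      using t(2) by (intro exI[of _ "- int n"] exI[of _ "x * t ^ n"]) (simp add: power_int_minus)
  qed
  moreover have "\<not> unit_in R t" using t by (auto simp: m_def unit_in_def)
  ultimately have "uniformizer R t" unfolding uniformizer_def using t mR by auto
  then show ?thesis unfolding curve_def using sub kR by blast
qed

text \<open>In contrapositive form: functions regular everywhere are constant. This is the base case
  of Riemann's count.\<close>

lemma ex_pole:
  assumes "y \<notin> range emb"
  shows "\<exists>P\<in>curve emb. y \<notin> P"
  using ex_maximal_without[OF assms] maximal_without_in_curve unfolding maximal_without_def by blast

section \<open>Constants and residues at a point\<close>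

lemma consts_subset: "P \<in> curve emb \<Longrightarrow> range emb \<subseteq> P"
  unfolding curve_def by blast

lemma ord_const: "P \<in> curve emb \<Longrightarrow> ord_at P (emb c) = 0" if "c \<noteq> 0"
proof -
  assume P: "P \<in> curve emb"
  interpret dvr P using curve_dvr[OF P] .
  have "unit_in P (emb c)"
    using consts_subset[OF P] emb_inverse[of c] emb_nonzero[OF that] unfolding unit_in_def by (metis rangeI subsetD)
  then show ?thesis by (simp add: unit_iff)
qed

lemma nonconst_if_ord_nonzero:
  assumes "P \<in> curve emb" "ord_at P x \<noteq> 0" "x \<noteq> 0"
  shows "x \<notin> range emb"
  using ord_const[OF _ assms(1)] assms(2,3) emb_zero by (metis rangeE)

text \<open>The residue field is k. Otherwise every f - c is a unit at P, and so is g(f) for every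
  nonzero polynomial g. The powers of f are then independent modulo a uniformizer t, hence over
  k[t], and there are more of them than the degree of t allows.\<close>

lemma ex_residue:
  assumes P: "P \<in> curve emb" and "f \<in> P"
  shows "\<exists>c. vge P 1 (f - emb c)"
proof (rule ccontr)
  assume no: "\<not> ?thesis"
  interpret dvr P using curve_dvr[OF P] .
  obtain t where t: "uniformizer P t" using ex_uniformizer by blast
  have t_nc: "t \<notin> range emb"
    using nonconst_if_ord_nonzero[OF P] uniformizer_ord[OF t] t unfolding uniformizer_def by auto
  have "\<not> lin_dep (range (ev t)) {..field_degree t} (\<lambda>i. f ^ i)"
  proof (rule not_lin_dep_if_indep_mod[OF subring consts_subset[OF P] _ t_nc])
    show "t \<in> P" using t unfolding uniformizer_def by blast
    show "f ^ i \<in> P" for i using subring_power[OF subring assms(2)] .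
    fix c r assume r: "r \<in> P" "(\<Sum>i\<le>field_degree t. emb (c i) * f ^ i) = t * r"
    define g where "g = (\<Sum>i\<le>field_degree t. monom (c i) i)"
    have g: "ev f g = t * r" using r(2) by (simp add: g_def ev_sum ev_monom)
    have "ev f g \<in> {x. x \<noteq> 0 \<and> ord_at P x = 0}" if "g \<noteq> 0"
    proof (rule ev_mult_closed)
      show "f - emb c \<in> {x. x \<noteq> 0 \<and> ord_at P x = 0}" for c
      proof -
        have "f - emb c \<in> P" using assms(2) consts_subset[OF P] by (intro subring_diff[OF subring]) auto
        moreover have "\<not> vge P 1 (f - emb c)" using no by blast
        ultimately show ?thesis by (simp add: vge_def mem_iff)
      qed
    qed (use that ord_const[OF _ P] emb_nonzero ord_mult in auto)
    moreover have "vge P 1 (t * r)"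
      using vge_mult[of 1 t 0 r] vge_ord[of t] uniformizer_ord[OF t] r(1) by (simp add: vge_0_iff)
    ultimately have "g = 0" using g by (metis (mono_tags, lifting) mem_Collect_eq not_one_le_zero vge_def)
    moreover have "coeff g i = c i" if "i \<le> field_degree t" for i using that by (simp add: g_def coeff_sum)
    ultimately show "\<forall>i\<in>{..field_degree t}. c i = 0" by auto
  qed
  then show False using lin_dep_if_field_degree_less[OF t_nc, of "{..field_degree t}"] by simp
qed

end

section \<open>Zeros and poles\<close>

text \<open>If k were finite, the polynomial 1 plus the product of all X - a would be nonconstant
  without a root.\<close>

lemma infinite_UNIV_alg_closed: "infinite (UNIV :: 'k::alg_closed_field set)"
proof
  assume fin: "finite (UNIV :: 'k set)"
  define f :: "'k poly" where "f = 1 + (\<Prod>a\<in>UNIV. [:- a, 1:])"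
  have f: "poly f x = 1" for x
    using fin by (simp add: f_def poly_prod prod_zero_iff)
  have "degree (\<Prod>a\<in>(UNIV :: 'k set). [:- a, 1:]) = card (UNIV :: 'k set)"
    by (subst degree_prod_eq_sum_degree) auto
  moreover have "card (UNIV :: 'k set) > 0" using fin by (simp add: card_gt_0_iff)
  ultimately have "degree f > 0"
    unfolding f_def by (subst degree_add_eq_right) auto
  then obtain x where "poly f x = 0" using alg_closed_imp_poly_has_root by blast
  then show False using f by simp
qed

context fun_field
begin

section \<open>Approximation at finitely many points and the bound on the number of zeros\<close>

lemma ex_separating:
  assumes "P \<in> curve emb" "Q \<in> curve emb" "P \<noteq> Q"
  shows "\<exists>w. w \<noteq> 0 \<and> ord_at P w < 0 \<and> ord_at Q w > 0"
proof -
  interpret P: dvr P using curve_dvr[OF assms(1)] .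
  interpret Q: dvr Q using curve_dvr[OF assms(2)] .
  obtain a where a: "a \<in> P" "a \<notin> Q" using dvr_not_subset P.dvr_axioms Q.dvr_axioms assms(3) by blast
  obtain b where b: "b \<in> Q" "b \<notin> P" using dvr_not_subset P.dvr_axioms Q.dvr_axioms assms(3) by blast
  have nz: "a \<noteq> 0" "b \<noteq> 0" using a b subring_zero[OF P.subring] subring_zero[OF Q.subring] by auto
  have "ord_at P a \<ge> 0" "ord_at Q b \<ge> 0" "ord_at Q a < 0" "ord_at P b < 0"
    using a b nz P.mem_iff[of a] P.mem_iff[of b] Q.mem_iff[of a] Q.mem_iff[of b] by auto
  \<comment> \<open>Here a has a pole at Q but none at P, and b has a pole at P but none at
    Q.\<close>
  then show ?thesis
    using nz by (intro exI[of _ "b / a"]) (simp add: P.ord_divide Q.ord_divide)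
qed

lemma residue_unique:
  assumes "P \<in> curve emb" "vge P 1 (w - emb c)" "vge P 1 (w - emb d)"
  shows "c = d"
proof (rule ccontr)
  interpret dvr P using curve_dvr[OF assms(1)] .
  assume "c \<noteq> d"
  then have nz: "d - c \<noteq> 0" by simp
  have "vge P 1 ((w - emb c) - (w - emb d))" using vge_diff[OF assms(2,3)] .
  then have "vge P 1 (emb (d - c))" by (simp add: emb_diff)
  then show False using ord_const[OF nz assms(1)] emb_nonzero[OF nz] by (simp add: vge_def)
qed

text \<open>If \<open>c\<close> avoids the finitely many residues of \<open>w\<close>, then \<open>w / (w - c)\<close> is integral on \<open>F\<close>, a unit
  at the poles of \<open>w\<close> and a nonunit at its zeros.\<close>

lemma ex_separating_integral:
  assumes "finite F" "F \<subseteq> curve emb" "P \<in> F" "Q \<in> F" "P \<noteq> Q"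
  shows "\<exists>s. s \<noteq> 0 \<and> ord_at P s = 0 \<and> ord_at Q s > 0 \<and> (\<forall>R\<in>F. ord_at R s \<ge> 0)"
proof -
  have "P \<in> curve emb" "Q \<in> curve emb" using assms(2-4) by auto
  from ex_separating[OF this assms(5)] obtain w where
    w: "w \<noteq> 0" "ord_at P w < 0" "ord_at Q w > 0" by blast
  have "finite {c. vge R 1 (w - emb c)}" if "R \<in> F" for R
  proof (cases "\<exists>c. vge R 1 (w - emb c)")
    case True
    then obtain c where "vge R 1 (w - emb c)" by blast
    then have "{c. vge R 1 (w - emb c)} \<subseteq> {c}" using residue_unique[of R w] assms(2) that by auto
    then show ?thesis by (rule finite_subset) simp
  qed simp
  \<comment> \<open>Zero is excluded together with the residues, so that w - c is a unit at the
    zeros of w.\<close>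
  then have "finite (insert 0 (\<Union>R\<in>F. {c. vge R 1 (w - emb c)}))" using assms(1) by simp
  from ex_new_if_finite[OF infinite_UNIV_alg_closed this]
  obtain c where "c \<notin> insert 0 (\<Union>R\<in>F. {c. vge R 1 (w - emb c)})" by (rule exE)
  then have c: "c \<noteq> 0" "\<And>R. R \<in> F \<Longrightarrow> \<not> vge R 1 (w - emb c)" by auto
  have wc: "w - emb c \<noteq> 0" using c(2)[OF assms(3)] by (auto simp: vge_def)
  define s where "s = w / (w - emb c)"
  have s0: "s \<noteq> 0" using w wc by (simp add: s_def)
  have s: "(ord_at R w < 0 \<longrightarrow> ord_at R s = 0) \<and> (ord_at R w > 0 \<longrightarrow> ord_at R s > 0) \<and> ord_at R s \<ge> 0"
    if "R \<in> F" for R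
  proof -
    have R: "R \<in> curve emb" using that assms(2) by blast
    interpret dvr R using curve_dvr[OF R] .
    have cc: "emb (- c) \<noteq> 0" "ord_at R (emb (- c)) = 0" using emb_nonzero ord_const[OF _ R] c(1) by auto
    have os: "ord_at R s = ord_at R w - ord_at R (w + emb (- c))"
      unfolding s_def using ord_divide[OF w(1) wc] by (simp add: emb_uminus)
    have w': "w + emb (- c) = w - emb c" by (simp add: emb_uminus)
    consider "ord_at R w < 0" | "ord_at R w > 0" | "ord_at R w = 0" by linarith
    then show ?thesis
    proof cases
      case 1
      then have "ord_at R (w + emb (- c)) = ord_at R w"
        using ord_add_lt(2)[OF w(1), of "emb (- c)"] cc by (simp add: vge_def)
      then show ?thesis using os 1 by simp
    next
      case 2
      then have "ord_at R (emb (- c) + w) = 0"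
        using ord_add_lt(2)[OF cc(1), of w] cc by (simp add: vge_def)
      then show ?thesis using os 2 by (simp add: add.commute)
    next
      case 3
      have "vge R 0 (w - emb c)"
        using 3 cc vge_add[of 0 w "emb (- c)"] unfolding w' by (simp add: vge_def)
      then have "ord_at R (w + emb (- c)) = 0"
        using c(2)[OF that] wc unfolding w' by (auto simp: vge_def)
      then show ?thesis using os 3 by simp
    qed
  qed
  show ?thesis using s0 s[OF assms(3)] s[OF assms(4)] s w by (intro exI[of _ s]) auto
qed

text \<open>A product of separating functions, one for each other point of F. Their integrality on
  all of F ensures that no factor destroys the zero contributed by another.\<close>

lemma ex_unit_at_only:
  assumes "finite F" "F \<subseteq> curve emb" "P \<in> F"
  shows "\<exists>s. s \<noteq> 0 \<and> ord_at P s = 0 \<and> (\<forall>Q\<in>F - {P}. ord_at Q s > 0)"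
proof -
  have "\<forall>Q\<in>F - {P}. \<exists>s. s \<noteq> 0 \<and> ord_at P s = 0 \<and> ord_at Q s > 0 \<and> (\<forall>R\<in>F. ord_at R s \<ge> 0)"
    by (intro ballI ex_separating_integral[OF assms]) auto
  from bchoice[OF this] obtain s where s: "\<forall>Q\<in>F - {P}. s Q \<noteq> 0 \<and> ord_at P (s Q) = 0 \<and>
    ord_at Q (s Q) > 0 \<and> (\<forall>R\<in>F. ord_at R (s Q) \<ge> 0)" by blast
  have prod: "ord_at R (prod s G) = (\<Sum>Q\<in>G. ord_at R (s Q)) \<and> prod s G \<noteq> 0"
    if "finite G" "G \<subseteq> F - {P}" "R \<in> F" for R G
    using that
  proof (induction G rule: finite_induct)
    case empty
    then show ?case using dvr.ord_one[OF curve_dvr[of R emb]] assms(2) by auto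
  next
    case (insert Q G)
    moreover have "s Q \<noteq> 0" using insert.prems s by blast
    ultimately show ?case using dvr.ord_mult[OF curve_dvr[of R emb]] assms(2) by auto
  qed
  have fin: "finite (F - {P})" using assms(1) by simp
  show ?thesis
  proof (intro exI[of _ "prod s (F - {P})"] conjI ballI)
    show "prod s (F - {P}) \<noteq> 0" using prod[OF fin _ assms(3)] by blast
    show "ord_at P (prod s (F - {P})) = 0" using prod[OF fin _ assms(3)] s by simp
    fix Q assume Q: "Q \<in> F - {P}"
    have "0 < ord_at Q (s Q)" using s Q by blast
    also have "\<dots> \<le> (\<Sum>R\<in>F - {P}. ord_at Q (s R))"
      using s Q fin by (intro member_le_sum) auto
    finally show "ord_at Q (prod s (F - {P})) > 0" using prod[OF fin, of Q] Q by simp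
  qed
qed

text \<open>For each zero P and each a below its multiplicity, a function is built with order
  exactly a at P and order at least that of x at the other zeros. Modulo x these functions are
  independent, so their number is bounded by the degree.\<close>

lemma sum_zeros_le_field_degree:
  assumes F: "finite F" "F \<subseteq> curve emb" and x: "x \<notin> range emb" and pos: "\<And>P. P \<in> F \<Longrightarrow> ord_at P x > 0"
  shows "(\<Sum>P\<in>F. ord_at P x) \<le> int (field_degree x)"
proof -
  have x0: "x \<noteq> 0" using x emb_zero by (metis rangeI)
  have "\<forall>P\<in>F. \<exists>t. uniformizer P t" using F(2) unfolding curve_def by blast
  from bchoice[OF this] obtain t where t: "\<forall>P\<in>F. uniformizer P (t P)" by blast
  have "\<forall>P\<in>F. \<exists>s. s \<noteq> 0 \<and> ord_at P s = 0 \<and> (\<forall>Q\<in>F - {P}. ord_at Q s > 0)"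
    by (intro ballI ex_unit_at_only[OF F])
  from bchoice[OF this] obtain s where
    s: "\<forall>P\<in>F. s P \<noteq> 0 \<and> ord_at P (s P) = 0 \<and> (\<forall>Q\<in>F - {P}. ord_at Q (s P) > 0)" by blast
  define e where "e P = nat (ord_at P x)" for P
  have e: "int (e P) = ord_at P x" if "P \<in> F" for P using pos[OF that] by (simp add: e_def)
  \<comment> \<open>\<open>t P\<close> may have poles at other points of F. This exponent of
    \<open>s P\<close> makes up for them and for the order of x; the sum over F avoids taking a
    maximum.\<close>
  define N where "N P a = (\<Sum>Q\<in>F. nat \<bar>ord_at Q x - int a * ord_at Q (t P)\<bar>)" for P a
  define u where "u = (\<lambda>(P, a). s P ^ N P a * t P ^ a)"
  define I where "I = Sigma F (\<lambda>P. {..<e P})"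
  have finI: "finite I" unfolding I_def using F(1) by simp
  have u_self: "ord_at P (u (P, a)) = int a" and u_nz: "u (P, a) \<noteq> 0" if "P \<in> F" for P a
  proof -
    interpret dvr P using curve_dvr[of P emb] that F(2) by auto
    have "t P \<noteq> 0" "s P \<noteq> 0" "ord_at P (s P) = 0" "ord_at P (t P) = 1"
      using t s that uniformizer_ord unfolding uniformizer_def by auto
    then show "ord_at P (u (P, a)) = int a" "u (P, a) \<noteq> 0"
      by (simp_all add: u_def ord_mult ord_power)
  qed
  have u_other: "ord_at Q (u (P, a)) \<ge> ord_at Q x" if "P \<in> F" "Q \<in> F" "P \<noteq> Q" for P Q a
  proof -
    interpret dvr Q using curve_dvr[of Q emb] that F(2) by auto
    have nz: "t P \<noteq> 0" "s P \<noteq> 0" using t s that unfolding uniformizer_def by auto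
    have "ord_at Q (s P) > 0" using s that by auto
    then have sQ: "ord_at Q (s P) \<ge> 1" by simp
    have "ord_at Q x - int a * ord_at Q (t P) \<le> int (nat \<bar>ord_at Q x - int a * ord_at Q (t P)\<bar>)" by simp
    also have "\<dots> \<le> int (N P a)"
      unfolding N_def of_nat_le_iff using that F(1) by (intro member_le_sum) auto
    also have "\<dots> \<le> int (N P a) * ord_at Q (s P)"
      using mult_left_mono[OF sQ, of "int (N P a)"] by simp
    finally show ?thesis using nz by (simp add: u_def ord_mult ord_power)
  qed
  \<comment> \<open>The semilocal ring of functions regular on F, in which reduction modulo x takes
    place.\<close>
  define R where "R = {y. \<forall>P\<in>F. y \<in> P}"
  have Rsub: "is_subring R"
  proof -
    have "is_subring P" if "P \<in> F" for P using F(2) dvr.subring[OF curve_dvr[of P emb]] that by auto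
    then show ?thesis unfolding R_def is_subring_def by blast
  qed
  have xR: "x \<in> R"
    unfolding R_def
  proof (intro CollectI ballI)
    fix P assume P: "P \<in> F"
    then show "x \<in> P" using dvr.mem_iff[OF curve_dvr[of P emb]] F(2) pos[OF P] by auto
  qed
  have uR: "u i \<in> R" if i: "i \<in> I" for i
    unfolding R_def
  proof (intro CollectI ballI)
    fix Q assume Q: "Q \<in> F"
    obtain P a where i: "i = (P, a)" "P \<in> F" using i unfolding I_def by (cases i) auto
    have "ord_at Q (u i) \<ge> 0"
      using u_self[of P a] u_other[of P Q a] i Q pos[OF Q] by (cases "P = Q") auto
    then show "u i \<in> Q" using dvr.mem_iff[OF curve_dvr[of Q emb]] F(2) Q by auto
  qed
  have "\<not> lin_dep (range (ev x)) I u"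
  proof (rule not_lin_dep_if_indep_mod[OF Rsub _ xR x uR])
    show "range emb \<subseteq> R" unfolding R_def using consts_subset F(2) by blast
  next
    fix c r assume r: "r \<in> R" "(\<Sum>i\<in>I. emb (c i) * u i) = x * r"
    show "\<forall>i\<in>I. c i = 0"
    proof (rule ccontr)
      assume "\<not> (\<forall>i\<in>I. c i = 0)"
      then obtain P a' where P: "(P, a') \<in> I" "c (P, a') \<noteq> 0" by auto
      \<comment> \<open>The term of this index has order exactly a at P, all other terms and x
        itself have order at least a + 1 there.\<close>
      define a where "a = (LEAST a. (P, a) \<in> I \<and> c (P, a) \<noteq> 0)"
      have a: "(P, a) \<in> I" "c (P, a) \<noteq> 0"
        using LeastI[of "\<lambda>a. (P, a) \<in> I \<and> c (P, a) \<noteq> 0" a'] P unfolding a_def by auto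
      have below: "c (P, b) = 0" if "b < a" "(P, b) \<in> I" for b
        using not_less_Least[of b "\<lambda>a. (P, a) \<in> I \<and> c (P, a) \<noteq> 0"] that unfolding a_def by auto
      have PF: "P \<in> F" and ae: "a < e P" using a(1) by (auto simp: I_def)
      have PX: "P \<in> curve emb" using PF F(2) by blast
      interpret dvr P using curve_dvr[OF PX] .
      have const: "emb c \<in> P" for c using consts_subset[OF PX] by blast
      have ordx: "int a + 1 \<le> ord_at P x" using ae e[OF PF] by simp
      have rest: "vge P (int a + 1) (emb (c i) * u i)" if i: "i \<in> I - {(P, a)}" for i
      proof -
        obtain Q b where Q: "i = (Q, b)" "Q \<in> F" "(Q, b) \<in> I" using i unfolding I_def by (cases i) auto
        show ?thesis
        proof (cases "Q = P")
          case True
          show ?thesis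
          proof (cases "b < a")
            case True
            then show ?thesis using below[of b] Q \<open>Q = P\<close> by (simp add: emb_zero)
          next
            case False
            then have "b \<ge> a + 1" using i Q True by (cases "b = a") auto
            then have "vge P (int a + 1) (u i)" using u_self[OF PF, of b] Q True by (simp add: vge_def)
            then show ?thesis using vge_mult_mem const by blast
          qed
        next
          case False
          then have "vge P (int a + 1) (u i)" using u_other[OF Q(2) PF, of b] ordx Q by (simp add: vge_def)
          then show ?thesis using vge_mult_mem const by blast
        qed
      qed
      have "(\<Sum>i\<in>I. emb (c i) * u i) = emb (c (P, a)) * u (P, a) + (\<Sum>i\<in>I - {(P, a)}. emb (c i) * u i)"
        using a(1) finI by (simp add: sum.remove)
      then have eq: "emb (c (P, a)) * u (P, a) = x * r - (\<Sum>i\<in>I - {(P, a)}. emb (c i) * u i)"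
        using r(2) by (simp add: algebra_simps)
      have "vge P (int a + 1) x" using ordx by (simp add: vge_def)
      moreover have "r \<in> P" using r(1) PF by (simp add: R_def)
      ultimately have "vge P (int a + 1) (x * r)"
        using vge_mult_mem[of r "int a + 1" x] by (simp add: mult.commute)
      then have "vge P (int a + 1) (emb (c (P, a)) * u (P, a))"
        unfolding eq using rest by (intro vge_diff vge_sum)
      moreover have "emb (c (P, a)) \<noteq> 0" "ord_at P (emb (c (P, a))) = 0"
        using a(2) emb_nonzero ord_const[OF _ PX] by auto
      ultimately show False using u_self[OF PF, of a] u_nz[OF PF, of a] by (simp add: vge_def ord_mult)
    qed
  qed
  then have "card I \<le> field_degree x" using lin_dep_if_field_degree_less[OF x finI] by (auto simp: not_less[symmetric])
  moreover have "card I = (\<Sum>P\<in>F. e P)" unfolding I_def using F(1) by simp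
  ultimately have "(\<Sum>P\<in>F. int (e P)) \<le> int (field_degree x)" by (simp flip: of_nat_sum)
  also have "(\<Sum>P\<in>F. int (e P)) = (\<Sum>P\<in>F. ord_at P x)" using e by simp
  finally show ?thesis .
qed

text \<open>Each zero contributes at least 1 to the sum of multiplicities, so no finite set of zeros
  has more elements than the degree.\<close>

lemma finite_zeros:
  assumes "x \<notin> range emb"
  shows "finite {P \<in> curve emb. ord_at P x > 0}"
proof (rule ccontr)
  assume "\<not> ?thesis"
  then obtain F where F: "F \<subseteq> {P \<in> curve emb. ord_at P x > 0}" "finite F" "card F = Suc (field_degree x)"
    using infinite_arbitrarily_large by blast
  have "int (card F) = (\<Sum>P\<in>F. 1)" by simp
  also have "\<dots> \<le> (\<Sum>P\<in>F. ord_at P x)" using F(1) by (intro sum_mono) auto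
  also have "\<dots> \<le> int (field_degree x)" using F by (intro sum_zeros_le_field_degree assms) auto
  finally show False using F(3) by simp
qed

lemma nonconst_inverse:
  assumes "x \<notin> range emb"
  shows "inverse x \<notin> range emb"
proof
  assume "inverse x \<in> range emb"
  then obtain c where "inverse x = emb c" by blast
  then have "x = emb (inverse c)" by (simp add: emb_inverse flip: \<open>inverse x = emb c\<close>)
  then show False using assms by blast
qed

lemma finite_poles:
  assumes "x \<notin> range emb"
  shows "finite {P \<in> curve emb. ord_at P x < 0}"
proof -
  have "x \<noteq> 0" using assms emb_zero by (metis rangeI)
  then have "{P \<in> curve emb. ord_at P x < 0} = {P \<in> curve emb. ord_at P (inverse x) > 0}"
    using dvr.ord_inverse[OF curve_dvr[of _ emb]] by (auto simp: neg_0_less_iff_less)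
  then show ?thesis using finite_zeros[OF nonconst_inverse[OF assms]] by simp
qed

lemma finite_support: "x \<noteq> 0 \<Longrightarrow> finite {P \<in> curve emb. ord_at P x \<noteq> 0}"
proof (cases "x \<in> range emb")
  case True
  assume "x \<noteq> 0"
  then have "{P \<in> curve emb. ord_at P x \<noteq> 0} = {}" using True nonconst_if_ord_nonzero by blast
  then show ?thesis by (simp only: finite.emptyI)
next
  case False
  have "{P \<in> curve emb. ord_at P x \<noteq> 0} = {P \<in> curve emb. ord_at P x > 0} \<union> {P \<in> curve emb. ord_at P x < 0}"
    by auto
  then show ?thesis using finite_zeros[OF False] finite_poles[OF False] by simp
qed

section \<open>Riemann's count: functions with poles bounded by an effective divisor\<close>

definition sections_with_poles :: "('a set \<Rightarrow> nat) \<Rightarrow> 'a set" where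
  "sections_with_poles D = {f. \<forall>P\<in>curve emb. vge P (- int (D P)) f}"

text \<open>The estimate l(D) \<le> deg D + 1, stated by a spanning family. Each additional pole
  order costs at most one generator because the residue fields are k; without poles only the
  constants are left.\<close>

lemma sections_with_poles_bound:
  assumes "finite S" "S \<subseteq> curve emb"
  shows "\<exists>v. sections_with_poles (\<lambda>P. if P \<in> S then D P else 0)
           \<subseteq> lin_combs (range emb) {..<Suc (\<Sum>P\<in>S. D P)} (v :: nat \<Rightarrow> 'a)"
proof (induction "\<Sum>P\<in>S. D P" arbitrary: D)
  case 0
  then have D0: "D P = 0" if "P \<in> S" for P using assms(1) that by simp
  have "f \<in> lin_combs (range emb) {..<Suc (\<Sum>P\<in>S. D P)} (\<lambda>_. 1)"
    if "f \<in> sections_with_poles (\<lambda>P. if P \<in> S then D P else 0)" for f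
  proof -
    have "f \<in> P" if P: "P \<in> curve emb" for P
    proof -
      interpret dvr P using curve_dvr[OF P] .
      have "vge P (- int (if P \<in> S then D P else 0)) f"
        using P \<open>f \<in> sections_with_poles _\<close> unfolding sections_with_poles_def by blast
      then show ?thesis using D0[of P] vge_0_iff by (auto split: if_splits)
    qed
    then have "f \<in> range emb" using ex_pole by blast
    then show ?thesis
      using 0 unfolding lin_combs_def by (intro CollectI exI[of _ "\<lambda>_. f"]) simp
  qed
  then show ?case by blast
next
  case (Suc n)
  have "\<exists>P0\<in>S. D P0 \<noteq> 0"
  proof (rule ccontr)
    assume "\<not> ?thesis"
    then have "(\<Sum>P\<in>S. D P) = 0" by simp
    then show False using Suc.hyps(2) by simp
  qed
  then obtain P0 where P0: "P0 \<in> S" "D P0 > 0" by auto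
  then have P0X: "P0 \<in> curve emb" using assms(2) by blast
  interpret P0: dvr P0 using curve_dvr[OF P0X] .
  define D' where "D' = D(P0 := D P0 - 1)"
  have "(\<Sum>P\<in>S. D P) = D P0 + (\<Sum>P\<in>S - {P0}. D P)"
    using P0 assms(1) by (simp add: sum.remove)
  moreover have "(\<Sum>P\<in>S. D' P) = D' P0 + (\<Sum>P\<in>S - {P0}. D' P)"
    using P0 assms(1) by (simp add: sum.remove)
  moreover have "(\<Sum>P\<in>S - {P0}. D' P) = (\<Sum>P\<in>S - {P0}. D P)"
    by (intro sum.cong) (auto simp: D'_def)
  ultimately have sumD': "(\<Sum>P\<in>S. D' P) = n" using Suc.hyps(2) P0(2) by (simp add: D'_def)
  let ?L = "sections_with_poles (\<lambda>P. if P \<in> S then D P else 0)"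
  let ?L' = "sections_with_poles (\<lambda>P. if P \<in> S then D' P else 0)"
  obtain v where v: "?L' \<subseteq> lin_combs (range emb) {..<Suc n} v"
    using Suc.hyps(1)[of D'] sumD' by auto
  have inL': "f \<in> ?L'" if f: "f \<in> ?L" and f0: "vge P0 (1 - int (D P0)) f" for f
    unfolding sections_with_poles_def
  proof (intro CollectI ballI)
    fix P assume P: "P \<in> curve emb"
    then have "vge P (- int (if P \<in> S then D P else 0)) f"
      using f unfolding sections_with_poles_def by blast
    then show "vge P (- int (if P \<in> S then D' P else 0)) f"
      using f0 P0 by (cases "P = P0") (auto simp: D'_def of_nat_diff)
  qed
  \<comment> \<open>A function attaining the full pole order at \<open>P0\<close>, if there is one;
    otherwise 0 fills the place.\<close>
  obtain w where w: "w \<in> ?L" "?L \<subseteq> ?L' \<or> \<not> vge P0 (1 - int (D P0)) w"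
  proof (cases "?L \<subseteq> ?L'")
    case True
    then show ?thesis using that[of 0] by (auto simp: sections_with_poles_def vge_def)
  next
    case False
    then obtain w where "w \<in> ?L" "w \<notin> ?L'" by blast
    then show ?thesis using inL' that[of w] by blast
  qed
  have "f \<in> lin_combs (range emb) {..<Suc (\<Sum>P\<in>S. D P)} (v(Suc n := w))" if f: "f \<in> ?L" for f
  proof -
    have "\<exists>c. f - emb c * w \<in> ?L'"
    proof (cases "?L \<subseteq> ?L'")
      case True
      then show ?thesis using f by (intro exI[of _ 0]) (auto simp: emb_zero)
    next
      case False
      then have nw: "\<not> vge P0 (1 - int (D P0)) w" using w by blast
      have wL: "vge P0 (- int (D P0)) w" and fL: "vge P0 (- int (D P0)) f"
        using w(1) f P0 P0X unfolding sections_with_poles_def by auto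
      have w0: "w \<noteq> 0" and ow: "ord_at P0 w = - int (D P0)" using nw wL by (auto simp: vge_def)
      have "f / w \<in> P0"
        using P0.mem_iff[of "f / w"] P0.ord_divide[OF _ w0, of f] fL ow by (cases "f = 0") (auto simp: vge_def)
      \<comment> \<open>Subtracting the value of f / w at \<open>P0\<close> times w lowers the pole
        order of f there.\<close>
      then obtain c where c: "vge P0 1 (f / w - emb c)" using ex_residue[OF P0X] by blast
      have "vge P0 (1 + - int (D P0)) ((f / w - emb c) * w)" by (rule P0.vge_mult[OF c wL])
      then have *: "vge P0 (1 - int (D P0)) (f - emb c * w)" using w0 by (simp add: left_diff_distrib)
      have "f - emb c * w \<in> ?L"
        unfolding sections_with_poles_def
      proof (intro CollectI ballI)
        fix P assume P: "P \<in> curve emb"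
        interpret dvr P using curve_dvr[OF P] .
        have "emb c \<in> P" using consts_subset[OF P] by blast
        then show "vge P (- int (if P \<in> S then D P else 0)) (f - emb c * w)"
          using f w(1) P unfolding sections_with_poles_def by (intro vge_diff vge_mult_mem) auto
      qed
      then show ?thesis using inL' * by blast
    qed
    then obtain c where "f - emb c * w \<in> ?L'" by blast
    then obtain a where a: "\<forall>j\<in>{..<Suc n}. a j \<in> range emb" "f - emb c * w = (\<Sum>j<Suc n. a j * v j)"
      using v unfolding lin_combs_def by blast
    have "f = (\<Sum>j<Suc n. a j * v j) + emb c * w" using a(2) by (simp only: diff_eq_eq)
    also have "\<dots> = (\<Sum>j<Suc (Suc n). (a(Suc n := emb c)) j * (v(Suc n := w)) j)" by simp
    finally have "f = (\<Sum>j<Suc (Suc n). (a(Suc n := emb c)) j * (v(Suc n := w)) j)" .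
    moreover have "\<forall>j\<in>{..<Suc (Suc n)}. (a(Suc n := emb c)) j \<in> range emb" using a(1) by auto
    ultimately show ?thesis
      unfolding lin_combs_def Suc.hyps(2)[symmetric] by blast
  qed
  then show ?case by blast
qed

lemma ev_power: "ev x (f ^ n) = ev x f ^ n"
  by (induction n) (simp_all add: ev_1 ev_mult)

text \<open>At a pole P of u where x is regular with value c, a power of x - c cancels the pole. The
  product of these powers over the finitely many such P is a polynomial in x.\<close>

lemma clear_poles:
  assumes x: "x \<notin> range emb"
  shows "\<exists>h. h \<noteq> 0 \<and> (\<forall>P\<in>curve emb. x \<in> P \<longrightarrow> ev x h * u \<in> P)"
proof (cases "u \<in> range emb")
  case True
  then show ?thesis using consts_subset by (intro exI[of _ 1]) (auto simp: ev_1)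
next
  case False
  have u0: "u \<noteq> 0" using False emb_zero by (metis rangeI)
  define T where "T = {P \<in> curve emb. ord_at P u < 0 \<and> x \<in> P}"
  have fin: "finite T" unfolding T_def using finite_poles[OF False] by (rule rev_finite_subset) auto
  have "\<forall>P\<in>T. \<exists>c. vge P 1 (x - emb c)" using ex_residue unfolding T_def by blast
  from bchoice[OF this] obtain c where c: "\<forall>P\<in>T. vge P 1 (x - emb (c P))" by blast
  define g where "g P = [:- c P, 1:] ^ nat (- ord_at P u)" for P
  have g: "ev x (g P) = (x - emb (c P)) ^ nat (- ord_at P u)" for P
    by (simp add: g_def ev_power ev_pCons emb_uminus emb_one)
  show ?thesis
  proof (intro exI[of _ "prod g T"] conjI ballI impI)
    show "prod g T \<noteq> 0" using fin by (simp add: prod_zero_iff g_def)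
    fix P assume P: "P \<in> curve emb" "x \<in> P"
    interpret dvr P using curve_dvr[OF P(1)] .
    have int: "x - emb d \<in> P" for d using P consts_subset[OF P(1)] by (intro subring_diff[OF subring]) auto
    have gP: "ev x (g Q) \<in> P" for Q unfolding g by (intro subring_power[OF subring] int)
    show "ev x (prod g T) * u \<in> P"
    proof (cases "ord_at P u < 0")
      case False
      then have "u \<in> P" using mem_iff by auto
      then show ?thesis
        unfolding ev_prod using gP by (intro subring_mult[OF subring] subring_prod[OF subring]) auto
    next
      case True
      then have PT: "P \<in> T" using P by (simp add: T_def)
      have xc: "x - emb (c P) \<noteq> 0" using x by auto
      have "ord_at P (x - emb (c P)) \<ge> 1" using c PT xc by (auto simp: vge_def)
      then have "int (nat (- ord_at P u)) * ord_at P (x - emb (c P)) \<ge> int (nat (- ord_at P u)) * 1"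
        by (intro mult_left_mono) auto
      then have "ord_at P (ev x (g P)) \<ge> - ord_at P u"
        unfolding g using True xc by (simp add: ord_power)
      then have "ev x (g P) * u \<in> P"
        using mem_iff[of "ev x (g P) * u"] ord_mult[of "ev x (g P)" u] u0 xc by (auto simp: g)
      then have "(\<Prod>Q\<in>T - {P}. ev x (g Q)) * (ev x (g P) * u) \<in> P"
        by (rule subring_mult[OF subring subring_prod[OF subring gP]])
      also have "(\<Prod>Q\<in>T - {P}. ev x (g Q)) * (ev x (g P) * u) = ev x (prod g T) * u"
        unfolding ev_prod using fin PT by (simp add: prod.remove mult_ac)
      finally show ?thesis .
    qed
  qed
qed

text \<open>Riemann's count: if \<open>x\<close> has \<open>d\<close> poles, the functions \<open>x\<^sup>i * w j\<close> with \<open>i \<le> l\<close> lie in a space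
  of dimension at most \<open>l * d + O(1)\<close>, but \<open>(l + 1) * field_degree x\<close> of them are linearly independent.\<close>

lemma field_degree_le_sum_poles:
  assumes x: "x \<notin> range emb"
  shows "int (field_degree x) \<le> (\<Sum>P\<in>{P \<in> curve emb. ord_at P x < 0}. - ord_at P x)"
proof -
  define n where "n = field_degree x"
  define S where "S = {P \<in> curve emb. ord_at P x < 0}"
  have S: "finite S" "S \<subseteq> curve emb" unfolding S_def using finite_poles[OF x] by auto
  have x0: "x \<noteq> 0" using x emb_zero by (metis rangeI)
  define e where "e P = nat (- ord_at P x)" for P
  define d where "d = (\<Sum>P\<in>S. e P)"
  have d_eq: "int d = (\<Sum>P\<in>S. - ord_at P x)" unfolding d_def e_def S_def by simp
  obtain u :: "nat \<Rightarrow> 'a" where u: "\<not> lin_dep (range (ev x)) {..<n} u"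
    using ex_indep_card_field_degree[OF x] unfolding n_def by blast
  have "\<forall>j. \<exists>h. h \<noteq> 0 \<and> (\<forall>P\<in>curve emb. x \<in> P \<longrightarrow> ev x h * u j \<in> P)" using clear_poles[OF x] by blast
  from choice[OF this] obtain h
    where h: "\<forall>j. h j \<noteq> 0 \<and> (\<forall>P\<in>curve emb. x \<in> P \<longrightarrow> ev x (h j) * u j \<in> P)" by blast
  \<comment> \<open>A multiple of \<open>u j\<close> by a nonzero polynomial in x, whose poles all
    lie among the poles of x.\<close>
  define w where "w j = ev x (h j) * u j" for j
  have "finite ((\<lambda>(P, j). nat (- ord_at P (w j))) ` (S \<times> {..<n}))" using S by simp
  then obtain C where "\<forall>m\<in>(\<lambda>(P, j). nat (- ord_at P (w j))) ` (S \<times> {..<n}). m \<le> C"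
    unfolding finite_nat_set_iff_bounded_le by blast
  then have "nat (- ord_at P (w j)) \<le> C" if "P \<in> S" "j < n" for P j using that by auto
  then have C: "- int C \<le> ord_at P (w j)" if "P \<in> S" "j < n" for P j using that by fastforce
  \<comment> \<open>Chosen so that the dimension bound l d + C |S| + 1 equals l (d + 1), which is
    below (l + 1) n as soon as d < n.\<close>
  define l where "l = C * card S + 1"
  define D where "D P = l * e P + C" for P
  have in_sections: "x ^ i * w j \<in> sections_with_poles (\<lambda>P. if P \<in> S then D P else 0)"
    if ij: "i \<le> l" "j < n" for i j
    unfolding sections_with_poles_def
  proof (intro CollectI ballI)
    fix P assume P: "P \<in> curve emb"
    interpret dvr P using curve_dvr[OF P] .
    show "vge P (- int (if P \<in> S then D P else 0)) (x ^ i * w j)"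
    proof (cases "P \<in> S")
      case True
      then have "int (e P) = - ord_at P x" by (simp add: e_def S_def)
      then have ox: "ord_at P (x ^ i) = - (int i * int (e P))" using x0 by (simp add: ord_power)
      have "int i * int (e P) \<le> int l * int (e P)" using ij by (intro mult_right_mono) auto
      then have "vge P (- (int l * int (e P))) (x ^ i)" using ox by (simp add: vge_def)
      moreover have "vge P (- int C) (w j)" using C[OF True ij(2)] by (simp add: vge_def)
      ultimately have "vge P (- (int l * int (e P)) + - int C) (x ^ i * w j)" by (rule vge_mult)
      then show ?thesis using True by (simp add: D_def algebra_simps)
    next
      case False
      then have "x \<in> P" using P mem_iff[of x] by (auto simp: S_def)
      moreover have "w j \<in> P" using h P \<open>x \<in> P\<close> by (simp add: w_def)
      ultimately have "x ^ i * w j \<in> P" by (intro subring_mult[OF subring] subring_power[OF subring])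
      then show ?thesis using False vge_0_iff by simp
    qed
  qed
  show ?thesis
  proof (rule ccontr)
    assume "\<not> ?thesis"
    then have "d < n" using d_eq by (simp add: n_def S_def)
    obtain v :: "nat \<Rightarrow> 'a" where v: "sections_with_poles (\<lambda>P. if P \<in> S then D P else 0)
        \<subseteq> lin_combs (range emb) {..<Suc (\<Sum>P\<in>S. D P)} v"
      using sections_with_poles_bound[OF S] by blast
    have "(\<Sum>P\<in>S. D P) = l * d + C * card S"
      by (simp add: D_def d_def sum.distrib sum_distrib_left)
    then have "Suc (\<Sum>P\<in>S. D P) = l * d + l" by (simp add: l_def)
    also have "\<dots> < Suc l * (d + 1)" by simp
    also have "\<dots> \<le> Suc l * n" using \<open>d < n\<close> by (intro mult_le_mono) auto
    finally have card: "card {..<Suc (\<Sum>P\<in>S. D P)} < card ({..l} \<times> {..<n})" by simp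
    have "lin_dep (range emb) ({..l} \<times> {..<n}) (\<lambda>(i, j). x ^ i * w j)"
      by (rule lin_dep_if_card_less[OF subring_consts _ _ card]) (use in_sections v in auto)
    then obtain c where c: "\<forall>k\<in>{..l} \<times> {..<n}. c k \<in> range emb" "\<exists>k\<in>{..l} \<times> {..<n}. c k \<noteq> 0"
      "(\<Sum>k\<in>{..l} \<times> {..<n}. c k * (case k of (i, j) \<Rightarrow> x ^ i * w j)) = 0"
      unfolding lin_dep_def by blast
    define b where "b i j = inv emb (c (i, j))" for i j
    have b: "c (i, j) = emb (b i j)" if "i \<le> l" "j < n" for i j
      unfolding b_def using c(1) that by (simp add: f_inv_into_f)
    define f where "f j = (\<Sum>i\<le>l. monom (b i j) i)" for j
    have coeff_f: "coeff (f j) i = b i j" if "i \<le> l" for i j using that by (simp add: f_def coeff_sum)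
    have "0 = (\<Sum>i\<le>l. \<Sum>j<n. c (i, j) * (x ^ i * w j))"
      using c(3) by (simp add: sum.cartesian_product case_prod_unfold)
    also have "\<dots> = (\<Sum>j<n. \<Sum>i\<le>l. c (i, j) * (x ^ i * w j))" by (rule sum.swap)
    also have "\<dots> = (\<Sum>j<n. ev x (f j) * w j)"
    proof (intro sum.cong refl)
      fix j assume "j \<in> {..<n}"
      then show "(\<Sum>i\<le>l. c (i, j) * (x ^ i * w j)) = ev x (f j) * w j"
        by (simp add: b f_def ev_sum ev_monom sum_distrib_right mult.assoc)
    qed
    \<comment> \<open>Collecting the constants belonging to j into a polynomial turns the relation
      over k into one over k[x] among the original \<open>u j\<close>.\<close>
    also have "\<dots> = (\<Sum>j<n. ev x (f j * h j) * u j)" by (simp add: w_def ev_mult mult.assoc)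
    finally have "(\<Sum>j<n. ev x (f j * h j) * u j) = 0" by simp
    moreover have "\<exists>j<n. ev x (f j * h j) \<noteq> 0"
    proof -
      obtain i j where ij: "i \<le> l" "j < n" "c (i, j) \<noteq> 0" using c(2) by auto
      then have "coeff (f j) i \<noteq> 0" using b coeff_f emb_zero by auto
      then have "f j * h j \<noteq> 0" using h by auto
      then show ?thesis using ev_nonzero[OF x] ij(2) by blast
    qed
    ultimately have "lin_dep (range (ev x)) {..<n} u"
      unfolding lin_dep_def by (intro exI[of _ "\<lambda>j. ev x (f j * h j)"]) auto
    then show False using u by blast
  qed
qed

text \<open>The two estimates give zeros \<le> degree \<le> poles, counted with multiplicity.
  Applied to 1 / x, where zeros and poles change places, they give the reverse inequality.\<close>

theorem degree_principal:
  assumes "x \<noteq> 0"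
  shows "(\<Sum>P\<in>{P \<in> curve emb. ord_at P x \<noteq> 0}. ord_at P x) = 0"
proof (cases "x \<in> range emb")
  case True
  then have "{P \<in> curve emb. ord_at P x \<noteq> 0} = {}" using nonconst_if_ord_nonzero assms by blast
  then show ?thesis by (simp only: sum.empty)
next
  case False
  define Z where "Z = {P \<in> curve emb. ord_at P x > 0}"
  define S where "S = {P \<in> curve emb. ord_at P x < 0}"
  have fin: "finite Z" "finite S" unfolding Z_def S_def using finite_zeros finite_poles False by auto
  note nc = nonconst_inverse[OF False]
  have oi: "ord_at P (inverse x) = - ord_at P x" if "P \<in> curve emb" for P
    using dvr.ord_inverse[OF curve_dvr[OF that] assms] .
  have Z': "{P \<in> curve emb. ord_at P (inverse x) < 0} = Z" unfolding Z_def using oi by auto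
  have "(\<Sum>P\<in>Z. ord_at P x) \<le> int (field_degree x)"
    using fin by (intro sum_zeros_le_field_degree False) (auto simp: Z_def)
  also have "\<dots> \<le> (\<Sum>P\<in>S. - ord_at P x)" unfolding S_def by (rule field_degree_le_sum_poles[OF False])
  finally have 1: "(\<Sum>P\<in>Z. ord_at P x) \<le> (\<Sum>P\<in>S. - ord_at P x)" .
  have "(\<Sum>P\<in>S. - ord_at P x) = (\<Sum>P\<in>S. ord_at P (inverse x))"
    by (intro sum.cong) (auto simp: S_def oi)
  also have "\<dots> \<le> int (field_degree (inverse x))"
    using fin oi by (intro sum_zeros_le_field_degree nc) (auto simp: S_def)
  also have "\<dots> \<le> (\<Sum>P\<in>Z. - ord_at P (inverse x))"
    using field_degree_le_sum_poles[OF nc] unfolding Z' .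
  also have "\<dots> = (\<Sum>P\<in>Z. ord_at P x)"
    by (intro sum.cong) (auto simp: Z_def oi)
  finally have 2: "(\<Sum>P\<in>S. - ord_at P x) \<le> (\<Sum>P\<in>Z. ord_at P x)" .
  have "{P \<in> curve emb. ord_at P x \<noteq> 0} = Z \<union> S" unfolding Z_def S_def by auto
  then have "(\<Sum>P\<in>{P \<in> curve emb. ord_at P x \<noteq> 0}. ord_at P x) = (\<Sum>P\<in>Z. ord_at P x) + (\<Sum>P\<in>S. ord_at P x)"
    using fin by (simp only:) (intro sum.union_disjoint, auto simp: Z_def S_def)
  then show ?thesis using 1 2 by (simp add: sum_negf)
qed

end

section \<open>Stalks\<close>

lemma submodule_zero: "submodule R M \<Longrightarrow> 0 \<in> M"
  unfolding submodule_def by blast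

lemma submodule_add: "submodule R M \<Longrightarrow> v \<in> M \<Longrightarrow> w \<in> M \<Longrightarrow> v + w \<in> M"
  unfolding submodule_def by blast

lemma submodule_scale: "submodule R M \<Longrightarrow> a \<in> R \<Longrightarrow> v \<in> M \<Longrightarrow> a *s v \<in> M"
  unfolding submodule_def by blast

lemma submodule_diff:
  assumes "is_subring R" "submodule R M" "v \<in> M" "w \<in> M"
  shows "v - w \<in> M"
proof -
  have "(- 1) *s w \<in> M"
    using assms by (intro submodule_scale[OF assms(2)] subring_uminus subring_one)
  then have "v + (- 1) *s w \<in> M" by (rule submodule_add[OF assms(2,3)])
  then show ?thesis by (simp add: vector_sneg_minus1 [symmetric])
qed

lemma submodule_sum:
  "submodule R M \<Longrightarrow> (\<And>i. i \<in> I \<Longrightarrow> f i \<in> M) \<Longrightarrow> sum f I \<in> M"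
  by (induction I rule: infinite_finite_induct) (auto intro: submodule_zero submodule_add)

lemma mat_mult_vector: "mat c *v v = c *s (v :: 'a::field ^ 'n)"
  by (simp add: vec_eq_iff matrix_vector_mult_def mat_def if_distrib[of "\<lambda>x. x * _"] sum.delta' cong: if_cong)

lemma mult_matrix_1: "A *v w = w $ 1 *s column 1 (A :: 'a::field ^ 1 ^ 'm)"
  by (simp add: vec_eq_iff matrix_vector_mult_def column_def sum_1 mult.commute)

text \<open>The P-lattice spanned by the columns of M; this is the shape of the stalks of a vector
  bundle.\<close>

definition free_stalk :: "'a::field set \<Rightarrow> 'a ^ 'n ^ 'n \<Rightarrow> ('a ^ 'n) set" where
  "free_stalk P M = (\<lambda>v. M *v v) ` {v. \<forall>i. v $ i \<in> P}"

definition principal_stalk :: "'a::field set \<Rightarrow> 'a \<Rightarrow> ('a ^ 1) set" where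
  "principal_stalk P g = {v. \<exists>a\<in>P. v $ 1 = a * g}"

definition columns2 :: "'a::field ^ 2 \<Rightarrow> 'a ^ 2 \<Rightarrow> 'a ^ 2 ^ 2" where
  "columns2 x y = (\<chi> i j. if j = 1 then x $ i else y $ i)"

lemma columns2_mult: "columns2 x y *v v = v $ 1 *s x + v $ 2 *s y"
  by (simp add: vec_eq_iff matrix_vector_mult_def columns2_def sum_2 mult.commute)

lemma det_columns2: "det (columns2 x y) = x $ 1 * y $ 2 - y $ 1 * x $ 2"
  by (simp add: det_2 columns2_def)

lemma free_stalk_columns2:
  "v \<in> free_stalk P (columns2 x y) \<longleftrightarrow> (\<exists>a\<in>P. \<exists>b\<in>P. v = a *s x + b *s y)"
proof
  assume "v \<in> free_stalk P (columns2 x y)"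
  then show "\<exists>a\<in>P. \<exists>b\<in>P. v = a *s x + b *s y"
    unfolding free_stalk_def by (auto simp: columns2_mult)
next
  assume "\<exists>a\<in>P. \<exists>b\<in>P. v = a *s x + b *s y"
  then obtain a b where ab: "a \<in> P" "b \<in> P" "v = a *s x + b *s y" by blast
  have "columns2 x y *v vector [a, b] = v" by (simp add: columns2_mult ab)
  moreover have "\<forall>i. (vector [a, b] :: 'a ^ 2) $ i \<in> P" using ab by (simp add: forall_2)
  ultimately show "v \<in> free_stalk P (columns2 x y)" unfolding free_stalk_def by blast
qed

lemma free_stalk_1: "free_stalk P (M :: 'a::field ^ 1 ^ 1) = principal_stalk P (M $ 1 $ 1)"
proof (intro set_eqI iffI)
  fix v assume "v \<in> free_stalk P M"
  then show "v \<in> principal_stalk P (M $ 1 $ 1)"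
    unfolding free_stalk_def principal_stalk_def by (auto simp: mult_matrix_1 column_def)
next
  fix v assume "v \<in> principal_stalk P (M $ 1 $ 1)"
  then obtain a where "a \<in> P" "v $ 1 = a * M $ 1 $ 1" unfolding principal_stalk_def by blast
  then have "v = M *v (\<chi> i. a)" "\<forall>i. (\<chi> i. a :: 'a ^ 1) $ i \<in> P"
    by (auto simp: vec_eq_iff forall_1 mult_matrix_1 column_def)
  then show "v \<in> free_stalk P M" unfolding free_stalk_def by blast
qed

lemma submodule_free_stalk:
  assumes "is_subring P"
  shows "submodule P (free_stalk P M)"
  unfolding submodule_def
proof (intro conjI ballI)
  have "0 = M *v 0" by simp
  then show "0 \<in> free_stalk P M"
    unfolding free_stalk_def using subring_zero[OF assms] by (intro image_eqI[of _ _ 0]) auto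
  fix v w assume "v \<in> free_stalk P M" "w \<in> free_stalk P M"
  then obtain x y where "v = M *v x" "w = M *v y" "\<forall>i. x $ i \<in> P" "\<forall>i. y $ i \<in> P"
    unfolding free_stalk_def by blast
  then show "v + w \<in> free_stalk P M"
    unfolding free_stalk_def
    by (intro image_eqI[of _ _ "x + y"]) (auto simp: matrix_vector_right_distrib intro: subring_add[OF assms])
next
  fix a v assume "a \<in> P" "v \<in> free_stalk P M"
  then obtain x where "v = M *v x" "\<forall>i. x $ i \<in> P"
    unfolding free_stalk_def by blast
  then show "a *s v \<in> free_stalk P M"
    unfolding free_stalk_def using \<open>a \<in> P\<close>
    by (intro image_eqI[of _ _ "a *s x"]) (auto simp: vector_scalar_commute intro: subring_mult[OF assms])
qed

lemma column_in_free_stalk: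
  assumes "is_subring P"
  shows "column i M \<in> free_stalk P M"
proof -
  have "M *v axis i 1 = column i M"     by (simp add: vec_eq_iff matrix_vector_mult_def column_def axis_def if_distrib[of "\<lambda>x. _ * x"] cong: if_cong)
  moreover have "\<forall>j. axis i 1 $ j \<in> P"
    using subring_zero[OF assms] subring_one[OF assms] by (simp add: axis_def)
  ultimately show ?thesis
    unfolding free_stalk_def by (intro image_eqI[of _ _ "axis i 1"]) simp_all
qed

lemma free_stalk_subset_submodule:
  assumes "submodule P S" "\<And>i. column i M \<in> S"
  shows "free_stalk P M \<subseteq> S"
proof
  fix v assume "v \<in> free_stalk P M"
  then obtain x where x: "v = M *v x" "\<forall>i. x $ i \<in> P" unfolding free_stalk_def by blast
  have "v = (\<Sum>i\<in>UNIV. x $ i *s column i M)" unfolding x(1) by (rule matrix_mult_sum)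
  also have "\<dots> \<in> S" using assms x(2) by (intro submodule_sum[OF assms(1)] submodule_scale[OF assms(1)]) auto
  finally show "v \<in> S" .
qed

section \<open>Stalks of tensor products, Frobenius pull-backs and determinants\<close>

lemma free_stalk_mat: "free_stalk P (mat c ** M) = (\<lambda>v. c *s v) ` free_stalk P M"
  unfolding free_stalk_def by (simp add: image_image matrix_vector_mul_assoc[symmetric] mat_mult_vector)

text \<open>Once L has a generator l at P, the scaled stalk is already a submodule, and the hull
  adds nothing.\<close>

lemma twist_stalk:
  assumes "is_subring P" "submodule P (V P)" "L P = principal_stalk P l"
  shows "twist V L P = (\<lambda>v. l *s v) ` V P"
  unfolding twist_def
proof (rule hull_unique)
  show "{k $ 1 *s v | k v. k \<in> L P \<and> v \<in> V P} \<subseteq> (\<lambda>v. l *s v) ` V P"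
  proof clarify
    fix k v assume "k \<in> L P" "v \<in> V P"
    then obtain a where a: "a \<in> P" "k $ 1 = a * l" using assms(3) unfolding principal_stalk_def by blast
    then have "k $ 1 *s v = l *s (a *s v)" by (simp add: mult.commute)
    then show "k $ 1 *s v \<in> (\<lambda>v. l *s v) ` V P"
      using submodule_scale[OF assms(2) a(1) \<open>v \<in> V P\<close>] by blast
  qed
  show "submodule P ((\<lambda>v. l *s v) ` V P)"
    unfolding submodule_def
  proof (intro conjI ballI)
    show "0 \<in> (\<lambda>v. l *s v) ` V P" using submodule_zero[OF assms(2)] by (intro image_eqI[of _ _ 0]) auto
    fix v w assume "v \<in> (\<lambda>v. l *s v) ` V P" "w \<in> (\<lambda>v. l *s v) ` V P"
    then obtain x y where "v = l *s x" "w = l *s y" "x \<in> V P" "y \<in> V P" by blast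
    then show "v + w \<in> (\<lambda>v. l *s v) ` V P"
      using submodule_add[OF assms(2)] by (intro image_eqI[of _ _ "x + y"]) (auto simp: vector_add_ldistrib)
  next
    fix a v assume "a \<in> P" "v \<in> (\<lambda>v. l *s v) ` V P"
    then obtain x where "v = l *s x" "x \<in> V P" by blast
    then show "a *s v \<in> (\<lambda>v. l *s v) ` V P"
      using submodule_scale[OF assms(2) \<open>a \<in> P\<close>] by (intro image_eqI[of _ _ "a *s x"]) (auto simp: mult.commute)
  qed
  fix T assume T: "{k $ 1 *s v | k v. k \<in> L P \<and> v \<in> V P} \<subseteq> T"
  have "(\<chi> i. l) \<in> L P"
    unfolding assms(3) principal_stalk_def using subring_one[OF assms(1)] by (auto intro!: bexI[of _ 1])
  then show "(\<lambda>v. l *s v) ` V P \<subseteq> T" using T by fastforce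
qed

lemma sum_frobenius_power:
  fixes f :: "'n \<Rightarrow> 'a::field"
  assumes "\<And>x y :: 'a. (x + y) ^ p = x ^ p + y ^ p" "p > 0"
  shows "(\<Sum>i\<in>I. f i) ^ p = (\<Sum>i\<in>I. f i ^ p)"
  using assms by (induction I rule: infinite_finite_induct) auto

text \<open>Additivity of the p-th power turns the entrywise power of M x into the entrywise power
  of M applied to that of x. The columns of M supply the generators.\<close>

lemma frobenius_pullback_stalk:
  assumes "is_subring P" "E P = free_stalk P M" "\<And>x y :: 'a::field. (x + y) ^ p = x ^ p + y ^ p"
    and "p > 0"
  shows "frobenius_pullback p E P = free_stalk P (frobenius_pullback_map p (M :: 'a ^ 'n ^ 'n))"
  unfolding frobenius_pullback_def
proof (rule hull_unique)
  note sum = sum_frobenius_power[OF assms(3,4)]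
  show "(\<lambda>v. \<chi> i. v $ i ^ p) ` E P \<subseteq> free_stalk P (frobenius_pullback_map p M)"
  proof clarify
    fix v assume "v \<in> E P"
    then obtain x where x: "v = M *v x" "\<forall>i. x $ i \<in> P" unfolding assms(2) free_stalk_def by blast
    have "(\<chi> i. v $ i ^ p) = frobenius_pullback_map p M *v (\<chi> i. x $ i ^ p)"
      unfolding x(1) frobenius_pullback_map_def
      by (simp add: vec_eq_iff matrix_vector_mult_def sum power_mult_distrib)
    then show "(\<chi> i. v $ i ^ p) \<in> free_stalk P (frobenius_pullback_map p M)"
      unfolding free_stalk_def using x(2)
      by (intro image_eqI[of _ _ "\<chi> i. x $ i ^ p"]) (auto intro: subring_power[OF assms(1)])
  qed
  show "submodule P (free_stalk P (frobenius_pullback_map p M))" by (rule submodule_free_stalk[OF assms(1)])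
  fix T assume T: "(\<lambda>v. \<chi> i. v $ i ^ p) ` E P \<subseteq> T" "submodule P T"
  show "free_stalk P (frobenius_pullback_map p M) \<subseteq> T"
  proof (rule free_stalk_subset_submodule[OF T(2)])
    fix i
    have "column i (frobenius_pullback_map p M) = (\<chi> j. column i M $ j ^ p)"
      by (simp add: column_def frobenius_pullback_map_def)
    then show "column i (frobenius_pullback_map p M) \<in> T"
      using T(1) column_in_free_stalk[OF assms(1), of i M] assms(2) by auto
  qed
qed

lemma det_mem_subring:
  assumes "is_subring P" "\<And>i j. A $ i $ j \<in> P"
  shows "det A \<in> P"
proof -
  have "of_int (sign \<sigma>) \<in> P" for \<sigma> :: "'b \<Rightarrow> 'b"
    using subring_one[OF assms(1)] subring_uminus[OF assms(1)] by (simp add: sign_def)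
  then show ?thesis
    unfolding det_def
    by (intro subring_sum[OF assms(1)] subring_mult[OF assms(1)] subring_prod[OF assms(1)] assms(2))
qed

lemma submodule_principal:
  fixes g :: "'a::field"
  shows "is_subring P \<Longrightarrow> submodule P (principal_stalk P g)"
  using submodule_free_stalk[of P "\<chi> i j. g :: 'a ^ 1 ^ 1"] by (simp add: free_stalk_1)

text \<open>A matrix with rows in the stalk is an integral matrix times the transpose of M, so its
  determinant is an integral multiple of that of M. The transpose itself attains this
  generator.\<close>

lemma det_bundle_stalk:
  fixes M :: "'a::field ^ 'n ^ 'n"
  assumes "is_subring P" "E P = free_stalk P M"
  shows "det_bundle E P = principal_stalk P (det M)"
  unfolding det_bundle_def
proof (rule hull_unique)
  show "{(\<chi> i. det A) |A. \<forall>i. row i A \<in> E P} \<subseteq> principal_stalk P (det M)"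
  proof clarify
    fix A :: "'a ^ 'n ^ 'n" assume "\<forall>i. row i A \<in> E P"
    then have "\<forall>i. \<exists>x. row i A = M *v x \<and> (\<forall>j. x $ j \<in> P)"
      unfolding assms(2) free_stalk_def by blast
    from choice[OF this] obtain x where x: "\<forall>i. row i A = M *v x i \<and> (\<forall>j. x i $ j \<in> P)" by blast
    have "A = (\<chi> i. x i) ** transpose M"
      using x by (simp add: vec_eq_iff row_def matrix_matrix_mult_def matrix_vector_mult_def transpose_def mult.commute)
    then have "det A = det (\<chi> i. x i) * det M" by (simp add: det_mul)
    moreover have "det (\<chi> i. x i) \<in> P" using x by (intro det_mem_subring[OF assms(1)]) simp
    ultimately show "(\<chi> i. det A) \<in> principal_stalk P (det M)" unfolding principal_stalk_def by auto
  qed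
  show "submodule P (principal_stalk P (det M))" by (rule submodule_principal[OF assms(1)])
  fix T :: "('a ^ 1) set" assume T: "{(\<chi> i. det A) |A. \<forall>i. row i A \<in> E P} \<subseteq> T" "submodule P T"
  have "\<forall>i. row i (transpose M) \<in> E P"
    unfolding assms(2) row_transpose using column_in_free_stalk[OF assms(1)] by blast
  then have "(\<chi> i. det (transpose M)) \<in> T" using T(1) by blast
  then have g: "(\<chi> i. det M) \<in> T" by simp
  show "principal_stalk P (det M) \<subseteq> T"
  proof
    fix v assume "v \<in> principal_stalk P (det M)"
    then obtain a where "a \<in> P" "v $ 1 = a * det M" unfolding principal_stalk_def by blast
    then have "v = a *s (\<chi> i. det M)" by (simp add: vec_eq_iff forall_1)
    then show "v \<in> T" using submodule_scale[OF T(2) \<open>a \<in> P\<close> g] by simp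
  qed
qed

section \<open>Local triviality of twists and pull-backs\<close>

lemma vector_bundle_iff:
  "vector_bundle X E \<longleftrightarrow> (\<forall>P\<in>X. \<exists>U M. U \<subseteq> X \<and> finite (X - U) \<and> P \<in> U \<and> invertible M \<and>
     (\<forall>Q\<in>U. E Q = free_stalk Q M))"
  unfolding vector_bundle_def free_stalk_def zariski_open_def
  by (intro ball_cong refl iff_exI) blast

lemma vector_bundle_stalk:
  assumes "vector_bundle X E" "P \<in> X"
  obtains M where "invertible M" "E P = free_stalk P M"
  using assms unfolding vector_bundle_iff by blast

lemma invertible_mat: "c \<noteq> 0 \<Longrightarrow> invertible (mat c :: 'a::field ^ 'n ^ 'n)"
  unfolding invertible_def
  by (intro exI[of _ "mat (inverse c)"])
     (simp add: matrix_eq matrix_vector_mul_assoc[symmetric] mat_mult_vector)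

lemma invertible_1: "invertible (M :: 'a::field ^ 1 ^ 1) \<longleftrightarrow> M $ 1 $ 1 \<noteq> 0"
  by (simp add: invertible_det_nz det_1)

lemma vector_bundle_twist:
  fixes V :: "('a::field, 'n::finite) subsheaf"
  assumes "vector_bundle X V" "line_bundle X L" "\<And>P. P \<in> X \<Longrightarrow> is_subring P"
  shows "vector_bundle X (twist V L)"
  unfolding vector_bundle_iff
proof
  fix P assume P: "P \<in> X"
  obtain U M where U: "U \<subseteq> X" "finite (X - U)" "P \<in> U" "invertible M" "\<forall>Q\<in>U. V Q = free_stalk Q M"
    using assms(1) P unfolding vector_bundle_iff by blast
  obtain U' K where U': "U' \<subseteq> X" "finite (X - U')" "P \<in> U'" "invertible K" "\<forall>Q\<in>U'. L Q = free_stalk Q K"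
    using assms(2) P unfolding vector_bundle_iff by blast
  have "twist V L Q = free_stalk Q (mat (K $ 1 $ 1) ** M)" if Q: "Q \<in> U \<inter> U'" for Q
  proof -
    have sub: "is_subring Q" using assms(3) Q U(1) by blast
    show ?thesis
      unfolding free_stalk_mat using Q U(5) U'(5) submodule_free_stalk[OF sub]
      by (subst twist_stalk[OF sub]) (auto simp: free_stalk_1)
  qed
  moreover have "invertible (mat (K $ 1 $ 1) ** M)"
    using U(4) U'(4) by (intro invertible_mult invertible_mat) (auto simp: invertible_1)
  moreover have "finite (X - (U \<inter> U'))" using U(2) U'(2) by (simp add: Diff_Int)
  ultimately show "\<exists>U M. U \<subseteq> X \<and> finite (X - U) \<and> P \<in> U \<and> invertible M \<and> (\<forall>Q\<in>U. twist V L Q = free_stalk Q M)"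
    using U U' by (intro exI[of _ "U \<inter> U'"] exI[of _ "mat (K $ 1 $ 1) ** M"]) auto
qed

lemma frobenius_pullback_map_mult:
  fixes A :: "'a::field ^ 'm ^ 'l" and B :: "'a ^ 'n ^ 'm"
  assumes "\<And>x y :: 'a::field. (x + y) ^ p = x ^ p + y ^ p" "p > 0"
  shows "frobenius_pullback_map p (A ** B) = frobenius_pullback_map p A ** frobenius_pullback_map p B"
  by (simp add: frobenius_pullback_map_def matrix_matrix_mult_def sum_frobenius_power[OF assms]
      power_mult_distrib)

lemma invertible_frobenius_pullback_map:
  fixes M :: "'a::field ^ 'n ^ 'n"
  assumes "\<And>x y :: 'a::field. (x + y) ^ p = x ^ p + y ^ p" "p > 0" "invertible M"
  shows "invertible (frobenius_pullback_map p M)"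
proof -
  obtain K where K: "M ** K = mat 1" "K ** M = mat 1" using assms(3) unfolding invertible_def by blast
  have one: "frobenius_pullback_map p (mat 1 :: 'a ^ 'n ^ 'n) = mat 1"
    using assms(2) by (simp add: frobenius_pullback_map_def mat_def vec_eq_iff)
  show ?thesis
    unfolding invertible_def
    using K one frobenius_pullback_map_mult[OF assms(1,2), of M K] frobenius_pullback_map_mult[OF assms(1,2), of K M]
    by metis
qed

lemma vector_bundle_frobenius_pullback:
  assumes "vector_bundle X E" "\<And>P. P \<in> X \<Longrightarrow> is_subring P"
    and "\<And>x y :: 'a::field. (x + y) ^ p = x ^ p + y ^ p" "p > 0"
  shows "vector_bundle X (frobenius_pullback p (E :: ('a, 'n::finite) subsheaf))"
  unfolding vector_bundle_iff
proof
  fix P assume P: "P \<in> X"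
  obtain U M where U: "U \<subseteq> X" "finite (X - U)" "P \<in> U" "invertible M" "\<forall>Q\<in>U. E Q = free_stalk Q M"
    using assms(1) P unfolding vector_bundle_iff by blast
  have "frobenius_pullback p E Q = free_stalk Q (frobenius_pullback_map p M)" if "Q \<in> U" for Q
    using that U assms by (intro frobenius_pullback_stalk) auto
  then show "\<exists>U M. U \<subseteq> X \<and> finite (X - U) \<and> P \<in> U \<and> invertible M \<and>
      (\<forall>Q\<in>U. frobenius_pullback p E Q = free_stalk Q M)"
    using U invertible_frobenius_pullback_map[OF assms(3,4) U(4)]
    by (intro exI[of _ U] exI[of _ "frobenius_pullback_map p M"]) auto
qed

section \<open>Degrees\<close>

lemma principal_image: "(\<lambda>a. a *s (g :: 'a::field ^ 1)) ` P = principal_stalk P (g $ 1)"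
  unfolding principal_stalk_def by (auto simp: vec_eq_iff forall_1 image_iff)

context dvr
begin

lemma principal_eq_vge:
  assumes "g \<noteq> 0"
  shows "principal_stalk P g = {v. vge P (ord_at P g) (v $ 1)}"
proof (intro set_eqI iffI)
  fix v assume "v \<in> principal_stalk P g"
  then obtain a where "a \<in> P" "v $ 1 = a * g" unfolding principal_stalk_def by blast
  then show "v \<in> {v. vge P (ord_at P g) (v $ 1)}" using vge_mult_mem vge_ord by simp
next
  fix v :: "'a ^ 1" assume v: "v \<in> {v. vge P (ord_at P g) (v $ 1)}"
  then have "v $ 1 / g \<in> P"
    using assms mem_iff[of "v $ 1 / g"] ord_divide[of "v $ 1" g] by (cases "v $ 1 = 0") (auto simp: vge_def)
  then show "v \<in> principal_stalk P g"
    unfolding principal_stalk_def using assms by (intro CollectI bexI[of _ "v $ 1 / g"]) auto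
qed

lemma principal_eq_iff:
  assumes "g \<noteq> 0" "h \<noteq> 0"
  shows "principal_stalk P g = principal_stalk P h \<longleftrightarrow> ord_at P g = ord_at P h"
proof
  assume eq: "principal_stalk P g = principal_stalk P h"
  have "(\<chi> i. g) \<in> principal_stalk P g" "(\<chi> i. h) \<in> principal_stalk P h"
    using assms by (auto simp: principal_eq_vge vge_ord)
  then have "(\<chi> i. g) \<in> principal_stalk P h" "(\<chi> i. h) \<in> principal_stalk P g" using eq by auto
  then show "ord_at P g = ord_at P h" using assms by (simp add: principal_eq_vge vge_def)
qed (use assms in \<open>simp add: principal_eq_vge\<close>)

text \<open>Two generators of the same stalk have the same order, so the description defining
  \<open>multiplicity_at\<close> has a unique solution.\<close>

lemma multiplicity_principal:
  assumes "L P = principal_stalk P g" "g \<noteq> 0"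
  shows "multiplicity_at L P = - ord_at P g"
  unfolding multiplicity_at_def
proof (rule the_equality)
  show "\<exists>h. h \<noteq> 0 \<and> L P = (\<lambda>a. a *s h) ` P \<and> - ord_at P g = - ord_at P (h $ 1)"
    unfolding principal_image
    by (rule exI[of _ "\<chi> i. g"]) (use assms in \<open>auto simp: vec_eq_iff\<close>)
next
  fix n assume "\<exists>h. h \<noteq> 0 \<and> L P = (\<lambda>a. a *s h) ` P \<and> n = - ord_at P (h $ 1)"
  then obtain h :: "'a ^ 1" where h: "h \<noteq> 0" "L P = principal_stalk P (h $ 1)" "n = - ord_at P (h $ 1)"
    unfolding principal_image by blast
  have "h $ 1 \<noteq> 0" using h(1) by (simp add: vec_eq_iff forall_1)
  then show "n = - ord_at P g" using principal_eq_iff[of g "h $ 1"] assms h by simp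
qed

end

context fun_field
begin

abbreviation X :: "'a set set" where "X \<equiv> curve emb"

text \<open>A family of local generators of a line bundle, one for each point.\<close>

definition idele :: "('a set \<Rightarrow> 'a) \<Rightarrow> bool" where
  "idele g \<longleftrightarrow> (\<forall>P\<in>X. g P \<noteq> 0) \<and> finite {P \<in> X. ord_at P (g P) \<noteq> 0}"

text \<open>The sign reflects that a stalk generated by g contains functions with poles up to the
  order of 1 / g.\<close>

definition idele_degree :: "('a set \<Rightarrow> 'a) \<Rightarrow> int" where
  "idele_degree g = - (\<Sum>P\<in>{P \<in> X. ord_at P (g P) \<noteq> 0}. ord_at P (g P))"

definition generated_by :: "('a, 1) subsheaf \<Rightarrow> ('a set \<Rightarrow> 'a) \<Rightarrow> bool" where
  "generated_by L g \<longleftrightarrow> idele g \<and> (\<forall>P\<in>X. L P = principal_stalk P (g P))"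

lemma X_dvr: "P \<in> X \<Longrightarrow> dvr P"
  by (rule curve_dvr)

lemma X_subring: "P \<in> X \<Longrightarrow> is_subring P"
  using dvr.subring[OF X_dvr] .

text \<open>The transcendental generator of the function field is nonconstant and so has a pole. A
  point is needed wherever a statement about generic fibres is read off a single stalk.\<close>

lemma X_nonempty: "X \<noteq> {}"
proof -
  obtain x where x: "transcendental_over emb x" using function_field unfolding function_field_def by blast
  have "x \<notin> range emb"
  proof
    assume "x \<in> range emb"
    then obtain c where "x = emb c" by blast
    then have "ev x [:- c, 1:] = 0" by (simp add: ev_pCons emb_uminus emb_one)
    then show False using x unfolding transcendental_over_def ev_def by fastforce
  qed
  then show ?thesis using ex_pole by blast
qed

lemma idele_nz: "idele g \<Longrightarrow> P \<in> X \<Longrightarrow> g P \<noteq> 0"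
  unfolding idele_def by blast

lemma idele_mult: "idele g \<Longrightarrow> idele h \<Longrightarrow> idele (\<lambda>P. g P * h P)"
  and idele_degree_mult: "idele g \<Longrightarrow> idele h \<Longrightarrow> idele_degree (\<lambda>P. g P * h P) = idele_degree g + idele_degree h"
proof -
  assume g: "idele g" and h: "idele h"
  define S where "S = {P \<in> X. ord_at P (g P) \<noteq> 0} \<union> {P \<in> X. ord_at P (h P) \<noteq> 0}"
  have fin: "finite S" using g h unfolding S_def idele_def by blast
  have ord: "ord_at P (g P * h P) = ord_at P (g P) + ord_at P (h P)" if "P \<in> X" for P
    using dvr.ord_mult[OF X_dvr[OF that]] idele_nz g h that by blast
  have sub: "{P \<in> X. ord_at P (g P * h P) \<noteq> 0} \<subseteq> S" unfolding S_def using ord by auto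
  then show "idele (\<lambda>P. g P * h P)"
    unfolding idele_def using idele_nz g h finite_subset[OF sub fin] by auto
  have deg: "(\<Sum>P\<in>{P \<in> X. ord_at P (f P) \<noteq> 0}. ord_at P (f P)) = (\<Sum>P\<in>S. ord_at P (f P))"
    if "{P \<in> X. ord_at P (f P) \<noteq> 0} \<subseteq> S" for f
    using that fin by (intro sum.mono_neutral_left) (auto simp: S_def)
  have "(\<Sum>P\<in>S. ord_at P (g P * h P)) = (\<Sum>P\<in>S. ord_at P (g P)) + (\<Sum>P\<in>S. ord_at P (h P))"
    unfolding sum.distrib[symmetric] by (intro sum.cong) (auto simp: S_def ord)
  then show "idele_degree (\<lambda>P. g P * h P) = idele_degree g + idele_degree h"
    unfolding idele_degree_def using deg[of "\<lambda>P. g P * h P"] deg[of g] deg[of h] sub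
    by (simp add: S_def)
qed

lemma idele_const: "c \<noteq> 0 \<Longrightarrow> idele (\<lambda>P. c)"
  unfolding idele_def using finite_support by simp

lemma idele_degree_const: "c \<noteq> 0 \<Longrightarrow> idele_degree (\<lambda>P. c) = 0"
  unfolding idele_degree_def using degree_principal by simp

lemma idele_power: "idele g \<Longrightarrow> idele (\<lambda>P. g P ^ n)"
  and idele_degree_power: "idele g \<Longrightarrow> idele_degree (\<lambda>P. g P ^ n) = int n * idele_degree g"
proof (induction n)
  case (Suc n)
  {
    case 1
    then show ?case using Suc idele_mult by simp
  next
    case 2
    then show ?case using Suc idele_degree_mult[of g "\<lambda>P. g P ^ n"] by (simp add: algebra_simps)
  }
qed (use idele_const[of 1] idele_degree_const[of 1] in auto)

lemma idele_inverse: "idele g \<Longrightarrow> idele (\<lambda>P. inverse (g P))"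
  and idele_degree_inverse: "idele g \<Longrightarrow> idele_degree (\<lambda>P. inverse (g P)) = - idele_degree g"
proof -
  assume g: "idele g"
  have ord: "ord_at P (inverse (g P)) = - ord_at P (g P)" if "P \<in> X" for P
    using dvr.ord_inverse[OF X_dvr[OF that]] idele_nz g that by blast
  have "{P \<in> X. ord_at P (inverse (g P)) \<noteq> 0} = {P \<in> X. ord_at P (g P) \<noteq> 0}" using ord by auto
  then show *: "idele (\<lambda>P. inverse (g P))" using g unfolding idele_def by simp
  have "idele_degree (\<lambda>P. g P * inverse (g P)) = idele_degree (\<lambda>P. 1)"
    unfolding idele_degree_def using idele_nz[OF g] by (intro arg_cong[where f = uminus] sum.cong) auto
  then show "idele_degree (\<lambda>P. inverse (g P)) = - idele_degree g"
    using idele_degree_mult[OF g *] idele_degree_const[of 1] by simp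
qed

lemma idele_divide: "idele g \<Longrightarrow> idele h \<Longrightarrow> idele (\<lambda>P. g P / h P)"
  unfolding divide_inverse using idele_mult idele_inverse by blast

lemma idele_degree_divide:
  "idele g \<Longrightarrow> idele h \<Longrightarrow> idele_degree (\<lambda>P. g P / h P) = idele_degree g - idele_degree h"
  unfolding divide_inverse
  using idele_degree_mult[of g "\<lambda>P. inverse (h P)"] idele_degree_inverse idele_inverse by simp

text \<open>The numerical form of the fact that a nonzero map of line bundles cannot lower the
  degree: g is the map expressed in local generators.\<close>

lemma idele_degree_nonpos:
  assumes "\<And>P. P \<in> X \<Longrightarrow> ord_at P (g P) \<ge> 0"
  shows "idele_degree g \<le> 0"
  unfolding idele_degree_def using assms by (auto intro!: sum_nonneg)

text \<open>A sum of nonnegative orders vanishes only termwise. In terms of maps: a nonzero map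
  between line bundles of equal degree is an isomorphism.\<close>

lemma idele_degree_zero_imp_units:
  assumes "idele g" "\<And>P. P \<in> X \<Longrightarrow> ord_at P (g P) \<ge> 0" "idele_degree g = 0" "P \<in> X"
  shows "ord_at P (g P) = 0"
proof -
  let ?S = "{P \<in> X. ord_at P (g P) \<noteq> 0}"
  have "finite ?S" using assms(1) unfolding idele_def by blast
  moreover have "(\<Sum>P\<in>?S. ord_at P (g P)) = 0"
    using assms(3) unfolding idele_degree_def by simp
  ultimately have "\<forall>P\<in>?S. ord_at P (g P) = 0"
    using sum_nonneg_eq_0_iff[of ?S "\<lambda>P. ord_at P (g P)"] assms(2) by blast
  then show ?thesis using assms(4) by blast
qed

section \<open>Degrees and slopes through local generators\<close>

lemma degree_line_generated_by:
  assumes "generated_by L g"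
  shows "degree_line X L = idele_degree g"
proof -
  have m: "multiplicity_at L P = - ord_at P (g P)" if "P \<in> X" for P
    using dvr.multiplicity_principal[OF X_dvr[OF that]] assms that idele_nz unfolding generated_by_def by blast
  then have "{P \<in> X. multiplicity_at L P \<noteq> 0} = {P \<in> X. ord_at P (g P) \<noteq> 0}" by auto
  then show ?thesis
    unfolding degree_line_def idele_degree_def using m by (simp flip: sum_negf)
qed

text \<open>One trivialisation serves all but finitely many points, and its generator is a fixed
  nonzero function, which has finitely many zeros and poles. The remaining points are treated one by
  one.\<close>

lemma ex_generators:
  assumes "line_bundle X L"
  obtains g where "generated_by L g"
proof -
  obtain P0 where "P0 \<in> X" using X_nonempty by blast
  then obtain U M where U: "U \<subseteq> X" "finite (X - U)" "invertible M" "\<forall>Q\<in>U. L Q = free_stalk Q M"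
    using assms unfolding vector_bundle_iff by blast
  have "\<exists>c. c \<noteq> 0 \<and> L P = principal_stalk P c" if "P \<in> X" for P
    using vector_bundle_stalk[OF assms that] by (metis free_stalk_1 invertible_1)
  then obtain c where c: "\<And>P. P \<in> X \<Longrightarrow> c P \<noteq> 0 \<and> L P = principal_stalk P (c P)" by metis
  define g where "g P = (if P \<in> U then M $ 1 $ 1 else c P)" for P
  have M0: "M $ 1 $ 1 \<noteq> 0" using U(3) by (simp add: invertible_1)
  have "{P \<in> X. ord_at P (g P) \<noteq> 0} \<subseteq> (X - U) \<union> {P \<in> X. ord_at P (M $ 1 $ 1) \<noteq> 0}"
    unfolding g_def by auto
  moreover have "finite \<dots>" using U(2) finite_support[OF M0] by simp
  ultimately have "finite {P \<in> X. ord_at P (g P) \<noteq> 0}" by (rule finite_subset)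
  then have "generated_by L g"
    unfolding generated_by_def idele_def using M0 c U(4) by (auto simp: g_def free_stalk_1)
  then show ?thesis by (rule that)
qed

lemma generated_by_det_bundle:
  assumes "\<And>P. P \<in> X \<Longrightarrow> E P = free_stalk P (M P)" "idele (\<lambda>P. det (M P))"
  shows "generated_by (det_bundle E) (\<lambda>P. det (M P))"
  unfolding generated_by_def
  by (intro conjI ballI assms(2) det_bundle_stalk X_subring assms(1))

lemma generated_by_det_line:
  assumes "generated_by L g"
  shows "generated_by (det_bundle L) g"
  using generated_by_det_bundle[of L "\<lambda>P. \<chi> i j. g P"] assms
  by (simp add: generated_by_def free_stalk_1 det_1)

lemma bundle_degree_line:
  assumes "generated_by L g"
  shows "bundle_degree X L = idele_degree g"
  unfolding bundle_degree_def by (rule degree_line_generated_by[OF generated_by_det_line[OF assms]])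

lemma slope_line: "generated_by L g \<Longrightarrow> slope X L = of_int (idele_degree g)"
  unfolding slope_def by (simp add: bundle_degree_line)

lemma generated_by_unique:
  assumes "generated_by L g" "generated_by L h" "P \<in> X"
  shows "ord_at P (g P) = ord_at P (h P)"
  using assms dvr.principal_eq_iff[OF X_dvr[OF assms(3)]] unfolding generated_by_def idele_def by metis

section \<open>Extensions of line bundles\<close>

lemma mult_row_1: "(B *v v) $ 1 = B $ 1 $ 1 * v $ 1 + B $ 1 $ 2 * v $ 2" for B :: "'a ^ 2 ^ 1"
  by (simp add: matrix_vector_mult_def sum_2)

lemma vec_1_eq_0_iff: "v = 0 \<longleftrightarrow> v $ 1 = 0" for v :: "'a ^ 1"
  by (simp add: vec_eq_iff forall_1)

text \<open>If \<open>B\<close> kills \<open>\<alpha>\<close>, then \<open>B\<close> and \<open>det (\<alpha>, _)\<close> are linear forms with the same kernel.\<close>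

lemma det_proportional:
  fixes \<alpha> :: "'a ^ 2" and B :: "'a ^ 2 ^ 1"
  assumes "B *v \<alpha> = 0" "\<alpha> \<noteq> 0" "B *v w \<noteq> 0"
  obtains \<delta> where "\<delta> \<noteq> 0" "\<And>v. det (columns2 \<alpha> v) = \<delta> * (B *v v) $ 1"
proof -
  have B: "B $ 1 $ 1 * \<alpha> $ 1 + B $ 1 $ 2 * \<alpha> $ 2 = 0" using assms(1) by (simp add: vec_1_eq_0_iff mult_row_1)
  have nz: "B $ 1 $ 1 \<noteq> 0 \<or> B $ 1 $ 2 \<noteq> 0" using assms(3) by (auto simp: vec_1_eq_0_iff mult_row_1)
  show ?thesis
  proof (cases "\<alpha> $ 1 = 0")
    case True
    then have "\<alpha> $ 2 \<noteq> 0" using assms(2) by (simp add: vec_eq_iff forall_2)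
    then have "B $ 1 $ 2 = 0" "B $ 1 $ 1 \<noteq> 0" using B True nz by auto
    then show ?thesis
      using that[of "- (\<alpha> $ 2) / B $ 1 $ 1"] \<open>\<alpha> $ 2 \<noteq> 0\<close> True by (simp add: det_columns2 mult_row_1)
  next
    case False
    have b2: "B $ 1 $ 2 \<noteq> 0" using B False nz by auto
    have "B $ 1 $ 1 * \<alpha> $ 1 = - (B $ 1 $ 2 * \<alpha> $ 2)" using B by (simp add: eq_neg_iff_add_eq_0)
    define k where "k = \<alpha> $ 1 / B $ 1 $ 2"
    have k: "k * B $ 1 $ 2 = \<alpha> $ 1" "k * B $ 1 $ 1 = - \<alpha> $ 2"
      using b2 \<open>B $ 1 $ 1 * \<alpha> $ 1 = _\<close> by (simp_all add: k_def field_simps)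
    have "det (columns2 \<alpha> v) = k * (B *v v) $ 1" for v
      unfolding det_columns2 mult_row_1 distrib_left mult.assoc[symmetric] k by (simp add: mult.commute)
    then show ?thesis using that[of k] b2 False by (simp add: k_def)
  qed
qed

lemma det_columns2_eq_0:
  fixes \<alpha> v :: "'a ^ 2"
  assumes "det (columns2 \<alpha> v) = 0" "\<alpha> \<noteq> 0"
  obtains k where "v = k *s \<alpha>"
proof (cases "\<alpha> $ 1 = 0")
  case True
  then have "\<alpha> $ 2 \<noteq> 0" using assms(2) by (simp add: vec_eq_iff forall_2)
  then show ?thesis
    using that[of "v $ 2 / \<alpha> $ 2"] assms(1) True by (simp add: det_columns2 vec_eq_iff forall_2)
next
  case False
  then show ?thesis
    using that[of "v $ 1 / \<alpha> $ 1"] assms(1) by (simp add: det_columns2 vec_eq_iff forall_2 field_simps)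
qed

lemma det_columns2_scale: "det (columns2 (a *s x) (b *s y)) = a * b * det (columns2 x (y :: 'a ^ 2))"
  by (simp add: det_columns2 algebra_simps)

text \<open>\<open>column 1 A\<close> spans the generic fibre of N, and \<open>v P\<close> lifts a
  generator of the stalk of Q. Subtracting a multiple of this lift moves any element of the stalk of
  V into the kernel of B, that is, into N; this gives a basis adapted to the extension.\<close>

lemma extension_stalks:
  assumes ex: "short_exact X N A V B (Q :: ('a, 1) subsheaf)" and V: "vector_bundle X (V :: ('a, 2) subsheaf)"
    and n: "generated_by N n" and q: "generated_by Q q"
  obtains v where "B *v column 1 A = 0" "column 1 A \<noteq> 0"
    "\<And>P. P \<in> X \<Longrightarrow> v P \<in> V P \<and> (B *v v P) $ 1 = q P \<and>
      V P = free_stalk P (columns2 (n P *s column 1 A) (v P))"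
proof -
  let ?\<alpha> = "column 1 A"
  have n': "\<And>P. P \<in> X \<Longrightarrow> N P = principal_stalk P (n P)" "\<And>P. P \<in> X \<Longrightarrow> n P \<noteq> 0"
    and q': "\<And>P. P \<in> X \<Longrightarrow> Q P = principal_stalk P (q P)"
    using n q unfolding generated_by_def idele_def by auto
  have gen: "(\<chi> i. g) \<in> principal_stalk P g" if "P \<in> X" for g P
    unfolding principal_stalk_def using subring_one[OF X_subring[OF that]] by (auto intro!: bexI[of _ 1])
  have A_gen: "A *v (\<chi> i. g) = g *s ?\<alpha>" for g by (simp add: mult_matrix_1)
  obtain P0 where P0: "P0 \<in> X" using X_nonempty by blast
  have ex': "inj_on (\<lambda>v. A *v v) (N P)" "(\<lambda>v. A *v v) ` N P = {v \<in> V P. B *v v = 0}"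
    "(\<lambda>v. B *v v) ` V P = Q P" if "P \<in> X" for P
    using ex that unfolding short_exact_def by auto
  \<comment> \<open>Otherwise A would kill the nonzero generator of a stalk of N, against
    injectivity.\<close>
  have \<alpha>0: "?\<alpha> \<noteq> 0"
  proof
    assume "?\<alpha> = 0"
    then have "A *v (\<chi> i. n P0) = A *v 0" by (simp add: A_gen)
    moreover have "0 \<in> N P0"
      using n'(1)[OF P0] submodule_zero[OF submodule_principal[OF X_subring[OF P0]]] by simp
    ultimately have "(\<chi> i. n P0) = (0 :: 'a ^ 1)"
      using ex'(1)[OF P0] gen[OF P0, of "n P0"] n'(1)[OF P0] by (metis inj_onD)
    then show False using n'(2)[OF P0] by (simp add: vec_eq_iff)
  qed
  have "n P0 *s ?\<alpha> \<in> (\<lambda>v. A *v v) ` N P0"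
    using gen[OF P0, of "n P0"] n'(1)[OF P0] A_gen[of "n P0"] by (metis image_eqI)
  then have "B *v (n P0 *s ?\<alpha>) = 0" using ex'(2)[OF P0] by blast
  then have B\<alpha>: "B *v ?\<alpha> = 0" using n'(2)[OF P0] by (simp add: vector_scalar_commute)
  have "\<exists>v. v \<in> V P \<and> (B *v v) $ 1 = q P" if P: "P \<in> X" for P
  proof -
    have "(\<chi> i. q P) \<in> (\<lambda>v. B *v v) ` V P" using gen[OF P] ex'(3)[OF P] q'[OF P] by simp
    then obtain v where "v \<in> V P" "B *v v = (\<chi> i. q P)" by force
    then show ?thesis by (intro exI[of _ v]) simp
  qed
  then obtain v where v: "\<And>P. P \<in> X \<Longrightarrow> v P \<in> V P" "\<And>P. P \<in> X \<Longrightarrow> (B *v v P) $ 1 = q P" by metis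
  have "V P = free_stalk P (columns2 (n P *s ?\<alpha>) (v P))" if P: "P \<in> X" for P
  proof (intro set_eqI iffI)
    have sub: "is_subring P" using X_subring[OF P] .
    have mod: "submodule P (V P)"
      using vector_bundle_stalk[OF V P] submodule_free_stalk[OF sub] by metis
    fix w
    show "w \<in> V P" if w: "w \<in> free_stalk P (columns2 (n P *s ?\<alpha>) (v P))"
    proof -
      have "n P *s ?\<alpha> \<in> V P"
        using ex'(2)[OF P] gen[OF P, of "n P"] n'(1)[OF P] A_gen[of "n P"] by (metis (mono_tags, lifting) imageI mem_Collect_eq)
      moreover obtain a b where "a \<in> P" "b \<in> P" "w = a *s (n P *s ?\<alpha>) + b *s v P"
        using w unfolding free_stalk_columns2 by blast
      ultimately show ?thesis
        using submodule_add[OF mod] submodule_scale[OF mod] v(1)[OF P] by metis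
    qed
    show "w \<in> free_stalk P (columns2 (n P *s ?\<alpha>) (v P))" if w: "w \<in> V P"
    proof -
      have "B *v w \<in> principal_stalk P (q P)" using w ex'(3)[OF P] q'[OF P] by blast
      then obtain a where a: "a \<in> P" "(B *v w) $ 1 = a * q P" unfolding principal_stalk_def by blast
      have "w - a *s v P \<in> V P"
        using w a v(1)[OF P] by (intro submodule_diff[OF sub mod] submodule_scale[OF mod])
      moreover have "B *v (w - a *s v P) = 0"
        using a v(2)[OF P] by (simp add: vec_1_eq_0_iff matrix_vector_mult_diff_distrib vector_scalar_commute)
      ultimately obtain x where x: "x \<in> N P" "w - a *s v P = A *v x" using ex'(2)[OF P] by blast
      then obtain b where b: "b \<in> P" "x $ 1 = b * n P" using n'(1)[OF P] unfolding principal_stalk_def by blast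
      have "w = b *s (n P *s ?\<alpha>) + a *s v P"
        using x(2) b(2) by (simp add: mult_matrix_1 diff_eq_eq)
      then show ?thesis using a b unfolding free_stalk_columns2 by blast
    qed
  qed
  then show ?thesis using that[OF B\<alpha> \<alpha>0, of v] v by blast
qed

end

section \<open>Matrices given by two columns, Frobenius on vectors, and direct sums\<close>

lemma columns2_column: "column 1 (columns2 x y) = x" "column 2 (columns2 x y) = y"
  by (simp_all add: column_def columns2_def vec_eq_iff)

lemma matrix_mult_columns2: "A ** columns2 x y = columns2 (A *v x) (A *v (y :: 'a::field ^ 2))"
  by (simp add: columns2_def matrix_matrix_mult_def matrix_vector_mult_def vec_eq_iff sum_2)

lemma image_free_stalk: "(\<lambda>v. A *v v) ` free_stalk P M = free_stalk P (A ** M)"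
  unfolding free_stalk_def by (simp add: image_image matrix_vector_mul_assoc)

lemma frobenius_pullback_map_columns2:
  "frobenius_pullback_map p (columns2 x y) = columns2 (\<chi> i. x $ i ^ p) (\<chi> i. y $ i ^ p)"
  by (simp add: frobenius_pullback_map_def columns2_def vec_eq_iff)

lemma frobenius_pullback_map_vector:
  fixes B :: "'a::field ^ 'm ^ 'n"
  assumes "\<And>x y :: 'a. (x + y) ^ p = x ^ p + y ^ p" "p > 0"
  shows "frobenius_pullback_map p B *v (\<chi> i. x $ i ^ p) = (\<chi> i. (B *v x) $ i ^ p)"
  by (simp add: frobenius_pullback_map_def matrix_vector_mult_def vec_eq_iff
      sum_frobenius_power[OF assms] power_mult_distrib)

lemma structure_sheaf_stalk: "structure_sheaf P = principal_stalk P 1"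
  unfolding structure_sheaf_def principal_stalk_def by auto

lemma direct_sum_stalk:
  fixes L :: "('a::field, 1) subsheaf"
  assumes "L P = principal_stalk P l"
  shows "direct_sum structure_sheaf L P = free_stalk P (columns2 (vector [1, 0]) (vector [0, l]))"
proof (intro set_eqI iffI)
  fix w assume "w \<in> direct_sum structure_sheaf L P"
  then obtain x y :: "'a ^ 1" where "w = vector [x $ 1, y $ 1]" "x $ 1 \<in> P" "y \<in> L P"
    unfolding direct_sum_def structure_sheaf_def by blast
  moreover from this obtain b where "b \<in> P" "y $ 1 = b * l" unfolding assms principal_stalk_def by blast
  ultimately show "w \<in> free_stalk P (columns2 (vector [1, 0]) (vector [0, l]))"
    unfolding free_stalk_columns2
    by (intro bexI[of _ "x $ 1"] bexI[of _ b]) (auto simp: vec_eq_iff forall_2)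
next
  fix w assume "w \<in> free_stalk P (columns2 (vector [1, 0]) (vector [0, l]))"
  then obtain a b where "a \<in> P" "b \<in> P" "w = a *s vector [1, 0] + b *s vector [0, l]"
    unfolding free_stalk_columns2 by blast
  then show "w \<in> direct_sum structure_sheaf L P"
    unfolding direct_sum_def structure_sheaf_def assms principal_stalk_def
    by (intro CollectI exI[of _ "\<chi> i. a"] exI[of _ "\<chi> i. b * l"]) (auto simp: vec_eq_iff forall_2)
qed

lemma vector_bundle_direct_sum:
  assumes "line_bundle X L"
  shows "vector_bundle X (direct_sum structure_sheaf L)"
  unfolding vector_bundle_iff
proof
  fix P assume "P \<in> X"
  then obtain U K where U: "U \<subseteq> X" "finite (X - U)" "P \<in> U" "invertible K" "\<forall>Q\<in>U. L Q = free_stalk Q K"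
    using assms unfolding vector_bundle_iff by blast
  define M where "M = columns2 (vector [1, 0]) (vector [0, K $ 1 $ 1])"
  have "invertible M"
    using U(4) by (simp add: M_def invertible_det_nz det_columns2 det_1)
  moreover have "direct_sum structure_sheaf L Q = free_stalk Q M" if "Q \<in> U" for Q
    unfolding M_def using U(5) that by (intro direct_sum_stalk) (simp add: free_stalk_1)
  ultimately show "\<exists>U M. U \<subseteq> X \<and> finite (X - U) \<and> P \<in> U \<and> invertible M \<and>
      (\<forall>Q\<in>U. direct_sum structure_sheaf L Q = free_stalk Q M)"
    using U by blast
qed

lemma image_principal: "(\<lambda>v. A *v v) ` principal_stalk P g = principal_stalk P (A $ 1 $ 1 * g)"
  using image_free_stalk[of A P "\<chi> i j. g"]
  by (simp add: free_stalk_1 matrix_matrix_mult_def sum_1)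

lemma bundle_iso_refl: "bundle_iso X E E"
  unfolding bundle_iso_def bundle_iso_by_def
  by (intro exI[of _ "mat 1"]) (simp add: invertible_def exI[of _ "mat 1"])

lemma free_stalk_columns2_scale:
  "(\<lambda>v. c *s v) ` free_stalk P (columns2 x y) = free_stalk P (columns2 (c *s x) (c *s y))"
  unfolding free_stalk_mat[symmetric] by (simp add: matrix_mult_columns2 mat_mult_vector)

section \<open>Higgs fields on extensions\<close>

context fun_field
begin

lemma submodule_bundle:
  assumes "vector_bundle X (V :: ('a, 'n::finite) subsheaf)" "P \<in> X"
  shows "submodule P (V P)"
  using vector_bundle_stalk[OF assms] submodule_free_stalk[OF X_subring[OF assms(2)]] by metis

text \<open>An isomorphism of rank 1 is multiplication by one nonzero function. The factor t is
  therefore the same at all points, and degrees agree because t has degree 0.\<close>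

lemma generated_by_iso:
  assumes "bundle_iso X E L" "generated_by L l"
  obtains t where "t \<noteq> 0" "generated_by E (\<lambda>P. t * l P)"
proof -
  obtain A where A: "invertible A" "\<And>P. P \<in> X \<Longrightarrow> (\<lambda>v. A *v v) ` E P = L P"
    using assms(1) unfolding bundle_iso_def bundle_iso_by_def by blast
  obtain A' where A': "A ** A' = mat 1" "A' ** A = mat 1" using A(1) unfolding invertible_def by blast
  have "A' $ 1 $ 1 \<noteq> 0" using A' unfolding invertible_1[symmetric] invertible_def by blast
  moreover have "E P = principal_stalk P (A' $ 1 $ 1 * l P)" if P: "P \<in> X" for P
  proof -
    have "E P = (\<lambda>v. A' *v v) ` (\<lambda>v. A *v v) ` E P"
      by (simp add: image_image matrix_vector_mul_assoc A')
    also have "\<dots> = (\<lambda>v. A' *v v) ` principal_stalk P (l P)"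
      using A(2) assms(2) P unfolding generated_by_def by simp
    finally show ?thesis by (simp add: image_principal)
  qed
  ultimately have "generated_by E (\<lambda>P. A' $ 1 $ 1 * l P)"
    using assms(2) idele_mult[OF idele_const] unfolding generated_by_def by simp
  with \<open>A' $ 1 $ 1 \<noteq> 0\<close> show ?thesis by (rule that)
qed

lemma slope_eq_half:
  assumes "bundle_iso X (det_bundle (V :: ('a, 2) subsheaf)) L" "generated_by L l"
  shows "slope X V = of_int (idele_degree l) / 2"
proof -
  obtain t where t: "t \<noteq> 0" "generated_by (det_bundle V) (\<lambda>P. t * l P)"
    using generated_by_iso[OF assms] by blast
  have "idele_degree (\<lambda>P. t * l P) = idele_degree l"
    using assms(2) idele_degree_mult[OF idele_const[OF t(1)], of l] idele_degree_const[OF t(1)]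
    unfolding generated_by_def by simp
  then show ?thesis unfolding slope_def bundle_degree_def by (simp add: degree_line_generated_by[OF t(2)])
qed

text \<open>The Higgs field \<open>A ** B\<close> factors through the quotient and is nilpotent, so its only invariant
  line subbundle is its kernel, which has degree 0.\<close>

lemma nilpotent_higgs_semistable:
  fixes A :: "'a ^ 1 ^ 2" and B :: "'a ^ 2 ^ 1"
  assumes V: "vector_bundle X V"
    and stalks: "\<And>P. P \<in> X \<Longrightarrow> V P = free_stalk P (columns2 (m P *s column 1 A) (m P *s v P))"
    and \<alpha>0: "column 1 A \<noteq> 0" and B\<alpha>: "B *v column 1 A = 0" and Bv: "\<And>P. P \<in> X \<Longrightarrow> (B *v v P) $ 1 = l P"
    and L: "generated_by L l" "idele_degree l \<ge> 0" and m: "idele m" "idele_degree m = 0"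
  shows "higgs_semistable X L V (A ** B)"
proof -
  let ?\<alpha> = "column 1 A"
  have l: "idele l" using L(1) unfolding generated_by_def by blast
  obtain P0 where P0: "P0 \<in> X" using X_nonempty by blast
  have "B *v v P0 \<noteq> 0" using Bv[OF P0] idele_nz[OF l P0] by (auto simp: vec_1_eq_0_iff)
  then obtain \<delta> where \<delta>: "\<delta> \<noteq> 0" "\<And>v. det (columns2 ?\<alpha> v) = \<delta> * (B *v v) $ 1"
    using det_proportional[OF B\<alpha> \<alpha>0] by metis
  have \<phi>: "(A ** B) *v w = (B *v w) $ 1 *s ?\<alpha>" for w
    by (simp add: matrix_vector_mul_assoc[symmetric] mult_matrix_1)
  have "bundle_hom X V (twist V L) (A ** B)"
    unfolding bundle_hom_def
  proof (intro ballI image_subsetI)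
    fix P w assume P: "P \<in> X" and w: "w \<in> V P"
    obtain a b where ab: "a \<in> P" "b \<in> P" "w = a *s (m P *s ?\<alpha>) + b *s (m P *s v P)"
      using w unfolding stalks[OF P] free_stalk_columns2 by blast
    have "(A ** B) *v w = l P *s (b *s (m P *s ?\<alpha>))"
      unfolding \<phi> ab(3)
      by (simp add: matrix_vector_right_distrib vector_scalar_commute B\<alpha> Bv[OF P] mult_ac)
    moreover have "b *s (m P *s ?\<alpha>) \<in> V P"
      unfolding stalks[OF P] free_stalk_columns2
      using ab(2) subring_zero[OF X_subring[OF P]] by (intro bexI[of _ b] bexI[of _ 0]) auto
    moreover have "twist V L P = (\<lambda>v. l P *s v) ` V P"
      using L(1) P unfolding generated_by_def
      by (intro twist_stalk X_subring submodule_bundle[OF V]) auto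
    ultimately show "(A ** B) *v w \<in> twist V L P" by blast
  qed
  then have higgs: "higgs_bundle X L V (A ** B)" unfolding higgs_bundle_def using V by blast
  \<comment> \<open>The determinant of V has local generators with factors of degree 0 besides
    \<open>l P\<close>: the function \<delta> is global, and m has degree 0 by assumption. So deg V
    = deg L.\<close>
  have det: "det (columns2 (m P *s ?\<alpha>) (m P *s v P)) = (m P * m P) * (\<delta> * l P)" if "P \<in> X" for P
    using \<delta>(2)[of "v P"] Bv[OF that] by (simp add: det_columns2_scale)
  have mm: "idele (\<lambda>P. (m P * m P) * (\<delta> * l P))" and
    deg: "idele_degree (\<lambda>P. (m P * m P) * (\<delta> * l P)) = idele_degree l"
    using m l \<delta>(1) by (simp_all add: idele_mult idele_const idele_degree_mult idele_degree_const)
  have gen: "generated_by (det_bundle V) (\<lambda>P. (m P * m P) * (\<delta> * l P))"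
    unfolding generated_by_def
  proof (intro conjI mm ballI)
    fix P assume P: "P \<in> X"
    show "det_bundle V P = principal_stalk P ((m P * m P) * (\<delta> * l P))"
      using det_bundle_stalk[where E = V, OF X_subring[OF P] stalks[OF P]] unfolding det[OF P] .
  qed
  have "slope X V = of_int (idele_degree l) / 2"
    unfolding slope_def bundle_degree_def degree_line_generated_by[OF gen] deg by simp
  then have slope: "slope X V \<ge> 0" using L(2) by simp
  have "slope X N \<le> slope X V" if inv: "invariant_line_subbundle X L V (A ** B) N A'" for N A'
  proof -
    obtain Q :: "('a, 1) subsheaf" and B' where N: "line_bundle X N" and Q: "line_bundle X Q"
      and ex: "short_exact X N A' V B' Q"
      using inv unfolding invariant_line_subbundle_def line_subbundle_def by blast
    obtain n where n: "generated_by N n" using ex_generators[OF N] .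
    obtain q where q: "generated_by Q q" using ex_generators[OF Q] .
    let ?\<alpha>' = "column 1 A'"
    obtain v' where ex': "B' *v ?\<alpha>' = 0" "?\<alpha>' \<noteq> 0"
      "\<And>P. P \<in> X \<Longrightarrow> v' P \<in> V P \<and> (B' *v v' P) $ 1 = q P \<and>
        V P = free_stalk P (columns2 (n P *s ?\<alpha>') (v' P))"
      using extension_stalks[OF ex V n q] by blast
    have "q P0 \<noteq> 0" using q idele_nz P0 unfolding generated_by_def by blast
    then have "B' *v v' P0 \<noteq> 0" using ex'(3)[OF P0] by (auto simp: vec_1_eq_0_iff)
    have nP0: "n P0 \<noteq> 0" using n idele_nz P0 unfolding generated_by_def by blast
    \<comment> \<open>Invariance at a single stalk already makes the generic vector of N an
      eigenvector of the Higgs field.\<close>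
    have "\<exists>s. (A ** B) *v ?\<alpha>' = s *s ?\<alpha>'"
    proof -
      have "(\<chi> i. n P0) \<in> N P0"
        using n P0 subring_one[OF X_subring[OF P0]] unfolding generated_by_def principal_stalk_def
        by (auto intro!: bexI[of _ 1])
      then have "(A ** B) *v (A' *v (\<chi> i. n P0)) \<in> (\<lambda>v. A' *v v) ` twist N L P0"
        using inv P0 unfolding invariant_line_subbundle_def by blast
      then obtain w where "(A ** B) *v (A' *v (\<chi> i. n P0)) = A' *v w" by blast
      then have "(A ** B) *v (n P0 *s ?\<alpha>') = w $ 1 *s ?\<alpha>'"
        by (simp only: mult_matrix_1[of A'] vec_lambda_beta)
      then have "n P0 *s ((A ** B) *v ?\<alpha>') = w $ 1 *s ?\<alpha>'" by (simp add: vector_scalar_commute)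
      then have "inverse (n P0) *s (n P0 *s ((A ** B) *v ?\<alpha>')) = (inverse (n P0) * w $ 1) *s ?\<alpha>'" by simp
      then show ?thesis using nP0 by auto
    qed
    then obtain s where s: "(B *v ?\<alpha>') $ 1 *s ?\<alpha> = s *s ?\<alpha>'" unfolding \<phi> by blast
    \<comment> \<open>Applying B to the eigenvector equation kills its left side. If B did not
      vanish on the eigenvector, the eigenvalue s would be 0, and the equation would then force
      \<alpha> = 0.\<close>
    have B\<alpha>': "(B *v ?\<alpha>') $ 1 = 0"
    proof (rule ccontr)
      assume nz: "(B *v ?\<alpha>') $ 1 \<noteq> 0"
      have "B *v (s *s ?\<alpha>') = 0" unfolding s[symmetric] by (simp add: vector_scalar_commute B\<alpha>)
      then have "s * (B *v ?\<alpha>') $ 1 = 0" by (simp add: vector_scalar_commute vec_1_eq_0_iff)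
      then have "s = 0" using nz by simp
      then show False using s nz \<alpha>0 by simp
    qed
    then have "det (columns2 ?\<alpha> ?\<alpha>') = 0" using \<delta>(2) by simp
    then obtain k where k: "?\<alpha>' = k *s ?\<alpha>" using det_columns2_eq_0 \<alpha>0 by metis
    have k0: "k \<noteq> 0" using k ex'(2) by auto
    \<comment> \<open>N and the kernel of the Higgs field span the same generic line and are both
      saturated in V, so their local generators are integral multiples of each other.\<close>
    have "ord_at P (k * n P) = ord_at P (m P)" if P: "P \<in> X" for P
    proof -
      interpret dvr P using X_dvr[OF P] .
      have nP: "n P \<noteq> 0" and mP: "m P \<noteq> 0" and lP: "l P \<noteq> 0" and qP: "q P \<noteq> 0"
        using n q m l idele_nz P unfolding generated_by_def by auto
      have B'\<alpha>: "B' *v ?\<alpha> = 0" using ex'(1) k0 unfolding k by (simp add: vector_scalar_commute)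

      have "n P *s ?\<alpha>' \<in> V P"
        using ex'(3)[OF P] column_in_free_stalk[OF subring, of 1 "columns2 (n P *s ?\<alpha>') (v' P)"]
        by (simp add: columns2_column)
      then obtain a b where ab: "a \<in> P" "b \<in> P" "n P *s ?\<alpha>' = a *s (m P *s ?\<alpha>) + b *s (m P *s v P)"
        unfolding stalks[OF P] free_stalk_columns2 by blast
      have "(B *v (n P *s ?\<alpha>')) $ 1 = b * (m P * l P)"
        unfolding ab(3) by (simp add: matrix_vector_right_distrib vector_scalar_commute B\<alpha> Bv[OF P])
      then have "b = 0" using B\<alpha>' mP lP by (simp add: vector_scalar_commute)
      then have "(n P * k - a * m P) *s ?\<alpha> = 0" using ab(3) k by (simp add: vector_ssub_ldistrib)
      then have 1: "n P * k = a * m P" using \<alpha>0 by simp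
      have "m P *s ?\<alpha> \<in> V P"
        using stalks[OF P] column_in_free_stalk[OF subring, of 1 "columns2 (m P *s ?\<alpha>) (m P *s v P)"]
        by (simp add: columns2_column)
      then obtain c d where cd: "c \<in> P" "d \<in> P" "m P *s ?\<alpha> = c *s (n P *s ?\<alpha>') + d *s v' P"
        using ex'(3)[OF P] unfolding free_stalk_columns2[symmetric] by (metis free_stalk_columns2)
      have "(B' *v (m P *s ?\<alpha>)) $ 1 = d * q P"
        unfolding cd(3) using ex'(1,3) P by (simp add: matrix_vector_right_distrib vector_scalar_commute)
      then have "d = 0" using B'\<alpha> qP by (simp add: vector_scalar_commute)
      then have "(m P - c * (n P * k)) *s ?\<alpha> = 0" using cd(3) k by (simp add: vector_ssub_ldistrib)
      then have 2: "m P = c * (k * n P)" using \<alpha>0 by (simp add: mult.commute)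
      have nz: "k * n P \<noteq> 0" using k0 nP by simp
      have "a \<noteq> 0" "c \<noteq> 0" using 1 2 nz mP by (auto simp: mult.commute)
      then have "ord_at P (k * n P) = ord_at P a + ord_at P (m P)" "ord_at P (m P) = ord_at P c + ord_at P (k * n P)"
        using 1 2 nz mP ord_mult by (metis mult.commute)+
      moreover have "ord_at P a \<ge> 0" "ord_at P c \<ge> 0" using ab(1) cd(1) mem_iff \<open>a \<noteq> 0\<close> \<open>c \<noteq> 0\<close> by auto
      ultimately show ?thesis by simp
    qed
    then have "idele_degree (\<lambda>P. k * n P) = idele_degree m"
      unfolding idele_degree_def by (intro arg_cong[where f = uminus] sum.cong) auto
    then have "idele_degree n = 0"
      using n m(2) k0 unfolding generated_by_def by (simp add: idele_degree_mult idele_const idele_degree_const)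
    then show ?thesis using slope slope_line[OF n] by simp
  qed
  then show ?thesis unfolding higgs_semistable_def using higgs by blast
qed

text \<open>Twisting scales both basis vectors of a stalk by \<open>m P\<close>. Frobenius raises A,
  B, the basis vectors, \<open>m P\<close> and \<open>l P\<close> to p-th powers entrywise and
  preserves the relations between them, so the preceding criterion applies before and after
  pull-back.\<close>

lemma frobenius_semistable_twist:
  fixes A :: "'a ^ 1 ^ 2" and B :: "'a ^ 2 ^ 1"
  assumes p: "\<And>x y :: 'a. (x + y) ^ p = x ^ p + y ^ p" "p > 0"
    and V: "vector_bundle X V" and stalks: "\<And>P. P \<in> X \<Longrightarrow> V P = free_stalk P (columns2 (column 1 A) (v P))"
    and \<alpha>0: "column 1 A \<noteq> 0" and B\<alpha>: "B *v column 1 A = 0" and Bv: "\<And>P. P \<in> X \<Longrightarrow> (B *v v P) $ 1 = l P"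
    and L: "generated_by L l" "idele_degree l \<ge> 0" and M: "line_bundle X M" "bundle_degree X M = 0"
  shows "frobenius_semistable p X L (twist V M) (A ** B)"
proof -
  obtain m where m: "generated_by M m" using ex_generators[OF M(1)] .
  have deg_m: "idele m" "idele_degree m = 0"
    using m M(2) bundle_degree_line[OF m] unfolding generated_by_def by auto
  have l: "idele l" using L(1) unfolding generated_by_def by blast
  let ?\<alpha> = "column 1 A"
  have VM: "vector_bundle X (twist V M)" by (rule vector_bundle_twist[OF V M(1) X_subring])
  have tw: "twist V M P = free_stalk P (columns2 (m P *s ?\<alpha>) (m P *s v P))" if P: "P \<in> X" for P
  proof -
    have "twist V M P = (\<lambda>v. m P *s v) ` V P"
      using m P unfolding generated_by_def
      by (intro twist_stalk X_subring submodule_bundle[OF V]) auto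
    then show ?thesis by (simp add: stalks[OF P] free_stalk_columns2_scale)
  qed
  have 1: "higgs_semistable X L (twist V M) (A ** B)"
    using nilpotent_higgs_semistable[OF VM tw \<alpha>0 B\<alpha> Bv L deg_m] .
  define A' where "A' = frobenius_pullback_map p A"
  define B' where "B' = frobenius_pullback_map p B"
  define v' where "v' P = (\<chi> i. v P $ i ^ p)" for P
  have \<alpha>': "column 1 A' = (\<chi> i. ?\<alpha> $ i ^ p)"
    by (simp add: A'_def frobenius_pullback_map_def column_def)
  have \<alpha>'0: "column 1 A' \<noteq> 0" using \<alpha>0 p(2) unfolding \<alpha>' by (auto simp: vec_eq_iff)
  have B'\<alpha>': "B' *v column 1 A' = 0"
    unfolding \<alpha>' B'_def frobenius_pullback_map_vector[OF p] B\<alpha> using p(2) by (simp add: vec_eq_iff)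
  have B'v': "(B' *v v' P) $ 1 = l P ^ p" if "P \<in> X" for P
    unfolding v'_def B'_def frobenius_pullback_map_vector[OF p] by (simp add: Bv[OF that])
  have FV: "vector_bundle X (frobenius_pullback p (twist V M))"
    by (rule vector_bundle_frobenius_pullback[OF VM X_subring p])
  have FV_stalk: "frobenius_pullback p (twist V M) P =
      free_stalk P (columns2 (m P ^ p *s column 1 A') (m P ^ p *s v' P))" if P: "P \<in> X" for P
  proof -
    have "(\<chi> i. (c *s x) $ i ^ p) = c ^ p *s (\<chi> i. x $ i ^ p)" for c and x :: "'a ^ 2"
      by (simp add: vec_eq_iff power_mult_distrib)
    then show ?thesis
      using frobenius_pullback_stalk[where E = "twist V M", OF X_subring[OF P] tw[OF P] p]
      by (simp only: frobenius_pullback_map_columns2 \<alpha>' v'_def)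
  qed
  have FL: "generated_by (frobenius_pullback p L) (\<lambda>P. l P ^ p)"
    unfolding generated_by_def
  proof (intro conjI ballI idele_power[OF l])
    fix P assume P: "P \<in> X"
    have "L P = free_stalk P (\<chi> i j. l P)"
      using L(1) P unfolding generated_by_def by (simp add: free_stalk_1)
    from frobenius_pullback_stalk[where E = L, OF X_subring[OF P] this p]
    show "frobenius_pullback p L P = principal_stalk P (l P ^ p)"
      by (simp add: free_stalk_1 frobenius_pullback_map_def)
  qed
  have "higgs_semistable X (frobenius_pullback p L) (frobenius_pullback p (twist V M)) (A' ** B')"
    using L(2) deg_m
    by (intro nilpotent_higgs_semistable[OF FV FV_stalk \<alpha>'0 B'\<alpha>' B'v' FL])
       (simp_all add: idele_degree_power l idele_power)
  then show ?thesis
    unfolding frobenius_semistable_def using 1 by (simp add: frobenius_pullback_map_mult[OF p] A'_def B'_def)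
qed

text \<open>Line subbundles have integral slope, so equality with 1 / 2 cannot occur.\<close>

lemma semistable_imp_stable:
  assumes "semistable X V" "slope X V = 1 / 2"
  shows "stable X V"
  unfolding stable_def
proof (intro conjI allI impI)
  show "vector_bundle X V" using assms(1) unfolding semistable_def by blast
  fix N A assume sub: "line_subbundle X V N A"
  then obtain n where n: "generated_by N n" using ex_generators unfolding line_subbundle_def by blast
  have "(of_int (idele_degree n) :: rat) \<le> 1 / 2"
    using assms sub slope_line[OF n] unfolding semistable_def by metis
  moreover have "(of_int (idele_degree n) :: rat) \<noteq> 1 / 2"
  proof
    assume "(of_int (idele_degree n) :: rat) = 1 / 2"
    then have "(of_int (2 * idele_degree n) :: rat) = of_int 1" by simp
    then have "2 * idele_degree n = 1" unfolding of_int_eq_iff .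
    then show False by presburger
  qed
  ultimately show "slope X N < slope X V" using assms(2) slope_line[OF n] by simp
qed

text \<open>V belongs to its own class only if it is S-equivalent to itself, which requires a graded
  object. Stability supplies V itself.\<close>

lemma semistable_in_moduli:
  assumes "semistable X V" "bundle_iso X (det_bundle V) L" "generated_by L l" "idele_degree l = 1"
  shows "\<exists>C\<in>bundle_moduli X L. V \<in> C"
proof -
  have "slope X V = 1 / 2" using slope_eq_half[OF assms(2,3)] assms(4) by simp
  then have "stable X V" using semistable_imp_stable assms(1) by blast
  then have "S_equivalent X V V"
    unfolding S_equivalent_def is_graded_def using bundle_iso_refl by blast
  then show ?thesis
    unfolding bundle_moduli_def Let_def
    by (intro bexI[OF _ quotientI[of V]]) (use assms(1,2) in auto)
qed

text \<open>If the induced map from N to the quotient vanishes generically, \<phi> maps N into the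
  kernel of B, which at each stalk is N twisted by L. It is used in contraposition: a destabilising
  N is not invariant, so the induced map is nonzero.\<close>

lemma destabilized_not_invariant:
  fixes B :: "'a ^ 2 ^ 1"
  assumes higgs: "higgs_bundle X L V \<phi>" and L: "generated_by L l"
    and ex: "short_exact X N A V B (Q :: ('a, 1) subsheaf)" and n: "generated_by N n"
    and sub: "line_subbundle X V N A" and zero: "(B *v (\<phi> *v column 1 A)) $ 1 = 0"
  shows "invariant_line_subbundle X L V \<phi> N A"
  unfolding invariant_line_subbundle_def
proof (intro conjI sub ballI image_subsetI)
  fix P w assume P: "P \<in> X" and w: "w \<in> N P"
  have V: "vector_bundle X V" and hom: "bundle_hom X V (twist V L) \<phi>"
    using higgs unfolding higgs_bundle_def by auto
  have lP: "l P \<noteq> 0" using L P idele_nz unfolding generated_by_def by blast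
  have LP: "L P = principal_stalk P (l P)" using L P unfolding generated_by_def by blast
  have "A *v w \<in> V P" using ex P w unfolding short_exact_def bundle_hom_def by blast
  then have "\<phi> *v (A *v w) \<in> twist V L P" using hom P unfolding bundle_hom_def by blast
  then obtain x where x: "x \<in> V P" "\<phi> *v (A *v w) = l P *s x"
    using twist_stalk[where V = V and L = L, OF X_subring[OF P] submodule_bundle[OF V P] LP] by blast
  have "l P *s (B *v x) = B *v (\<phi> *v (A *v w))" unfolding x(2) by (simp add: vector_scalar_commute)
  also have "\<dots> = w $ 1 *s (B *v (\<phi> *v column 1 A))"
    by (simp add: mult_matrix_1[of A] vector_scalar_commute)
  also have "\<dots> = 0" using zero by (simp add: vec_1_eq_0_iff)
  finally have "B *v x = 0" using lP by simp
  then obtain y where y: "y \<in> N P" "x = A *v y"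
    using ex x(1) P unfolding short_exact_def by blast
  have "submodule P (N P)"
    using n P submodule_principal[OF X_subring[OF P]] unfolding generated_by_def by simp
  then have "l P *s y \<in> twist N L P"
    using twist_stalk[where V = N and L = L, OF X_subring[OF P] _ LP] y(1) by blast
  moreover have "\<phi> *v (A *v w) = A *v (l P *s y)" using x(2) y(2) by (simp add: vector_scalar_commute)
  ultimately show "\<phi> *v (A *v w) \<in> (\<lambda>v. A *v v) ` twist N L P" by blast
qed

text \<open>A destabilising line subbundle \<open>N\<close> with quotient \<open>Q\<close> is not invariant, so \<open>\<phi>\<close> induces a nonzero
  map \<open>N \<rightarrow> Q \<otimes> L\<close>.  As \<open>deg N > deg (V / N)\<close>, it is an isomorphism, and its inverse
  followed by \<open>\<phi>\<close> splits the extension.\<close>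

lemma unstable_higgs_splits:
  assumes higgs: "higgs_semistable X L V \<phi>" and iso: "bundle_iso X (det_bundle V) L"
    and L: "generated_by L l" "idele_degree l = 1"
    and not: "\<not> semistable X V"
  shows "\<exists>W\<in>J2 X (direct_sum structure_sheaf L). bundle_iso X V W"
proof -
  have hb: "higgs_bundle X L V \<phi>"
    and inv_slope: "\<And>N A. invariant_line_subbundle X L V \<phi> N A \<Longrightarrow> slope X N \<le> slope X V"
    using higgs unfolding higgs_semistable_def by auto
  have V: "vector_bundle X V" and hom: "bundle_hom X V (twist V L) \<phi>"
    using hb unfolding higgs_bundle_def by auto
  have slopeV: "slope X V = 1 / 2" using slope_eq_half[OF iso L(1)] L(2) by simp
  obtain N A where sub: "line_subbundle X V N A" and gt: "\<not> slope X N \<le> slope X V"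
    using not V unfolding semistable_def by blast
  obtain Q :: "('a, 1) subsheaf" and B where N: "line_bundle X N" and Q: "line_bundle X Q"
    and ex: "short_exact X N A V B Q"
    using sub unfolding line_subbundle_def by blast
  obtain n where n: "generated_by N n" using ex_generators[OF N] .
  obtain q where q: "generated_by Q q" using ex_generators[OF Q] .
  let ?\<alpha> = "column 1 A"
  obtain v where B\<alpha>: "B *v ?\<alpha> = 0" and \<alpha>0: "?\<alpha> \<noteq> 0"
    and v: "\<And>P. P \<in> X \<Longrightarrow> v P \<in> V P \<and> (B *v v P) $ 1 = q P \<and>
      V P = free_stalk P (columns2 (n P *s ?\<alpha>) (v P))"
    using extension_stalks[OF ex V n q] by blast
  have idl: "idele n" "idele q" "idele l" using n q L(1) unfolding generated_by_def by auto
  note nz = idele_nz[OF idl(1)] idele_nz[OF idl(2)] idele_nz[OF idl(3)]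
  have LP: "L P = principal_stalk P (l P)" and QP: "Q P = principal_stalk P (q P)" if "P \<in> X" for P
    using L(1) q that unfolding generated_by_def by auto
  obtain P0 where P0: "P0 \<in> X" using X_nonempty by blast
  have "B *v v P0 \<noteq> 0" using v[OF P0] nz(2)[OF P0] by (auto simp: vec_1_eq_0_iff)
  then obtain \<delta> where \<delta>: "\<delta> \<noteq> 0" "\<And>v. det (columns2 ?\<alpha> v) = \<delta> * (B *v v) $ 1"
    using det_proportional[OF B\<alpha> \<alpha>0] by metis

  have det: "det (columns2 (n P *s ?\<alpha>) (v P)) = n P * (\<delta> * q P)" if "P \<in> X" for P
    using det_columns2_scale[of "n P" ?\<alpha> 1 "v P"] \<delta>(2)[of "v P"] v[OF that] by simp
  have gen: "generated_by (det_bundle V) (\<lambda>P. n P * (\<delta> * q P))"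
    unfolding generated_by_def
  proof (intro conjI ballI idele_mult idl idele_const \<delta>(1))
    fix P assume P: "P \<in> X"
    have "V P = free_stalk P (columns2 (n P *s ?\<alpha>) (v P))" using v[OF P] by blast
    from det_bundle_stalk[where E = V, OF X_subring[OF P] this]
    show "det_bundle V P = principal_stalk P (n P * (\<delta> * q P))" unfolding det[OF P] .
  qed
  obtain t where t: "t \<noteq> 0" "generated_by (det_bundle V) (\<lambda>P. t * l P)"
    using generated_by_iso[OF iso L(1)] by blast
  have ord_det: "ord_at P (n P) + ord_at P \<delta> + ord_at P (q P) = ord_at P t + ord_at P (l P)"
    if P: "P \<in> X" for P
    using generated_by_unique[OF gen t(2) P] \<delta>(1) t(1) nz[OF P]
    by (simp add: dvr.ord_mult[OF X_dvr[OF P]])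
  have "idele_degree (\<lambda>P. n P * (\<delta> * q P)) = idele_degree (\<lambda>P. t * l P)"
    using degree_line_generated_by[OF gen] degree_line_generated_by[OF t(2)] by simp
  then have deg: "idele_degree n + idele_degree q = 1"
    using idl \<delta>(1) t(1) L(2) by (simp add: idele_degree_mult idele_mult idele_const idele_degree_const)
  have deg_n: "idele_degree n \<ge> 1"
    using gt slope_line[OF n] slopeV by (cases "idele_degree n \<le> 0") auto

  \<comment> \<open>The map from N to the quotient twisted by L, induced by \<phi> on generic
    fibres.\<close>
  define c where "c = (B *v (\<phi> *v ?\<alpha>)) $ 1"
  have c0: "c \<noteq> 0"
  proof
    assume "c = 0"
    then have "invariant_line_subbundle X L V \<phi> N A"
      unfolding c_def by (rule destabilized_not_invariant[OF hb L(1) ex n sub])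
    then show False using inv_slope gt by blast
  qed
  have \<phi>n: "\<exists>x\<in>V P. n P *s (\<phi> *v ?\<alpha>) = l P *s x" if P: "P \<in> X" for P
  proof -
    have "n P *s ?\<alpha> \<in> V P"
      using v[OF P] column_in_free_stalk[OF X_subring[OF P], of 1 "columns2 (n P *s ?\<alpha>) (v P)"]
      by (simp add: columns2_column)
    then have "\<phi> *v (n P *s ?\<alpha>) \<in> twist V L P" using hom P unfolding bundle_hom_def by blast
    then show ?thesis
      using twist_stalk[where V = V and L = L, OF X_subring[OF P] submodule_bundle[OF V P] LP[OF P]]
      by (auto simp: vector_scalar_commute)
  qed
  \<comment> \<open>The same map written in the local generators \<open>n P\<close> of N and
    \<open>l P * q P\<close> of Q \<otimes> L. It is regular because \<phi> respects stalks.\<close>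
  define r where "r P = (c * n P) / (l P * q P)" for P
  have r: "idele r" "idele_degree r = idele_degree n - 1 - idele_degree q"
    unfolding r_def using idl c0 L(2)
    by (simp_all add: idele_divide idele_mult idele_const idele_degree_divide idele_degree_mult idele_degree_const)
  have r_mem: "r P \<in> P" if P: "P \<in> X" for P
  proof -
    obtain x where x: "x \<in> V P" "n P *s (\<phi> *v ?\<alpha>) = l P *s x" using \<phi>n[OF P] by blast
    have "B *v x \<in> Q P" using ex P x(1) unfolding short_exact_def bundle_hom_def by blast
    then obtain a where a: "a \<in> P" "(B *v x) $ 1 = a * q P" unfolding QP[OF P] principal_stalk_def by blast
    have "n P * c = (B *v (n P *s (\<phi> *v ?\<alpha>))) $ 1" by (simp add: c_def vector_scalar_commute)
    also have "\<dots> = l P * (a * q P)" unfolding x(2) by (simp add: vector_scalar_commute a(2))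
    finally have "r P = a" using nz[OF P] by (simp add: r_def field_simps)
    then show ?thesis using a(1) by simp
  qed
  have r_ord: "ord_at P (r P) \<ge> 0" if P: "P \<in> X" for P
    using r_mem[OF P] dvr.mem_iff[OF X_dvr[OF P]] idele_nz[OF r(1) P] by auto
  have "idele_degree r \<le> 0" using idele_degree_nonpos r_ord by blast
  \<comment> \<open>With deg q = 1 - deg n the degree of r is 2 deg n - 2. It is at most 0, while
    deg n is at least 1.\<close>
  then have degs: "idele_degree n = 1" "idele_degree q = 0" "idele_degree r = 0"
    using deg deg_n r(2) by auto
  have unit: "ord_at P (r P) = 0" if "P \<in> X" for P
    using idele_degree_zero_imp_units[OF r(1) _ degs(3) that] r_ord by blast
  have inv_r: "inverse (r P) \<in> P" if P: "P \<in> X" for P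
    using unit[OF P] idele_nz[OF r(1) P] dvr.unit_iff[OF X_dvr[OF P]] unfolding unit_in_def by blast
  have n_eq: "n P = r P * (inverse c * (q P * l P))" if "P \<in> X" for P
    using nz[OF that] c0 by (simp add: r_def)
  have ord_n: "ord_at P (n P) = ord_at P (q P) + ord_at P (l P) - ord_at P c" if P: "P \<in> X" for P
    using arg_cong[OF n_eq[OF P], of "ord_at P"] unit[OF P] nz[OF P] c0 idele_nz[OF r(1) P]
    by (simp add: dvr.ord_mult[OF X_dvr[OF P]] dvr.ord_inverse[OF X_dvr[OF P]])

  let ?W = "twist (direct_sum structure_sheaf L) Q"
  have sQ: "submodule P (Q P)" if "P \<in> X" for P
    unfolding QP[OF that] by (rule submodule_principal[OF X_subring[OF that]])
  have "bundle_iso X (twist Q Q) structure_sheaf"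
  proof -
    \<comment> \<open>The two formulas \<open>ord_det\<close> and \<open>ord_n\<close> determine
      twice the order of \<open>q P\<close> as that of c t / \<delta>. Multiplication by the inverse
      function therefore trivialises the square of Q.\<close>
    define K :: "'a ^ 1 ^ 1" where "K = (\<chi> i j. \<delta> / (c * t))"
    have k0: "\<delta> / (c * t) \<noteq> 0" using \<delta>(1) c0 t(1) by simp
    have "(\<lambda>v. K *v v) ` twist Q Q P = structure_sheaf P" if P: "P \<in> X" for P
    proof -
      interpret dvr P using X_dvr[OF P] .
      have "twist Q Q P = (\<lambda>v. mat (q P) *v v) ` principal_stalk P (q P)"
        using twist_stalk[where V = Q and L = Q, OF subring sQ[OF P] QP[OF P]] QP[OF P]
        by (simp add: mat_mult_vector)
      then have "twist Q Q P = principal_stalk P (q P * q P)" by (simp add: image_principal mat_def)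
      then have "(\<lambda>v. K *v v) ` twist Q Q P = principal_stalk P (\<delta> / (c * t) * (q P * q P))"
        by (simp add: image_principal K_def)
      moreover have "ord_at P (\<delta> / (c * t) * (q P * q P)) = 0"
        using ord_det[OF P] ord_n[OF P] \<delta>(1) c0 t(1) nz[OF P] by (simp add: ord_mult ord_divide)
      ultimately show ?thesis
        using principal_eq_iff[of "\<delta> / (c * t) * (q P * q P)" 1] k0 nz[OF P]
        by (simp add: structure_sheaf_stalk ord_one)
    qed
    moreover have "invertible K" using k0 by (simp add: invertible_1 K_def)
    ultimately show ?thesis unfolding bundle_iso_def bundle_iso_by_def by blast
  qed
  moreover have "bundle_degree X Q = 0" using bundle_degree_line[OF q] degs by simp
  ultimately have W: "?W \<in> J2 X (direct_sum structure_sheaf L)" unfolding J2_def using Q by blast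

  let ?e1 = "vector [1, 0] :: 'a ^ 2"
  \<comment> \<open>The first column sends Q into V and splits the projection, since B maps \<phi>
    \<alpha> to c. The second sends Q \<otimes> L onto N, being inverse to the isomorphism induced
    by \<phi>.\<close>
  define T where "T = columns2 (inverse c *s (\<phi> *v ?\<alpha>)) (inverse c *s ?\<alpha>)"
  have "det T = inverse c * inverse c * - det (columns2 ?\<alpha> (\<phi> *v ?\<alpha>))"
    unfolding T_def det_columns2_scale by (simp add: det_columns2 algebra_simps)
  then have "det T \<noteq> 0" using \<delta> c0 by (simp add: c_def)
  then obtain T' where T': "T ** T' = mat 1" "T' ** T = mat 1"
    unfolding invertible_det_nz[symmetric] invertible_def by blast
  have TW: "(\<lambda>v. T *v v) ` ?W P = V P" if P: "P \<in> X" for P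
  proof -
    have sub: "is_subring P" using X_subring[OF P] .
    have mod: "submodule P (V P)" using submodule_bundle[OF V P] .
    have ds: "direct_sum structure_sheaf L P = free_stalk P (columns2 ?e1 (vector [0, l P]))"
      by (rule direct_sum_stalk[where L = L, OF LP[OF P]])
    have "?W P = (\<lambda>v. q P *s v) ` free_stalk P (columns2 ?e1 (vector [0, l P]))"
      using twist_stalk[where V = "direct_sum structure_sheaf L" and L = Q, OF sub _ QP[OF P]]
        submodule_free_stalk[OF sub] ds by metis
    then have "?W P = free_stalk P (columns2 (q P *s ?e1) (q P *s vector [0, l P]))"
      by (simp only: free_stalk_columns2_scale)
    moreover have "T *v (q P *s ?e1) = (inverse c * q P) *s (\<phi> *v ?\<alpha>)"
      by (simp add: T_def columns2_mult mult.commute)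
    moreover have "T *v (q P *s vector [0, l P]) = (inverse c * (q P * l P)) *s ?\<alpha>"
      by (simp add: T_def columns2_mult mult_ac)
    ultimately have TW: "(\<lambda>v. T *v v) ` ?W P =
        free_stalk P (columns2 ((inverse c * q P) *s (\<phi> *v ?\<alpha>)) ((inverse c * (q P * l P)) *s ?\<alpha>))"
      by (simp only: image_free_stalk matrix_mult_columns2)
    let ?x = "(inverse c * q P) *s (\<phi> *v ?\<alpha>)" and ?y = "(inverse c * (q P * l P)) *s ?\<alpha>"
    have rP: "r P \<noteq> 0" using idele_nz[OF r(1) P] .
    have nV: "n P *s ?\<alpha> \<in> V P"
      using v[OF P] column_in_free_stalk[OF sub, of 1 "columns2 (n P *s ?\<alpha>) (v P)"]
      by (simp add: columns2_column)
    have y_eq: "n P *s ?\<alpha> = r P *s ?y" by (subst n_eq[OF P]) simp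
    \<comment> \<open>Here r being a unit is used: \<open>?y\<close> generates N at P as well as
      \<open>n P *s\<close> \<alpha> does.\<close>
    have "?y = inverse (r P) *s (n P *s ?\<alpha>)"
      unfolding y_eq vector_smult_assoc mult.assoc[symmetric] left_inverse[OF rP] by simp
    then have yV: "?y \<in> V P" using submodule_scale[OF mod inv_r[OF P] nV] by metis
    have xV: "?x \<in> V P"
    proof -
      obtain x where x: "x \<in> V P" "n P *s (\<phi> *v ?\<alpha>) = l P *s x" using \<phi>n[OF P] by blast
      have "l P *s x = (r P * (inverse c * (q P * l P))) *s (\<phi> *v ?\<alpha>)"
        unfolding x(2)[symmetric] by (subst n_eq[OF P]) simp
      then have "inverse (r P * l P) *s (l P *s x) = ?x"
        using rP nz[OF P] by (simp add: field_simps)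
      moreover have "inverse (r P * l P) * l P = inverse (r P)" using rP nz[OF P] by (simp add: field_simps)
      ultimately have "?x = inverse (r P) *s x" by (metis vector_smult_assoc)
      then show ?thesis using submodule_scale[OF mod inv_r[OF P] x(1)] by simp
    qed
    have "free_stalk P (columns2 ?x ?y) = V P"
    proof
      show "free_stalk P (columns2 ?x ?y) \<subseteq> V P"
      proof (rule free_stalk_subset_submodule[OF mod])
        show "column i (columns2 ?x ?y) \<in> V P" for i
          using exhaust_2[of i] xV yV by (auto simp: columns2_column)
      qed
    next
      let ?F = "free_stalk P (columns2 ?x ?y)"
      have modF: "submodule P ?F" by (rule submodule_free_stalk[OF sub])
      have xF: "?x \<in> ?F" and yF: "?y \<in> ?F"
        using column_in_free_stalk[OF sub, of 1 "columns2 ?x ?y"] column_in_free_stalk[OF sub, of 2 "columns2 ?x ?y"]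
        by (simp_all add: columns2_column)
      have nF: "n P *s ?\<alpha> \<in> ?F" unfolding y_eq by (rule submodule_scale[OF modF r_mem[OF P] yF])
      have "v P \<in> ?F"
      proof -
        \<comment> \<open>\<open>v P\<close> and \<open>?x\<close> have the same image in Q, so they
          differ by an element of N.\<close>
        have "v P - ?x \<in> V P" using v[OF P] xV by (intro submodule_diff[OF sub mod]) auto
        then obtain a b where ab: "a \<in> P" "b \<in> P" "v P - ?x = a *s (n P *s ?\<alpha>) + b *s v P"
          using v[OF P] free_stalk_columns2[of _ P "n P *s ?\<alpha>" "v P"] by auto
        have "(B *v (v P - ?x)) $ 1 = 0"
          using v[OF P] c0 by (simp add: matrix_vector_mult_diff_distrib vector_scalar_commute c_def[symmetric])
        then have "b * q P = 0"
          unfolding ab(3) using v[OF P] by (simp add: matrix_vector_right_distrib vector_scalar_commute B\<alpha>)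
        then have "b = 0" using nz[OF P] by simp
        then have "v P = a *s (n P *s ?\<alpha>) + ?x" using ab(3) by (simp add: diff_eq_eq)
        also have "\<dots> \<in> ?F" by (intro submodule_add[OF modF] submodule_scale[OF modF ab(1) nF] xF)
        finally show ?thesis .
      qed
      then have "free_stalk P (columns2 (n P *s ?\<alpha>) (v P)) \<subseteq> ?F"
      proof (intro free_stalk_subset_submodule[OF modF])
        show "column i (columns2 (n P *s ?\<alpha>) (v P)) \<in> ?F" if "v P \<in> ?F" for i
          using exhaust_2[of i] nF that by (auto simp: columns2_column)
      qed
      then show "V P \<subseteq> ?F" using v[OF P] by simp
    qed
    then show ?thesis using TW by simp
  qed
  have "bundle_iso_by X V ?W T'"
    unfolding bundle_iso_by_def
  proof (intro conjI ballI)
    show "invertible T'" using T' unfolding invertible_def by blast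
    fix P assume P: "P \<in> X"
    have "(\<lambda>v. T' *v v) ` V P = (\<lambda>v. T' *v (T *v v)) ` ?W P"
      unfolding TW[OF P, symmetric] image_image ..
    then show "(\<lambda>v. T' *v v) ` V P = ?W P" by (simp add: matrix_vector_mul_assoc T')
  qed
  then show ?thesis using W unfolding bundle_iso_def by blast
qed

end

theorem theorem2:
  fixes emb :: "'k::alg_closed_field \<Rightarrow> 'a::field"
    and X :: "'a set set"
    and L\<^sub>\<theta> :: "('a, 1) subsheaf"
    and p :: nat
  assumes "function_field emb"
    and "X = curve emb"
    and "genus emb = 2"
    and "theta_characteristic emb L\<^sub>\<theta>"
    and "CHAR('k) = p"
    and "p = 2"
  shows "(\<forall>C \<in> higgs_moduli X L\<^sub>\<theta> L\<^sub>\<theta>. \<forall>(V, \<phi>) \<in> C.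
            (\<exists>C' \<in> bundle_moduli X L\<^sub>\<theta>. V \<in> C') \<or>
            (\<exists>W \<in> J2 X (direct_sum structure_sheaf L\<^sub>\<theta>). bundle_iso X V W))
       \<and> (\<exists>\<phi>\<^sub>0. \<forall>W \<in> J2 X (direct_sum structure_sheaf L\<^sub>\<theta>).
            frobenius_semistable p X L\<^sub>\<theta> W \<phi>\<^sub>0)
       \<and> (\<forall>V\<^sub>1. nontrivial_extension X structure_sheaf V\<^sub>1 L\<^sub>\<theta> \<longrightarrow>
            (\<exists>\<phi>\<^sub>1. \<forall>V \<in> J2 X V\<^sub>1. frobenius_semistable p X L\<^sub>\<theta> V \<phi>\<^sub>1))"
proof -
  interpret fun_field emb using assms(1) by unfold_locales
  have line: "line_bundle X L\<^sub>\<theta>" and degree: "bundle_degree X L\<^sub>\<theta> = 1"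
    using assms(2,4) unfolding theta_characteristic_def by auto
  obtain l where l: "generated_by L\<^sub>\<theta> l" using ex_generators line assms(2) by blast
  have deg_l: "idele_degree l = 1" using bundle_degree_line[OF l] degree assms(2) by simp
  have "of_nat 2 = (0 :: 'k)" using assms(5,6) of_nat_CHAR[where 'a = 'k] by simp
  then have "(2 :: 'a) = 0" using emb_add[of 1 1] by (simp add: emb_one emb_zero)
  then have two: "2 * x = 0" for x :: 'a by simp
  \<comment> \<open>The mixed term 2 x y vanishes, as 2 = 0 passes from k to the function field
    along \<open>emb\<close>.\<close>
  have p: "(x + y) ^ p = x ^ p + y ^ p" "p > 0" for x y :: 'a
    using assms(6) two[of "x * y"] by (simp_all add: power2_sum mult.assoc)

  have 1: "(\<exists>C' \<in> bundle_moduli X L\<^sub>\<theta>. V \<in> C') \<or>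
      (\<exists>W \<in> J2 X (direct_sum structure_sheaf L\<^sub>\<theta>). bundle_iso X V W)"
    if C: "C \<in> higgs_moduli X L\<^sub>\<theta> L\<^sub>\<theta>" "(V, \<phi>) \<in> C" for C V \<phi>
  proof -
    have "higgs_semistable X L\<^sub>\<theta> V \<phi>" "bundle_iso X (det_bundle V) L\<^sub>\<theta>"
      using C unfolding higgs_moduli_def Let_def quotient_def by auto
    then show ?thesis
      using semistable_in_moduli[of V, OF _ _ l deg_l] unstable_higgs_splits[of _ V, OF _ _ l deg_l]
      unfolding assms(2) by metis
  qed

  \<comment> \<open>One Higgs field serves all twists: V and its twists lie in the same generic
    fibre, on which \<open>A ** B\<close> acts.\<close>
  have 2: "frobenius_semistable p X L\<^sub>\<theta> W (A ** B)"
    if W: "W \<in> J2 X V" and "vector_bundle X V" "column 1 A \<noteq> 0" "B *v column 1 A = 0"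
      "\<And>P. P \<in> X \<Longrightarrow> V P = free_stalk P (columns2 (column 1 A) (v P)) \<and> (B *v v P) $ 1 = l P"
    for W V v and A :: "'a ^ 1 ^ 2" and B :: "'a ^ 2 ^ 1"
  proof -
    obtain M where M: "W = twist V M" "line_bundle X M" "bundle_degree X M = 0"
      using W unfolding J2_def by blast
    show ?thesis
      unfolding M(1) using that M l deg_l unfolding assms(2)
      by (intro frobenius_semistable_twist[where v = v and l = l] p) auto
  qed

  have 3: "\<exists>\<phi>\<^sub>0. \<forall>W \<in> J2 X (direct_sum structure_sheaf L\<^sub>\<theta>). frobenius_semistable p X L\<^sub>\<theta> W \<phi>\<^sub>0"
  proof -
    \<comment> \<open>Inclusion of the first summand and projection to the second; their product is
      the matrix with a single entry 1 in the upper right corner.\<close>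
    define A :: "'a ^ 1 ^ 2" where "A = (\<chi> i j. if i = 1 then 1 else 0)"
    define B :: "'a ^ 2 ^ 1" where "B = (\<chi> i j. if j = 1 then 0 else 1)"
    have A: "column 1 A = vector [1, 0]" by (simp add: A_def column_def vec_eq_iff forall_2)
    have "frobenius_semistable p X L\<^sub>\<theta> W (A ** B)"
      if W: "W \<in> J2 X (direct_sum structure_sheaf L\<^sub>\<theta>)" for W
    proof (rule 2[OF W vector_bundle_direct_sum[OF line]])
      show "column 1 A \<noteq> 0" by (simp add: A vec_eq_iff forall_2)
      show "B *v column 1 A = 0"
        by (simp add: A B_def vec_eq_iff forall_1 matrix_vector_mult_def sum_2)
      fix P assume "P \<in> X"
      then have "L\<^sub>\<theta> P = principal_stalk P (l P)" using l assms(2) unfolding generated_by_def by blast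
      then show "direct_sum structure_sheaf L\<^sub>\<theta> P = free_stalk P (columns2 (column 1 A) (vector [0, l P])) \<and>
          (B *v vector [0, l P]) $ 1 = l P"
        unfolding A by (intro conjI direct_sum_stalk) (simp_all add: B_def matrix_vector_mult_def sum_2)
    qed
    then show ?thesis by blast
  qed

  have 4: "\<exists>\<phi>\<^sub>1. \<forall>V \<in> J2 X V\<^sub>1. frobenius_semistable p X L\<^sub>\<theta> V \<phi>\<^sub>1"
    if ext: "nontrivial_extension X structure_sheaf V\<^sub>1 L\<^sub>\<theta>" for V\<^sub>1
  proof -
    obtain A B where V: "vector_bundle X V\<^sub>1" and ex: "short_exact X structure_sheaf A V\<^sub>1 B L\<^sub>\<theta>"
      using ext unfolding nontrivial_extension_def by blast
    \<comment> \<open>Since the structure sheaf has the generator 1 everywhere, the adapted basis of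
      each stalk starts with \<open>column 1 A\<close> itself, as the common criterion
      demands.\<close>
    have O: "generated_by structure_sheaf (\<lambda>P. 1)"
      unfolding generated_by_def by (simp add: structure_sheaf_stalk idele_const)
    obtain v where "B *v column 1 A = 0" "column 1 A \<noteq> 0"
      "\<And>P. P \<in> X \<Longrightarrow> v P \<in> V\<^sub>1 P \<and> (B *v v P) $ 1 = l P \<and>
        V\<^sub>1 P = free_stalk P (columns2 (1 *s column 1 A) (v P))"
      using extension_stalks[OF ex[unfolded assms(2)] V[unfolded assms(2)] O l] assms(2) by metis
    then have "frobenius_semistable p X L\<^sub>\<theta> W (A ** B)" if "W \<in> J2 X V\<^sub>1" for W
      using that V by (intro 2[of W V\<^sub>1 A B v]) auto
    then show ?thesis by blast
  qed
  show ?thesis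
  proof (intro conjI ballI allI impI 3 4)
    fix C x assume "C \<in> higgs_moduli X L\<^sub>\<theta> L\<^sub>\<theta>" "x \<in> C"
    then show "case x of (V, \<phi>) \<Rightarrow> (\<exists>C' \<in> bundle_moduli X L\<^sub>\<theta>. V \<in> C') \<or>
        (\<exists>W \<in> J2 X (direct_sum structure_sheaf L\<^sub>\<theta>). bundle_iso X V W)"
      using 1[of C "fst x" "snd x"] by (simp only: case_prod_unfold prod.collapse)
  qed
qed

end
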